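(* Let $\mathcal A_q=\mathcal A_q(\underline x=(X_1,\dots,X_r),B,L,G)$ be a graded quantum cluster algebra. Let $\underline t=(t_1,\dots,t_r)^T\in\mathbb{Z}^r$ and $\underline u=(u_1,\dots,u_r)^T\in\mathbb{Z}^r$ be gradings for $B$, i.e. $B_i\underline t=B_i\underline u=0$ for every mutable index $i$, where $B_i$ is the $i$th row of $B$. Let $\tau:\mathcal A_q\to\mathcal A_q$ be the algebra automorphism induced by $\underline t$, i.e. such that $\tau(X_i)=q^{t_i}X_i$ for $1\le i\le r$, and let $\mathcal A_q[z^{\pm1};\tau]$ be the corresponding skew-Laurent extension. Then the following initial data determine a graded quantum cluster algebra $\tilde{\mathcal A}_q^{\underline t,\underline u}=\mathcal A_q(\underline{\tilde x},\tilde B,\tilde L,\tilde G)$ (with the same mutable indices): - $\underline{\tilde x}=(q^{\frac{t_1u_1}{2}}X_1z^{u_1},\dots,q^{\frac{t_ru_r}{2}}X_rz^{u_r})$, - $\tilde B=B$, - $\tilde L=L-\underline t\wedge\underline u$, - $\tilde G=G+\underline u$, and $\tilde{\mathcal A}_q^{\underline t,\underline u}$ is a subalgebra of $\mathcal A_q[z^{\pm1};\tau]$.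
   Context: $\mathbb{K}=\mathbb{Q}(q^{1/2})$. A quantum seed $(\underline{x},B,L)$ of cardinality $r$, with a fixed subset of $\{1,\dots,r\}$ of mutable indices (the others are frozen), consists of: a skew-symmetric integer matrix $L=(l_{ij})$; a tuple $\underline{x}=(X_1,\dots,X_r)$ generating, as a skew-field over $\mathbb{K}$, the skew-field of fractions $\mathcal F$ of the quantum torus with generators $X_i^{\pm1}$ and relations $X_iX_j=q^{l_{ij}}X_jX_i$; and a skew-symmetric integer $r\times r$ matrix $B=(b_{ij})$ with $b_{ij}=0$ if $i,j$ are both frozen, compatible with $L$: for some positive integer $d$, $\sum_k b_{ki}l_{kj}=d\delta_{ij}$ for all mutable $i$ and all $j$. For $\underline a\in\mathbb{Z}^r$ put $M(\underline a)=q^{\frac12\sum_{i<j}a_ia_jl_{ji}}X_1^{a_1}\cdots X_r^{a_r}$. For mutable $k$ put $\underline b_k^+=-\underline e_k+\sum_{b_{ik}>0}b_{ik}\underline e_i$, $\underline b_k^-=-\underline e_k-\sum_{b_{ik}<0}b_{ik}\underline e_i$. Mutation in direction $k$ replaces $X_k$ by $X_k'=M(\underline b_k^+)+M(\underline b_k^-)$, leaves the other $X_i$ unchanged, and replaces $B,L$ by $EBE^T$ (entries with both indices frozen reset to $0$) and $E^TLE$, where $E_{rs}=\delta_{rs}$ if $s\ne k$, $E_{kk}=-1$, $E_{rk}=\max(0,-b_{rk})$ if $r\neq k$. The quantum cluster variables are all entries (including frozen ones) of all seeds obtained from the initial one by iterated mutation; the quantum cluster algebra $\mathcal A_q(\underline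 x,B,L)$ is the $\mathbb{K}$-subalgebra of $\mathcal F$ they generate. A grading for $B$ is $G\in\mathbb{Z}^r$ with $B_iG=0$ for all mutable $i$ ($B_i$ the $i$th row); a graded quantum seed is $(\underline x,B,L,G)$ with $G$ a grading for $B$, and $\mathcal A_q(\underline x,B,L,G)$ denotes the associated quantum cluster algebra, called graded, with $\deg X_i=G_i$. Gradings mutate along with seeds: $G'_i=G_i$ for $i\ne k$ and $G_k'=\underline b_k^-\cdot G=\underline b_k^+\cdot G$. For $\underline t,\underline u\in\mathbb{Z}^r$, $\underline t\wedge\underline u$ is the skew-symmetric matrix with $(i,j)$-entry $t_iu_j-t_ju_i$. In the skew-Laurent extension $A[z^{\pm1};\tau]$ one has $za=\tau(a)z$ for $a\in A$. *)

theory Defs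
  imports
    "HOL-Analysis.Cartesian_Space"
    "HOL-Computational_Algebra.Fraction_Field"
    "HOL-Computational_Algebra.Polynomial"
    "HOL-Algebra.Algebraic_Closure_Type"
begin

(* frees the infix $ for vector components *)
unbundle no Formal_Power_Series.fps_syntax

section \<open>The ground field and algebras over it\<close>

text \<open>The ground field is \<open>\<rat>(q\<^bsup>1/2\<^esup>)\<close>, realised as the rational functions over \<open>\<rat>\<close> in the
  indeterminate \<open>q\<^bsup>1/2\<^esup>\<close>. Thus \<open>q_param\<close> is \<open>q\<close>, and \<open>q_half powi m\<close> is \<open>q\<^bsup>m/2\<^esup>\<close>.\<close>

type_synonym qfield = "rat poly fract"

definition q_half :: qfield
  where "q_half = Fract [:0, 1:] 1"

definition q_param :: qfield
  where "q_param = q_half ^ 2"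

text \<open>The locale \<open>algebra\<close> of HOL-Algebra is restricted to commutative algebras.\<close>

locale K_algebra = Module.module "ring_of_type_algebra :: qfield ring" A + ring A
  for A :: "(qfield, 'a) module" (structure) +
  assumes smult_mult_left:
      "\<lbrakk>x \<in> carrier A; y \<in> carrier A\<rbrakk> \<Longrightarrow> (c \<odot> x) \<otimes> y = c \<odot> (x \<otimes> y)"
    and smult_mult_right:
      "\<lbrakk>x \<in> carrier A; y \<in> carrier A\<rbrakk> \<Longrightarrow> x \<otimes> (c \<odot> y) = c \<odot> (x \<otimes> y)"

definition K_algebra_hom :: "(qfield, 'a) module \<Rightarrow> (qfield, 'b) module \<Rightarrow> ('a \<Rightarrow> 'b) set"
  where "K_algebra_hom A C =
    {h \<in> ring_hom A C. \<forall>c. \<forall>x \<in> carrier A. h (c \<odot>\<^bsub>A\<^esub> x) = c \<odot>\<^bsub>C\<^esub> h x}"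

definition K_algebra_automorphism :: "(qfield, 'a) module \<Rightarrow> ('a \<Rightarrow> 'a) \<Rightarrow> bool"
  where "K_algebra_automorphism A h \<longleftrightarrow>
    h \<in> K_algebra_hom A A \<and> bij_betw h (carrier A) (carrier A)"

definition K_subalgebra :: "'a set \<Rightarrow> (qfield, 'a) module \<Rightarrow> bool"
  where "K_subalgebra H A \<longleftrightarrow> subring H A \<and> (\<forall>c. \<forall>x \<in> H. c \<odot>\<^bsub>A\<^esub> x \<in> H)"

definition K_subalgebra_generated :: "(qfield, 'a) module \<Rightarrow> 'a set \<Rightarrow> 'a set"
  where "K_subalgebra_generated A S = \<Inter>{H. K_subalgebra H A \<and> S \<subseteq> H}"


section \<open>Skew-fields over the ground field\<close>

locale K_skew_field = K_algebra +
  assumes Units_eq: "Units A = carrier A - {\<zero>}"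

definition K_skew_subfield_generated :: "(qfield, 'a) module \<Rightarrow> 'a set \<Rightarrow> 'a set"
  where "K_skew_subfield_generated D S =
    \<Inter>{H. K_subalgebra H D \<and> (\<forall>x \<in> H - {\<zero>\<^bsub>D\<^esub>}. inv\<^bsub>D\<^esub> x \<in> H) \<and> S \<subseteq> H}"

text \<open>The skew-field of fractions of an Ore domain \<open>R\<close>, given by its embedding \<open>\<phi>\<close> into a
  skew-field all of whose elements are right fractions of elements of \<open>R\<close>; this determines
  \<open>(F, \<phi>)\<close> up to a unique isomorphism.\<close>

definition skew_field_of_fractions ::
    "(qfield, 'b) module \<Rightarrow> (qfield, 'a) module \<Rightarrow> ('b \<Rightarrow> 'a) \<Rightarrow> bool"
  where "skew_field_of_fractions R F \<phi> \<longleftrightarrow>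
    K_algebra R \<and> K_skew_field F \<and>
    \<phi> \<in> K_algebra_hom R F \<and> inj_on \<phi> (carrier R) \<and>
    (\<forall>y \<in> carrier F. \<exists>a \<in> carrier R. \<exists>b \<in> carrier R - {\<zero>\<^bsub>R\<^esub>}.
        y = \<phi> a \<otimes>\<^bsub>F\<^esub> inv\<^bsub>F\<^esub> (\<phi> b))"


section \<open>Quantum tori\<close>

text \<open>The quantum torus is the twisted group algebra of \<open>\<int>\<^sup>r\<close>: it has a basis of symbols
  \<open>M(a)\<close>, \<open>a \<in> \<int>\<^sup>r\<close>, with \<open>M(a) M(b) = q\<^bsup>h/2\<^esup> M(a + b)\<close>, \<open>h = \<Sum>\<^sub>i\<^sub>j a\<^sub>i L\<^sub>i\<^sub>j b\<^sub>j\<close>. Its generators \<open>X\<^sub>i = M(e\<^sub>i)\<close>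
  satisfy \<open>X\<^sub>i X\<^sub>j = q\<^bsup>l(i,j)\<^esup> X\<^sub>j X\<^sub>i\<close> when \<open>L\<close> is skew-symmetric. The index set \<open>{1,\<dots>,r}\<close> is the
  finite linearly ordered type \<open>'n\<close>, and \<open>f\<close> stands for \<open>\<Sum>\<^sub>a f(a) M(a)\<close>.\<close>

definition quantum_torus :: "int^'n^'n \<Rightarrow> (qfield, int^'n \<Rightarrow> qfield) module"
  where "quantum_torus L = \<lparr>
    carrier = {f. finite {a. f a \<noteq> 0}},
    monoid.mult = (\<lambda>f g c. \<Sum>a | f a \<noteq> 0.
      q_half powi (\<Sum>i\<in>UNIV. \<Sum>j\<in>UNIV. a $ i * L $ i $ j * (c - a) $ j) * f a * g (c - a)),
    one = (\<lambda>c. if c = 0 then 1 else 0),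
    zero = (\<lambda>c. 0),
    add = (\<lambda>f g c. f c + g c),
    module.smult = (\<lambda>s f c. s * f c)\<rparr>"

definition torus_gen :: "'n \<Rightarrow> int^'n \<Rightarrow> qfield"
  where "torus_gen i = (\<lambda>c. if c = axis i 1 then 1 else 0)"


section \<open>Quantum seeds, gradings and mutation\<close>

definition skew_symmetric :: "int^'n^'n \<Rightarrow> bool"
  where "skew_symmetric A \<longleftrightarrow> transpose A = - A"

text \<open>\<open>mut\<close> is always the set of mutable indices; the other indices are frozen.\<close>

definition is_grading :: "'n set \<Rightarrow> int^'n^'n \<Rightarrow> int^'n \<Rightarrow> bool"
  where "is_grading mut B G \<longleftrightarrow> (\<forall>i \<in> mut. (B *v G) $ i = 0)"

definition compatible :: "'n set \<Rightarrow> int^'n^'n \<Rightarrow> int^'n^'n \<Rightarrow> bool"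
  where "compatible mut B L \<longleftrightarrow>
    (\<exists>d > 0. \<forall>i \<in> mut. \<forall>j. (\<Sum>k\<in>UNIV. B $ k $ i * L $ k $ j) = (if i = j then d else 0))"

record ('n, 'a) seed =
  cluster :: "'n \<Rightarrow> 'a"
  exch :: "int^'n^'n"
  qform :: "int^'n^'n"
  grading :: "int^'n"

definition graded_quantum_seed ::
    "(qfield, 'a) module \<Rightarrow> 'n set \<Rightarrow> ('n::{finite,linorder}, 'a) seed \<Rightarrow> bool"
  where "graded_quantum_seed F mut S \<longleftrightarrow>
    skew_symmetric (qform S) \<and>
    (\<exists>\<phi>. skew_field_of_fractions (quantum_torus (qform S)) F \<phi> \<and>
         (\<forall>i. \<phi> (torus_gen i) = cluster S i)) \<and>
    skew_symmetric (exch S) \<and>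
    (\<forall>i j. i \<notin> mut \<and> j \<notin> mut \<longrightarrow> exch S $ i $ j = 0) \<and>
    compatible mut (exch S) (qform S) \<and>
    is_grading mut (exch S) (grading S)"

text \<open>\<open>qmonomial F x L a\<close> is \<open>M(a)\<close> formed with the tuple \<open>x\<close>; the product runs over the indices in
  increasing order.\<close>

definition qmonomial ::
    "(qfield, 'a) module \<Rightarrow> ('n \<Rightarrow> 'a) \<Rightarrow>
     int^('n::{finite,linorder})^('n::{finite,linorder}) \<Rightarrow> int^('n::{finite,linorder}) \<Rightarrow> 'a"
  where "qmonomial F x L a =
    q_half powi (\<Sum>j\<in>UNIV. \<Sum>i | i < j. a $ i * a $ j * L $ j $ i) \<odot>\<^bsub>F\<^esub>
    foldr (\<lambda>i y. (x i [^]\<^bsub>F\<^esub> a $ i) \<otimes>\<^bsub>F\<^esub> y) (sorted_list_of_set UNIV) \<one>\<^bsub>F\<^esub>"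

definition b_plus :: "int^'n^'n \<Rightarrow> 'n \<Rightarrow> int^'n"
  where "b_plus B k = - axis k 1 + (\<Sum>i | B $ i $ k > 0. axis i (B $ i $ k))"

definition b_minus :: "int^'n^'n \<Rightarrow> 'n \<Rightarrow> int^'n"
  where "b_minus B k = - axis k 1 - (\<Sum>i | B $ i $ k < 0. axis i (B $ i $ k))"

definition mutation_matrix :: "int^'n^'n \<Rightarrow> 'n \<Rightarrow> int^'n^'n"
  where "mutation_matrix B k = (\<chi> i j.
    if j \<noteq> k then (if i = j then 1 else 0)
    else if i = k then - 1
    else max 0 (- (B $ i $ k)))"

definition reset_frozen :: "'n set \<Rightarrow> int^'n^'n \<Rightarrow> int^'n^'n"
  where "reset_frozen mut B = (\<chi> i j. if i \<notin> mut \<and> j \<notin> mut then 0 else B $ i $ j)"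

definition mutate ::
    "(qfield, 'a) module \<Rightarrow> 'n set \<Rightarrow> 'n \<Rightarrow> ('n::{finite,linorder}, 'a) seed \<Rightarrow> ('n, 'a) seed"
  where "mutate F mut k S =
    (let x = cluster S; B = exch S; L = qform S; G = grading S; E = mutation_matrix B k in
     \<lparr>cluster = x(k := qmonomial F x L (b_plus B k) \<oplus>\<^bsub>F\<^esub> qmonomial F x L (b_minus B k)),
      exch = reset_frozen mut (E ** B ** transpose E),
      qform = transpose E ** L ** E,
      grading = (\<chi> i. if i = k then (\<Sum>j\<in>UNIV. b_minus B k $ j * G $ j) else G $ i)\<rparr>)"

inductive_set mutation_class ::
    "(qfield, 'a) module \<Rightarrow> 'n set \<Rightarrow> ('n::{finite,linorder}, 'a) seed \<Rightarrow> ('n, 'a) seed set"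
  for F mut S where
    initial: "S \<in> mutation_class F mut S"
  | step: "T \<in> mutation_class F mut S \<Longrightarrow> k \<in> mut \<Longrightarrow> mutate F mut k T \<in> mutation_class F mut S"

definition quantum_cluster_variables ::
    "(qfield, 'a) module \<Rightarrow> 'n set \<Rightarrow> ('n::{finite,linorder}, 'a) seed \<Rightarrow> 'a set"
  where "quantum_cluster_variables F mut S = {cluster T i | T i. T \<in> mutation_class F mut S}"

definition quantum_cluster_algebra ::
    "(qfield, 'a) module \<Rightarrow> 'n set \<Rightarrow> ('n::{finite,linorder}, 'a) seed \<Rightarrow> (qfield, 'a) module"
  where "quantum_cluster_algebra F mut S =
    F\<lparr>carrier := K_subalgebra_generated F (quantum_cluster_variables F mut S)\<rparr>"


section \<open>Skew-Laurent extensions\<close>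

definition aut_pow :: "(qfield, 'a) module \<Rightarrow> ('a \<Rightarrow> 'a) \<Rightarrow> int \<Rightarrow> 'a \<Rightarrow> 'a"
  where "aut_pow A \<tau> m =
    (if m \<ge> 0 then \<tau> ^^ nat m else inv_into (carrier A) \<tau> ^^ nat (- m))"

text \<open>\<open>f\<close> stands for \<open>\<Sum>\<^sub>m f(m) z\<^sup>m\<close>; since \<open>z a = \<tau>(a) z\<close>, one has
  \<open>a z\<^sup>m b z\<^sup>n = a \<tau>\<^sup>m(b) z\<^bsup>m+n\<^esup>\<close>.\<close>

definition skew_laurent ::
    "(qfield, 'a) module \<Rightarrow> ('a \<Rightarrow> 'a) \<Rightarrow> (qfield, int \<Rightarrow> 'a) module"
  where "skew_laurent A \<tau> = \<lparr>
    carrier = {f. (\<forall>m. f m \<in> carrier A) \<and> finite {m. f m \<noteq> \<zero>\<^bsub>A\<^esub>}},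
    monoid.mult = (\<lambda>f g n. \<Oplus>\<^bsub>A\<^esub>m \<in> {m. f m \<noteq> \<zero>\<^bsub>A\<^esub>}. f m \<otimes>\<^bsub>A\<^esub> aut_pow A \<tau> m (g (n - m))),
    one = (\<lambda>n. if n = 0 then \<one>\<^bsub>A\<^esub> else \<zero>\<^bsub>A\<^esub>),
    zero = (\<lambda>n. \<zero>\<^bsub>A\<^esub>),
    add = (\<lambda>f g n. f n \<oplus>\<^bsub>A\<^esub> g n),
    module.smult = (\<lambda>c f n. c \<odot>\<^bsub>A\<^esub> f n)\<rparr>"

text \<open>The element \<open>a z\<^sup>m\<close>.\<close>

definition laurent_monom :: "(qfield, 'a) module \<Rightarrow> 'a \<Rightarrow> int \<Rightarrow> int \<Rightarrow> 'a"
  where "laurent_monom A a m = (\<lambda>n. if n = m then a else \<zero>\<^bsub>A\<^esub>)"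


section \<open>The twisted initial data\<close>

definition wedge :: "int^'n \<Rightarrow> int^'n \<Rightarrow> int^'n^'n"
  where "wedge t u = (\<chi> i j. t $ i * u $ j - t $ j * u $ i)"

definition twisted_seed ::
    "(qfield, 'a) module \<Rightarrow> ('a \<Rightarrow> 'a) \<Rightarrow> ('n, 'a) seed \<Rightarrow> int^'n \<Rightarrow> int^'n \<Rightarrow>
     ('n, int \<Rightarrow> 'a) seed"
  where "twisted_seed A \<tau> S t u =
    \<lparr>cluster = (\<lambda>i. q_half powi (t $ i * u $ i) \<odot>\<^bsub>skew_laurent A \<tau>\<^esub>
                     laurent_monom A (cluster S i) (u $ i)),
     exch = exch S,
     qform = qform S - wedge t u,
     grading = grading S + u\<rparr>"

definition map_seed :: "('a \<Rightarrow> 'b) \<Rightarrow> ('n::finite, 'a) seed \<Rightarrow> ('n, 'b) seed"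
  where "map_seed h S =
    \<lparr>cluster = h \<circ> cluster S, exch = exch S, qform = qform S, grading = grading S\<rparr>"

end

theory Submission
  imports Defs
begin

text \<open>The heart of the matter is that \<open>x \<mapsto> q\<^bsup>tu/2\<^esup> x z\<^sup>u\<close>, applied to eigenvectors \<open>x\<close> of \<open>\<tau>\<close>
  with eigenvalue \<open>q\<^sup>t\<close>, is multiplicative up to the power of \<open>q\<^bsup>1/2\<^esup>\<close> by which \<open>L - t \<and> u\<close>
  differs from \<open>L\<close>. Hence it carries quantum monomials with nonnegative exponents to quantum monomials,
  and, since \<open>t\<close> and \<open>u\<close> are gradings, also the two-term products \<open>X\<^sub>k X\<^sub>k'\<close> to their twisted
  counterparts; cancelling \<open>X\<^sub>k\<close> shows that twisting commutes with mutation, so that every cluster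
  variable of the twisted seed lies in the skew-Laurent ring.

  It remains to see that the subfield generated by the twisted cluster is the skew-field of fractions of
  the quantum torus of \<open>L - t \<and> u\<close>. Its monomials are linearly independent: after multiplication by a
  monomial all exponents are nonnegative, and one compares coefficients of powers of \<open>z\<close>. A quantum
  torus has polynomial growth, so counting dimensions gives the Ore condition, and right fractions
  exhaust the subfield.\<close>

section \<open>Integer bilinear forms and mutation matrices\<close>

text \<open>The automorphism \<open>\<tau>\<close> is given on the cluster algebra only. An element
  can be twisted when it lies there and is an eigenvector, which fails in general for inverses of
  cluster variables; this is why nonnegative exponents are singled out throughout. The factor
  \<open>q^(tu/2)\<close> balances the two sides of a product. For an eigenvector \<open>x'\<close>
  of degree \<open>t'\<close> the rule \<open>z^u x' = q^(u t') x' z^u\<close> is one-sided; after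
  normalisation it leaves the antisymmetric exponent \<open>(u t' - t u')/2\<close>, which is what
  \<open>- wedge t u\<close> contributes to a product of quantum monomials. What is carried along a
  sequence of mutations is stronger than membership in the skew-Laurent ring: each seed has its own
  pair of gradings, obtained from the initial pair by transposed mutation matrices, and each twisted
  variable is the twist of the untwisted one with respect to the current pair.\<close>

definition dot :: "int^'n \<Rightarrow> int^'n \<Rightarrow> int"
  where "dot a b = (\<Sum>i\<in>UNIV. a $ i * b $ i)"

definition bil :: "int^'n^'n \<Rightarrow> int^'n \<Rightarrow> int^'n \<Rightarrow> int"
  where "bil L a b = (\<Sum>i\<in>UNIV. \<Sum>j\<in>UNIV. a $ i * L $ i $ j * b $ j)"

lemma dot_add_right: "dot a (b + c) = dot a b + dot a c"
  by (simp add: dot_def algebra_simps sum.distrib)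

lemma dot_zero_right [simp]: "dot a 0 = 0"
  by (simp add: dot_def)

lemma dot_axis_right [simp]: "dot a (axis i 1) = a $ i"
  by (simp add: dot_def axis_def if_distrib cong: if_cong)

lemma bil_axis_left: "bil L (axis i 1) b = (\<Sum>j\<in>UNIV. L $ i $ j * b $ j)"
proof -
  have "(\<Sum>j\<in>UNIV. axis i 1 $ i' * L $ i' $ j * b $ j) =
      (if i' = i then \<Sum>j\<in>UNIV. L $ i $ j * b $ j else 0)" for i'
    by (simp add: axis_def)
  then show ?thesis by (simp add: bil_def)
qed

lemma bil_axis_axis [simp]: "bil L (axis i 1) (axis j 1) = L $ i $ j"
  unfolding bil_axis_left by (simp add: axis_def if_distrib cong: if_cong)

lemma skew_symmetric_nth: "skew_symmetric L \<Longrightarrow> L $ j $ i = - L $ i $ j"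
proof -
  assume "skew_symmetric L"
  then have "transpose L $ i $ j = (- L) $ i $ j" by (simp only: skew_symmetric_def)
  then show ?thesis by (simp only: transpose_def vec_lambda_beta vector_uminus_component)
qed

lemma skew_symmetric_diag: "skew_symmetric L \<Longrightarrow> L $ i $ i = 0"
  using skew_symmetric_nth[of L i i] by linarith

lemma bil_skew: assumes "skew_symmetric L" shows "bil L b a = - bil L a b"
proof -
  have "bil L b a = (\<Sum>j\<in>UNIV. \<Sum>i\<in>UNIV. b $ i * L $ i $ j * a $ j)"
    unfolding bil_def by (rule sum.swap)
  also have "\<dots> = (\<Sum>j\<in>UNIV. \<Sum>i\<in>UNIV. - (a $ j * L $ j $ i * b $ i))"
  proof (intro sum.cong refl)
    fix i j show "b $ i * L $ i $ j * a $ j = - (a $ j * L $ j $ i * b $ i)"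
      unfolding skew_symmetric_nth[OF assms, of j i] by (simp only: mult_minus_right mult_minus_left mult_ac minus_minus)
  qed
  finally show ?thesis by (simp add: bil_def sum_negf)
qed

text \<open>The correction is the exponent that \<open>twist_mult\<close> yields for factors of
  degrees \<open>dot t a\<close>, \<open>dot u a\<close> and \<open>dot t b\<close>,
  \<open>dot u b\<close>; this match is the reason for the form
  \<open>L - wedge t u\<close>.\<close>

lemma bil_wedge: "bil (L - wedge t u) a b = bil L a b - dot t a * dot u b + dot u a * dot t b"
proof -
  have *: "dot x a * dot y b = (\<Sum>i\<in>UNIV. \<Sum>j\<in>UNIV. a $ i * (x $ i * y $ j) * b $ j)" for x y
    by (simp add: dot_def sum_product algebra_simps)
  show ?thesis
    unfolding * bil_def wedge_def by (simp add: algebra_simps sum.distrib sum_subtractf)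
qed

lemma skew_symmetric_wedge: "skew_symmetric (wedge t u)"
  by (simp add: skew_symmetric_def transpose_def wedge_def vec_eq_iff)

lemma transpose_diff_int: "transpose (A - B) = transpose A - (transpose B :: int^'n^'n)"
  by (simp add: transpose_def vec_eq_iff)

lemma skew_symmetric_diff: "skew_symmetric L \<Longrightarrow> skew_symmetric K \<Longrightarrow> skew_symmetric (L - K)"
  by (simp add: skew_symmetric_def transpose_diff_int)

lemma b_plus_nth: "b_plus B k $ i = - (if i = k then 1 else 0) + max 0 (B $ i $ k)"
proof -
  have "(\<Sum>j | 0 < B $ j $ k. axis j (B $ j $ k) $ i) =
      (\<Sum>j | 0 < B $ j $ k. if j = i then B $ i $ k else 0)"
    by (rule sum.cong) (auto simp: axis_def)
  also have "\<dots> = max 0 (B $ i $ k)" by (simp add: max_def)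
  finally show ?thesis by (simp add: b_plus_def axis_def sum_component)
qed

lemma b_minus_nth: "b_minus B k $ i = - (if i = k then 1 else 0) + max 0 (- (B $ i $ k))"
proof -
  have "(\<Sum>j | B $ j $ k < 0. axis j (B $ j $ k) $ i) =
      (\<Sum>j | B $ j $ k < 0. if j = i then B $ i $ k else 0)"
    by (rule sum.cong) (auto simp: axis_def)
  also have "\<dots> = - max 0 (- (B $ i $ k))" by (simp add: max_def)
  finally show ?thesis by (simp add: b_minus_def axis_def sum_component)
qed

text \<open>The only possibly negative entry of either vector is in position \<open>k\<close>, where
  it is at least \<open>- 1\<close>. Multiplying an exchange relation by \<open>x k\<close>
  therefore removes every inverse.\<close>

lemma b_plus_minus_nonneg:
  "0 \<le> (axis k 1 + b_plus B k) $ i" "0 \<le> (axis k 1 + b_minus B k) $ i"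
  by (auto simp: b_plus_nth b_minus_nth axis_def)

text \<open>The two vectors differ by column \<open>k\<close> of \<open>B\<close>, which by
  skew-symmetry is minus row \<open>k\<close>, and a grading annihilates the mutable rows. So both
  exchange monomials have the same degree.\<close>

lemma dot_b_plus_minus:
  assumes "skew_symmetric B" "is_grading mut B G" "k \<in> mut"
  shows "dot G (b_plus B k) = dot G (b_minus B k)"
proof -
  have "dot G (b_plus B k) - dot G (b_minus B k) = (\<Sum>i\<in>UNIV. G $ i * B $ i $ k)"
    unfolding dot_def sum_subtractf[symmetric]
    by (rule sum.cong) (auto simp: b_plus_nth b_minus_nth max_def algebra_simps)
  also have "\<dots> = - (\<Sum>i\<in>UNIV. B $ k $ i * G $ i)"
    unfolding sum_negf[symmetric]
    by (intro sum.cong refl) (simp add: skew_symmetric_nth[OF assms(1), of _ k])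
  also have "\<dots> = 0"
    using assms(2,3) by (simp add: is_grading_def matrix_vector_mult_def)
  finally show ?thesis by simp
qed

text \<open>As \<open>b_plus - b_minus\<close> is column \<open>k\<close> of \<open>B\<close>,
  compatibility evaluates its pairing with \<open>L\<close>: zero for \<open>j \<noteq> k\<close>,
  so that both exchange monomials q-commute alike with \<open>x j\<close>, and off by
  \<open>d\<close> for \<open>j = k\<close>, so that \<open>x k\<close> tells them apart.\<close>

lemma bil_b_plus_minus:
  assumes "skew_symmetric L" "\<forall>j. (\<Sum>i\<in>UNIV. B $ i $ k * L $ i $ j) = (if k = j then d else 0)"
  shows "bil L (axis j 1) (b_minus B k) = bil L (axis j 1) (b_plus B k) + (if j = k then d else 0)"
proof -
  have "bil L (axis j 1) (b_plus B k) - bil L (axis j 1) (b_minus B k)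
      = (\<Sum>i\<in>UNIV. L $ j $ i * B $ i $ k)"
    unfolding bil_axis_left sum_subtractf[symmetric]
    by (rule sum.cong) (auto simp: b_plus_nth b_minus_nth max_def algebra_simps)
  also have "\<dots> = - (\<Sum>i\<in>UNIV. B $ i $ k * L $ i $ j)"
    unfolding sum_negf[symmetric]
    by (intro sum.cong refl) (simp add: skew_symmetric_nth[OF assms(1), of _ j])
  finally show ?thesis using assms(2) by auto
qed

section \<open>Mutation matrices and their action on forms and gradings\<close>

lemma mutation_matrix_diag [simp]: "mutation_matrix B k $ k $ k = - 1"
  by (simp add: mutation_matrix_def)

lemma mutation_matrix_vec:
  "(mutation_matrix B k *v w) $ i =
     mutation_matrix B k $ i $ k * w $ k + (if i = k then 0 else w $ i)"
proof -
  have "(mutation_matrix B k *v w) $ i =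
      (\<Sum>j\<in>UNIV. (if j = k then mutation_matrix B k $ i $ k * w $ k else 0) +
                  (if j = i then if i = k then 0 else w $ i else 0))"
    unfolding matrix_vector_mult_def vec_lambda_beta
    by (intro sum.cong refl) (auto simp: mutation_matrix_def)
  then show ?thesis by (simp add: sum.distrib)
qed

lemma matrix_mult_column: "(A ** B) $ i $ j = (A *v column j B) $ i"
  by (simp add: matrix_matrix_mult_def matrix_vector_mult_def column_def)

lemma mutation_matrix_mult_nth:
  "(mutation_matrix B k ** M) $ i $ j =
     mutation_matrix B k $ i $ k * M $ k $ j + (if i = k then 0 else M $ i $ j)"
  unfolding matrix_mult_column mutation_matrix_vec by (simp add: column_def)

text \<open>Off the diagonal only column \<open>k\<close> is nonzero, and squaring adds each such
  entry to its product with the diagonal entry \<open>- 1\<close>. Being its own inverse, the matrix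
  cancels between \<open>E B E^T\<close> and \<open>E^T L E\<close>.\<close>

lemma mutation_matrix_involution: "mutation_matrix B k ** mutation_matrix B k = mat 1"
  unfolding vec_eq_iff mutation_matrix_mult_nth
  by (auto simp: mat_def mutation_matrix_def)

lemma transpose_mutation_matrix_involution:
  "transpose (mutation_matrix B k) ** transpose (mutation_matrix B k) = mat 1"
  using mutation_matrix_involution[of B k] by (metis matrix_transpose_mul transpose_mat)

text \<open>Because of this column, \<open>transpose E ** L ** E\<close> and
  \<open>transpose E *v G\<close> read off \<open>L\<close> and \<open>G\<close> at the mutated
  exponents. Skew-symmetry supplies \<open>B $ k $ k = 0\<close>, without which entry
  \<open>k\<close> of \<open>b_minus\<close> could differ from \<open>- 1\<close>.\<close>

lemma mutation_matrix_column:
  assumes "skew_symmetric B"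
  shows "column k (mutation_matrix B k) = b_minus B k"
  using skew_symmetric_diag[OF assms, of k]
  by (auto simp: vec_eq_iff column_def mutation_matrix_def b_minus_nth)

lemma mutation_matrix_column_other:
  "j \<noteq> k \<Longrightarrow> column j (mutation_matrix B k) = axis j 1"
  by (auto simp: vec_eq_iff column_def mutation_matrix_def axis_def)

lemma congruence_nth: "(transpose E ** L ** E) $ i $ j = bil L (column i E) (column j E)"
proof -
  have "(transpose E ** L ** E) $ i $ j = (\<Sum>s\<in>UNIV. \<Sum>r\<in>UNIV. E $ r $ i * L $ r $ s * E $ s $ j)"
    by (simp add: matrix_matrix_mult_def transpose_def sum_distrib_right)
  also have "\<dots> = bil L (column i E) (column j E)"
    unfolding bil_def column_def by (subst sum.swap) simp
  finally show ?thesis .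
qed

lemma minus_matrix_mult: "(- A) ** B = - (A ** (B :: int^'m^'n))" "A ** (- B) = - (A ** B)"
  by (simp_all add: matrix_matrix_mult_def vec_eq_iff sum_negf)

lemma skew_symmetric_congruence: "skew_symmetric L \<Longrightarrow> skew_symmetric (transpose E ** L ** E)"
  by (simp add: skew_symmetric_def matrix_transpose_mul minus_matrix_mult matrix_mul_assoc)

lemma skew_symmetric_congruence': "skew_symmetric L \<Longrightarrow> skew_symmetric (E ** L ** transpose E)"
  using skew_symmetric_congruence[of L "transpose E"] by simp

lemma skew_symmetric_reset_frozen: "skew_symmetric B \<Longrightarrow> skew_symmetric (reset_frozen mut B)"
proof -
  assume B: "skew_symmetric B"
  show ?thesis
    unfolding skew_symmetric_def vec_eq_iff transpose_def
    by (simp add: reset_frozen_def skew_symmetric_nth[OF B, symmetric])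
qed

lemma reset_frozen_nth_mutable:
  "i \<in> mut \<Longrightarrow> reset_frozen mut B $ i $ j = B $ i $ j"
  "j \<in> mut \<Longrightarrow> reset_frozen mut B $ i $ j = B $ i $ j"
  by (auto simp: reset_frozen_def)

lemma transpose_mult_nth: "(transpose A ** B) $ i $ j = (\<Sum>k\<in>UNIV. A $ k $ i * B $ k $ j)"
  by (simp add: matrix_matrix_mult_def transpose_def)

lemma compatible_transpose:
  "compatible mut B L \<longleftrightarrow>
    (\<exists>d>0. \<forall>i\<in>mut. \<forall>j. (transpose B ** L) $ i $ j = (if i = j then d else 0))"
  by (simp add: compatible_def matrix_matrix_mult_def transpose_def)

text \<open>With \<open>E\<close> its own inverse, the product telescopes to
  \<open>E (B^T L) E\<close>. Mutable rows of \<open>B^T L\<close> are \<open>d\<close> times those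
  of the identity, and row \<open>i\<close> of \<open>E\<close> uses only rows \<open>i\<close> and
  \<open>k\<close>, both mutable, leaving \<open>d E E\<close>. Resetting frozen entries does not
  touch column \<open>i\<close>.\<close>

lemma compatible_mutation:
  assumes "compatible mut B L" "k \<in> mut"
  defines "E \<equiv> mutation_matrix B k"
  shows "compatible mut (reset_frozen mut (E ** B ** transpose E)) (transpose E ** L ** E)"
proof -
  obtain d where d: "d > 0"
    "\<And>i j. i \<in> mut \<Longrightarrow> (transpose B ** L) $ i $ j = (if i = j then d else 0)"
    using assms(1) unfolding compatible_transpose by blast
  define N where "N = transpose B ** L ** E"
  have N: "N $ i $ j = d * E $ i $ j" if "i \<in> mut" for i j
  proof -
    have "N $ i $ j = (\<Sum>s\<in>UNIV. (transpose B ** L) $ i $ s * E $ s $ j)"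
      by (simp add: N_def matrix_matrix_mult_def)
    then show ?thesis using d(2)[OF that] by (simp add: if_distrib if_distribR cong: if_cong)
  qed
  have "(transpose (reset_frozen mut (E ** B ** transpose E)) ** (transpose E ** L ** E)) $ i $ j
      = (if i = j then d else 0)" if i: "i \<in> mut" for i j
  proof -
    have "(transpose (reset_frozen mut (E ** B ** transpose E)) ** (transpose E ** L ** E)) $ i $ j
      = (transpose (E ** B ** transpose E) ** (transpose E ** L ** E)) $ i $ j"
      unfolding transpose_mult_nth by (simp only: reset_frozen_nth_mutable(2)[OF i])
    also have "transpose (E ** B ** transpose E) ** (transpose E ** L ** E)
        = E ** (transpose B ** (transpose E ** transpose E) ** L ** E)"
      by (simp add: matrix_transpose_mul matrix_mul_assoc)
    also have "\<dots> = E ** N"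
      by (simp add: E_def N_def transpose_mutation_matrix_involution)
    also have "(E ** N) $ i $ j = E $ i $ k * N $ k $ j + (if i = k then 0 else N $ i $ j)"
      by (simp add: E_def mutation_matrix_mult_nth)
    also have "\<dots> = d * (E ** E) $ i $ j"
      using N[OF i] N[OF assms(2)] unfolding E_def mutation_matrix_mult_nth
      by (simp add: algebra_simps)
    also have "\<dots> = (if i = j then d else 0)"
      by (simp add: E_def mutation_matrix_involution mat_def)
    finally show ?thesis .
  qed
  then show ?thesis unfolding compatible_transpose using d(1) by blast
qed

text \<open>Again \<open>E^T E^T\<close> cancels, and row \<open>i\<close> of \<open>E\<close>
  combines only rows \<open>i\<close> and \<open>k\<close> of \<open>B *v G\<close>, both
  zero.\<close>

lemma is_grading_mutation:
  assumes "is_grading mut B G" "k \<in> mut"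
  defines "E \<equiv> mutation_matrix B k"
  shows "is_grading mut (reset_frozen mut (E ** B ** transpose E)) (transpose E *v G)"
  unfolding is_grading_def
proof
  fix i assume i: "i \<in> mut"
  have "(reset_frozen mut (E ** B ** transpose E) *v (transpose E *v G)) $ i
      = ((E ** B ** transpose E) *v (transpose E *v G)) $ i"
    using i by (simp add: matrix_vector_mult_def[of "reset_frozen _ _"]
        matrix_vector_mult_def[of "E ** B ** transpose E"] reset_frozen_nth_mutable)
  also have "(E ** B ** transpose E) *v (transpose E *v G)
      = E *v (B *v ((transpose E ** transpose E) *v G))"
    by (simp only: matrix_vector_mul_assoc matrix_mul_assoc)
  also have "\<dots> $ i = 0"
    using assms(1,2) i
    by (simp add: E_def transpose_mutation_matrix_involution mutation_matrix_vec is_grading_def)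
  finally show "(reset_frozen mut (E ** B ** transpose E) *v (transpose E *v G)) $ i = 0" .
qed

lemma transpose_mutation_vec:
  assumes "skew_symmetric B"
  shows "(transpose (mutation_matrix B k) *v G) $ i = (if i = k then dot G (b_minus B k) else G $ i)"
proof -
  have "(transpose (mutation_matrix B k) *v G) $ i = dot G (column i (mutation_matrix B k))"
    by (simp add: matrix_vector_mult_def transpose_def dot_def column_def mult.commute)
  then show ?thesis
    by (simp add: mutation_matrix_column[OF assms] mutation_matrix_column_other)
qed

text \<open>A congruence acts on \<open>t u^T - u t^T\<close> by acting on \<open>t\<close> and
  \<open>u\<close>. This keeps the relation between a quantum form and its twist intact under
  mutation, with the gradings mutated as well.\<close>

lemma congruence_wedge:
  "transpose E ** (L - wedge t u) ** E
     = transpose E ** L ** E - wedge (transpose E *v t) (transpose E *v u)"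
proof -
  have "(transpose E *v x) $ i = dot x (column i E)" for x i
    by (simp add: matrix_vector_mult_def transpose_def dot_def column_def mult.commute)
  then show ?thesis
    unfolding vec_eq_iff
    by (auto simp: congruence_nth bil_wedge vector_minus_component)
      (simp add: wedge_def algebra_simps)
qed

text \<open>The change of each sum is a combination of the pairings of column \<open>i\<close> of
  \<open>B\<close> with \<open>t\<close> and \<open>u\<close>; by skew-symmetry these are minus the
  pairings with row \<open>i\<close>, which vanish.\<close>

lemma compatible_wedge:
  assumes "skew_symmetric B" "compatible mut B L" "is_grading mut B t" "is_grading mut B u"
  shows "compatible mut B (L - wedge t u)"
proof -
  have z: "(\<Sum>k\<in>UNIV. B $ k $ i * x $ k) = 0" if "is_grading mut B x" "i \<in> mut" for x i
  proof -
    have "(\<Sum>k\<in>UNIV. B $ k $ i * x $ k) = - (\<Sum>k\<in>UNIV. B $ i $ k * x $ k)"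
      unfolding sum_negf[symmetric]
      by (intro sum.cong refl) (simp add: skew_symmetric_nth[OF assms(1), of _ i])
    then show ?thesis using that by (simp add: is_grading_def matrix_vector_mult_def)
  qed
  have "(\<Sum>k\<in>UNIV. B $ k $ i * (L - wedge t u) $ k $ j) = (\<Sum>k\<in>UNIV. B $ k $ i * L $ k $ j)"
    if "i \<in> mut" for i j
  proof -
    have "(\<Sum>k\<in>UNIV. B $ k $ i * (L - wedge t u) $ k $ j) =
      (\<Sum>k\<in>UNIV. B $ k $ i * L $ k $ j) - u $ j * (\<Sum>k\<in>UNIV. B $ k $ i * t $ k)
        + t $ j * (\<Sum>k\<in>UNIV. B $ k $ i * u $ k)"
      by (simp add: wedge_def algebra_simps sum.distrib sum_subtractf sum_distrib_left)
    then show ?thesis by (simp add: z[OF assms(3) that] z[OF assms(4) that])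
  qed
  then show ?thesis using assms(2) by (simp add: compatible_def)
qed

lemma is_grading_add: "is_grading mut B t \<Longrightarrow> is_grading mut B u \<Longrightarrow> is_grading mut B (t + u)"
  by (simp add: is_grading_def matrix_vector_right_distrib)



section \<open>Powers of \<open>q\<^bsup>1/2\<^esup>\<close> and q-commuting elements\<close>

lemma q_half_nonzero [simp]: "q_half \<noteq> 0"
  by (simp add: q_half_def Zero_fract_def eq_fract)

lemma q_half_powi_mult [simp]: "q_half powi m * q_half powi n = q_half powi (m + n)"
  by (simp add: power_int_add)

lemma q_half_powi_mult_left [simp]: "q_half powi m * (q_half powi n * c) = q_half powi (m + n) * c"
  by (simp flip: mult.assoc)

lemma q_param_powi: "q_param powi m = q_half powi (2 * m)"
  by (simp add: q_param_def power_int_mult)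

lemma q_half_power: "q_half ^ n = Fract ([:0, 1:] ^ n) 1"
  by (induction n) (simp_all add: q_half_def One_fract_def)

text \<open>The indeterminate is not a root of unity, as the degree of its powers shows; negative
  exponents reduce to positive ones by inversion. \<open>mutated_nonzero\<close> rests on
  this.\<close>

lemma q_half_powi_eq_1: assumes "q_half powi m = 1" shows "m = 0"
proof -
  have nat: "n = 0" if "q_half ^ n = 1" for n
  proof -
    have "([:0, 1:] :: rat poly) ^ n = 1"
      using that by (simp add: q_half_power One_fract_def eq_fract)
    then have "degree (([:0, 1:] :: rat poly) ^ n) = 0" by simp
    then show ?thesis by (simp add: degree_power_eq)
  qed
  show ?thesis
  proof (cases "m \<ge> 0")
    case True
    then show ?thesis using assms nat[of "nat m"] by (simp add: power_int_def)
  next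
    case False
    then have "q_half ^ nat (- m) = 1" using assms by (simp add: power_int_def power_inverse)
    then show ?thesis using nat[of "nat (- m)"] False by simp
  qed
qed

lemma ring_of_type_algebra_simps [simp]:
  "carrier (ring_of_type_algebra :: qfield ring) = UNIV"
  "monoid.mult (ring_of_type_algebra :: qfield ring) = (*)"
  "one (ring_of_type_algebra :: qfield ring) = 1"
  "zero (ring_of_type_algebra :: qfield ring) = 0"
  "add (ring_of_type_algebra :: qfield ring) = (+)"
  by (simp_all add: ring_of_type_algebra_def)

context K_algebra
begin

lemma K_smult_closed [simp]: "x \<in> carrier A \<Longrightarrow> c \<odot> x \<in> carrier A"
  using smult_closed[of c x] by simp

lemma K_smult_smult [simp]: "x \<in> carrier A \<Longrightarrow> c \<odot> (d \<odot> x) = (c * d) \<odot> x"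
  using smult_assoc1[of c d x] by simp

lemma K_smult_add_left: "x \<in> carrier A \<Longrightarrow> (c + d) \<odot> x = c \<odot> x \<oplus> d \<odot> x"
  using smult_l_distr[of c d x] by simp

lemma K_smult_add_right:
  "\<lbrakk>x \<in> carrier A; y \<in> carrier A\<rbrakk> \<Longrightarrow> c \<odot> (x \<oplus> y) = c \<odot> x \<oplus> c \<odot> y"
  using smult_r_distr[of c x y] by simp

lemma K_smult_one [simp]: "x \<in> carrier A \<Longrightarrow> 1 \<odot> x = x"
  using smult_one[of x] by simp

lemma K_smult_zero_left [simp]: "x \<in> carrier A \<Longrightarrow> 0 \<odot> x = \<zero>"
  using smult_l_null[of x] by simp

lemma K_smult_zero_right [simp]: "c \<odot> \<zero> = \<zero>"
  using smult_r_null[of c] by simp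

lemma K_smult_eq_zero:
  assumes "x \<in> carrier A" "c \<odot> x = \<zero>" "c \<noteq> 0"
  shows "x = \<zero>"
proof -
  have "x = inverse c \<odot> (c \<odot> x)" using assms(1,3) by simp
  then show ?thesis unfolding assms(2) by simp
qed

lemma K_smult_cancel:
  assumes "x \<in> carrier A" "y \<in> carrier A" "c \<odot> x = c \<odot> y" "c \<noteq> 0"
  shows "x = y"
proof -
  have "x = inverse c \<odot> (c \<odot> x)" using assms(1,4) by simp
  then show ?thesis unfolding assms(3) using assms(2,4) by simp
qed

lemma K_uminus: "x \<in> carrier A \<Longrightarrow> \<ominus> x = (- 1) \<odot> x"
proof -
  assume x: "x \<in> carrier A"
  have "x \<oplus> (- 1) \<odot> x = (1 + (- 1)) \<odot> x"
    using x K_smult_add_left[of x 1 "- 1"] by simp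
  then have "x \<oplus> (- 1) \<odot> x = \<zero>" using x by simp
  then show "\<ominus> x = (- 1) \<odot> x"
    using x by (metis add.inv_comm minus_equality K_smult_closed)
qed

text \<open>The exponent counts powers of \<open>q_half\<close>, so the relation
  \<open>X_i X_j = q^(l_ij) X_j X_i\<close> appears with \<open>h = 2 * l_ij\<close>.\<close>

definition q_commute :: "int \<Rightarrow> 'a \<Rightarrow> 'a \<Rightarrow> bool"
  where "q_commute h x y \<longleftrightarrow> x \<otimes> y = q_half powi h \<odot> (y \<otimes> x)"

lemma q_commute_sym:
  "\<lbrakk>x \<in> carrier A; y \<in> carrier A; q_commute h x y\<rbrakk> \<Longrightarrow> q_commute (- h) y x"
  by (simp add: q_commute_def)

lemma q_commute_mult_left:
  assumes "x \<in> carrier A" "x' \<in> carrier A" "y \<in> carrier A" "q_commute h x y" "q_commute h' x' y"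
  shows "q_commute (h + h') (x \<otimes> x') y"
proof -
  have "x \<otimes> x' \<otimes> y = x \<otimes> (q_half powi h' \<odot> (y \<otimes> x'))"
    using assms by (simp add: q_commute_def m_assoc)
  also have "\<dots> = q_half powi h' \<odot> (x \<otimes> y \<otimes> x')"
    using assms by (simp add: smult_mult_right m_assoc)
  also have "\<dots> = q_half powi h' \<odot> ((q_half powi h \<odot> (y \<otimes> x)) \<otimes> x')"
    using assms by (simp add: q_commute_def)
  also have "\<dots> = q_half powi (h + h') \<odot> (y \<otimes> (x \<otimes> x'))"
    using assms by (simp add: smult_mult_left m_assoc add.commute)
  finally show ?thesis by (simp add: q_commute_def)
qed

lemma q_commute_one_left [simp]: "y \<in> carrier A \<Longrightarrow> q_commute 0 \<one> y"
  by (simp add: q_commute_def)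

lemma q_commute_nat_pow:
  assumes "x \<in> carrier A" "y \<in> carrier A" "q_commute h x y"
  shows "q_commute (int n * h) (x [^] n) y"
proof (induction n)
  case (Suc n)
  have "q_commute (int n * h + h) (x [^] n \<otimes> x) y"
    using assms Suc by (intro q_commute_mult_left) auto
  then show ?case by (simp add: algebra_simps)
qed (use assms in simp)

end

section \<open>Cancellation, inverses and integer powers in a skew-field\<close>

context K_skew_field
begin

lemma nonzero_Units: "x \<in> carrier A \<Longrightarrow> x \<noteq> \<zero> \<Longrightarrow> x \<in> Units A"
  using Units_eq by simp

lemma one_nonzero [simp]: "\<one> \<noteq> \<zero>"
  using Units_eq Units_one_closed by blast

lemma inv_in_carrier [simp]: "x \<in> carrier A \<Longrightarrow> x \<noteq> \<zero> \<Longrightarrow> inv x \<in> carrier A"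
  using nonzero_Units by simp

lemma inv_right [simp]: "x \<in> carrier A \<Longrightarrow> x \<noteq> \<zero> \<Longrightarrow> x \<otimes> inv x = \<one>"
  using nonzero_Units by simp

lemma inv_left [simp]: "x \<in> carrier A \<Longrightarrow> x \<noteq> \<zero> \<Longrightarrow> inv x \<otimes> x = \<one>"
  using nonzero_Units by simp

lemma left_cancel:
  assumes "z \<in> carrier A" "z \<noteq> \<zero>" "x \<in> carrier A" "y \<in> carrier A" "z \<otimes> x = z \<otimes> y"
  shows "x = y"
  using assms nonzero_Units Units_l_cancel by metis

lemma mult_nonzero [simp]:
  assumes "x \<in> carrier A" "x \<noteq> \<zero>" "y \<in> carrier A" "y \<noteq> \<zero>"
  shows "x \<otimes> y \<noteq> \<zero>"
proof
  assume "x \<otimes> y = \<zero>"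
  then have "x \<otimes> y = x \<otimes> \<zero>" using assms by simp
  then show False using left_cancel[of x y \<zero>] assms by simp
qed

lemma smult_nonzero: "\<lbrakk>x \<in> carrier A; x \<noteq> \<zero>; c \<noteq> 0\<rbrakk> \<Longrightarrow> c \<odot> x \<noteq> \<zero>"
  using K_smult_eq_zero by blast

lemma inv_eqI:
  assumes "x \<in> carrier A" "y \<in> carrier A" "x \<otimes> y = \<one>"
  shows "inv x = y"
proof -
  have "x \<noteq> \<zero>" using assms one_nonzero by (metis l_null)
  moreover from this have "x \<otimes> inv x = x \<otimes> y" using assms by simp
  ultimately show ?thesis using left_cancel[of x "inv x" y] assms by simp
qed

text \<open>Integer powers of nonzero elements are handled in the group of units, where the exponent
  laws hold for both signs.\<close>

lemma int_pow_units_of: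
  assumes "x \<in> carrier A" "x \<noteq> \<zero>"
  shows "x [^]\<^bsub>units_of A\<^esub> (m :: int) = x [^] m"
proof -
  have U: "x \<in> Units A" using assms nonzero_Units by simp
  have nat: "x [^]\<^bsub>units_of A\<^esub> (n :: nat) = x [^] n" for n
    by (simp add: nat_pow_def units_of_def)
  have "x [^] n \<in> Units A" for n :: nat using U by (rule Units_pow_closed)
  then show ?thesis by (simp add: int_pow_def2 nat units_of_inv del: pow_nat)
qed

lemma int_pow_Units:
  assumes "x \<in> carrier A" "x \<noteq> \<zero>"
  shows "x [^] (m :: int) \<in> Units A"
proof -
  interpret U: group "units_of A" by (rule units_group)
  have "x [^]\<^bsub>units_of A\<^esub> m \<in> carrier (units_of A)"
    using assms nonzero_Units by (intro U.int_pow_closed) (simp add: units_of_carrier)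
  then show ?thesis using assms by (simp add: int_pow_units_of units_of_carrier)
qed

lemma int_pow_in_carrier [simp]: "x \<in> carrier A \<Longrightarrow> x \<noteq> \<zero> \<Longrightarrow> x [^] (m :: int) \<in> carrier A"
  using int_pow_Units Units_eq by blast

lemma int_pow_nonzero [simp]: "x \<in> carrier A \<Longrightarrow> x \<noteq> \<zero> \<Longrightarrow> x [^] (m :: int) \<noteq> \<zero>"
  using int_pow_Units Units_eq by blast

lemma int_pow_add:
  assumes "x \<in> carrier A" "x \<noteq> \<zero>"
  shows "x [^] (m + n :: int) = x [^] m \<otimes> x [^] n"
proof -
  interpret U: group "units_of A" by (rule units_group)
  have "x [^]\<^bsub>units_of A\<^esub> (m + n) = x [^]\<^bsub>units_of A\<^esub> m \<otimes>\<^bsub>units_of A\<^esub> x [^]\<^bsub>units_of A\<^esub> n"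
    using assms nonzero_Units by (intro U.int_pow_mult) (simp add: units_of_carrier)
  then show ?thesis using assms by (simp add: int_pow_units_of units_of_mult)
qed

text \<open>Multiplied by \<open>x\<close> on the left, both sides become \<open>y\<close>; then
  cancel \<open>x\<close>.\<close>

lemma q_commute_inv:
  assumes "x \<in> carrier A" "x \<noteq> \<zero>" "y \<in> carrier A" "q_commute h x y"
  shows "q_commute (- h) (inv x) y"
proof -
  have "x \<otimes> (inv x \<otimes> y) = y \<otimes> x \<otimes> inv x"
  proof -
    have "x \<otimes> (inv x \<otimes> y) = y" using assms by (simp flip: m_assoc)
    moreover have "y \<otimes> x \<otimes> inv x = y" using assms by (simp add: m_assoc)
    ultimately show ?thesis by simp
  qed
  also have "y \<otimes> x = q_half powi (- h) \<odot> (x \<otimes> y)"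
    using q_commute_sym[of x y h] assms by (simp add: q_commute_def)
  also have "\<dots> \<otimes> inv x = x \<otimes> (q_half powi (- h) \<odot> (y \<otimes> inv x))"
    using assms by (simp add: smult_mult_left smult_mult_right m_assoc)
  finally have *: "x \<otimes> (inv x \<otimes> y) = x \<otimes> (q_half powi (- h) \<odot> (y \<otimes> inv x))" .
  show ?thesis unfolding q_commute_def
    by (rule left_cancel[OF _ _ _ _ *]) (use assms in \<open>auto simp: m_assoc\<close>)
qed

lemma q_commute_int_pow:
  assumes "x \<in> carrier A" "x \<noteq> \<zero>" "y \<in> carrier A" "q_commute h x y"
  shows "q_commute (m * h) (x [^] m) y"
proof (cases "m < 0")
  case True
  have "x [^] nat (- m) \<noteq> \<zero>"
    using int_pow_nonzero[of x "int (nat (- m))"] assms by (simp only: int_pow_int not_False_eq_True)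
  then have "q_commute (- (int (nat (- m)) * h)) (inv (x [^] nat (- m))) y"
    using assms by (intro q_commute_inv q_commute_nat_pow) auto
  then show ?thesis using True by (simp add: int_pow_def2 del: pow_nat)
next
  case False
  then show ?thesis using q_commute_nat_pow[of x y h "nat m"] assms by (simp add: int_pow_def2 del: pow_nat)
qed

end

section \<open>Quantum monomials\<close>

text \<open>Linear independence of the monomials is kept out on purpose: the calculus of
  \<open>M\<close> holds for any nonzero q-commuting entries, which makes it available for mutated
  clusters and for the twisted cluster before independence is established.\<close>

locale q_commuting = K_skew_field F for F :: "(qfield, 'a) module" (structure) +
  fixes x :: "'n::{finite,linorder} \<Rightarrow> 'a"
    and L :: "int^('n::{finite,linorder})^('n::{finite,linorder})"
  assumes x_closed [simp]: "x i \<in> carrier F"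
    and x_nonzero [simp]: "x i \<noteq> \<zero>"
    and L_skew: "skew_symmetric L"
    and x_commute: "q_commute (2 * L $ i $ j) (x i) (x j)"
begin

definition ordered_prod :: "'n list \<Rightarrow> (int, 'n) vec \<Rightarrow> 'a"
  where "ordered_prod xs a = foldr (\<lambda>i y. (x i [^] a $ i) \<otimes> y) xs \<one>"

lemma ordered_prod_simps [simp]:
  "ordered_prod [] a = \<one>"
  "ordered_prod (i # xs) a = (x i [^] a $ i) \<otimes> ordered_prod xs a"
  by (simp_all add: ordered_prod_def)

lemma ordered_prod_closed [simp]: "ordered_prod xs a \<in> carrier F"
  by (induction xs) auto

lemma ordered_prod_nonzero [simp]: "ordered_prod xs a \<noteq> \<zero>"
  by (induction xs) auto

lemma ordered_prod_commute:
  assumes "distinct xs"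
  shows "q_commute (\<Sum>i\<in>set xs. 2 * (a $ i * L $ i $ j * m)) (ordered_prod xs a) (x j [^] m)"
  using assms
proof (induction xs)
  case (Cons i xs)
  have "q_commute (- (m * (- (a $ i * (2 * L $ i $ j))))) (x i [^] a $ i) (x j [^] m)"
    using x_commute by (intro q_commute_sym q_commute_int_pow) auto
  then have "q_commute (- (m * (- (a $ i * (2 * L $ i $ j)))) + (\<Sum>i\<in>set xs. 2 * (a $ i * L $ i $ j * m)))
      (x i [^] a $ i \<otimes> ordered_prod xs a) (x j [^] m)"
    using Cons by (intro q_commute_mult_left) auto
  then show ?case using Cons.prems by (simp add: algebra_simps)
qed simp

text \<open>Half the exponent of \<open>q\<^bsup>1/2\<^esup>\<close> created by sorting the concatenation of two ordered products.\<close>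

definition sort_exp :: "'n set \<Rightarrow> (int, 'n) vec \<Rightarrow> (int, 'n) vec \<Rightarrow> int"
  where "sort_exp S a b = (\<Sum>j\<in>S. \<Sum>i | i \<in> S \<and> i < j. a $ j * b $ i * L $ j $ i)"

lemma sort_exp_insert_least:
  assumes "finite S" "\<And>j. j \<in> S \<Longrightarrow> i < j"
  shows "sort_exp (insert i S) a b = (\<Sum>j\<in>S. a $ j * b $ i * L $ j $ i) + sort_exp S a b"
proof -
  have i: "i \<notin> S" using assms(2) by blast
  have 0: "{i'. i' \<in> insert i S \<and> i' < i} = {}"
    using assms(2) by (metis (mono_tags, lifting) empty_Collect_eq insert_iff order_less_asym order_less_irrefl)
  have 1: "{i'. i' \<in> insert i S \<and> i' < j} = insert i {i'. i' \<in> S \<and> i' < j}" if "j \<in> S" for j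
    using assms(2)[OF that] by auto
  have "sort_exp (insert i S) a b =
      (\<Sum>j\<in>S. \<Sum>i' | i' \<in> insert i S \<and> i' < j. a $ j * b $ i' * L $ j $ i')"
    unfolding sort_exp_def by (subst sum.insert[OF assms(1) i]) (simp only: 0 sum.empty add_0)
  also have "\<dots> = (\<Sum>j\<in>S. a $ j * b $ i * L $ j $ i + (\<Sum>i' | i' \<in> S \<and> i' < j. a $ j * b $ i' * L $ j $ i'))"
    using assms(1) i by (intro sum.cong refl) (simp only: 1, subst sum.insert, auto)
  finally show ?thesis by (simp add: sum.distrib sort_exp_def)
qed

text \<open>The head \<open>i\<close> is the least index. Moving its power in the second factor left
  across the tail of the first creates the terms of \<open>sort_exp\<close> that involve
  \<open>i\<close>; the rest is the induction hypothesis.\<close>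

lemma ordered_prod_mult:
  assumes "sorted_wrt (<) xs"
  shows "ordered_prod xs a \<otimes> ordered_prod xs b =
    q_half powi (2 * sort_exp (set xs) a b) \<odot> ordered_prod xs (a + b)"
  using assms
proof (induction xs)
  case Nil
  then show ?case by (simp add: sort_exp_def)
next
  case (Cons i xs)
  let ?P = "ordered_prod xs" and ?h = "\<Sum>j\<in>set xs. 2 * (a $ j * L $ j $ i * b $ i)"
  have d: "distinct xs" using Cons.prems by (auto simp: strict_sorted_iff)
  have c: "?P a \<otimes> x i [^] b $ i = q_half powi ?h \<odot> (x i [^] b $ i \<otimes> ?P a)"
    using ordered_prod_commute[OF d, of a i "b $ i"] by (simp add: q_commute_def)
  have "ordered_prod (i # xs) a \<otimes> ordered_prod (i # xs) b
      = x i [^] a $ i \<otimes> (?P a \<otimes> x i [^] b $ i) \<otimes> ?P b"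
    by (simp add: m_assoc)
  also have "\<dots> = q_half powi ?h \<odot> (x i [^] a $ i \<otimes> x i [^] b $ i \<otimes> (?P a \<otimes> ?P b))"
    unfolding c by (simp add: smult_mult_left smult_mult_right m_assoc)
  also have "\<dots> = q_half powi (?h + 2 * sort_exp (set xs) a b) \<odot> ordered_prod (i # xs) (a + b)"
    using Cons by (simp add: smult_mult_right int_pow_add)
  also have "?h + 2 * sort_exp (set xs) a b = 2 * sort_exp (set (i # xs)) a b"
    using Cons.prems by (simp add: sort_exp_insert_least sum_distrib_left algebra_simps)
  finally show ?case .
qed

abbreviation M :: "(int, 'n) vec \<Rightarrow> 'a"
  where "M \<equiv> qmonomial F x L"

lemma M_ordered_prod:
  "M a = q_half powi (sort_exp UNIV a a) \<odot> ordered_prod (sorted_list_of_set UNIV) a"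
  unfolding qmonomial_def ordered_prod_def sort_exp_def by (simp add: mult_ac)

lemma sort_exp_add_left: "sort_exp S (a + b) c = sort_exp S a c + sort_exp S b c"
  by (simp add: sort_exp_def algebra_simps sum.distrib)

lemma sort_exp_add_right: "sort_exp S c (a + b) = sort_exp S c a + sort_exp S c b"
  by (simp add: sort_exp_def algebra_simps sum.distrib)

text \<open>The double sum splits into the parts below, above and on the diagonal. The diagonal
  vanishes, and skew-symmetry turns the upper part into \<open>- sort_exp UNIV b a\<close>.\<close>

lemma sort_exp_swap: "sort_exp UNIV a b - sort_exp UNIV b a = bil L a b"
proof -
  have split: "(\<Sum>i\<in>UNIV. f i) = (\<Sum>i | i < j. f i) + (\<Sum>i | j < i. f i) + f j"
    for f :: "'n \<Rightarrow> int" and j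
  proof -
    have "UNIV = insert j ({i. i < j} \<union> {i. j < i})" by auto
    then have "(\<Sum>i\<in>UNIV. f i) = f j + sum f ({i. i < j} \<union> {i. j < i})"
      by (metis (no_types, lifting) UnE finite_code mem_Collect_eq order_less_irrefl sum.insert)
    also have "sum f ({i. i < j} \<union> {i. j < i}) = (\<Sum>i | i < j. f i) + (\<Sum>i | j < i. f i)"
      by (rule sum.union_disjoint) auto
    finally show ?thesis by simp
  qed
  have "bil L a b = (\<Sum>j\<in>UNIV. (\<Sum>i | i < j. a $ j * L $ j $ i * b $ i))
      + (\<Sum>j\<in>UNIV. \<Sum>i | j < i. a $ j * L $ j $ i * b $ i)"
    unfolding bil_def sum.distrib[symmetric]
  proof (intro sum.cong refl)
    fix j
    show "(\<Sum>i\<in>UNIV. a $ j * L $ j $ i * b $ i) =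
        (\<Sum>i | i < j. a $ j * L $ j $ i * b $ i) + (\<Sum>i | j < i. a $ j * L $ j $ i * b $ i)"
      by (simp add: split[of _ j] skew_symmetric_diag[OF L_skew])
  qed
  also have "(\<Sum>j\<in>UNIV. \<Sum>i | j < i. a $ j * L $ j $ i * b $ i)
      = (\<Sum>i\<in>UNIV. \<Sum>j | j < i. a $ j * L $ j $ i * b $ i)"
    using sum.swap_restrict[of UNIV UNIV "\<lambda>j i. a $ j * L $ j $ i * b $ i" "\<lambda>j i. j < i"] by simp
  also have "\<dots> = - sort_exp UNIV b a"
    unfolding sort_exp_def sum_negf[symmetric]
  proof (intro sum.cong)
    fix i j show "a $ j * L $ j $ i * b $ i = - (b $ i * a $ j * L $ i $ j)"
      unfolding skew_symmetric_nth[OF L_skew, of j i] by (simp only: mult_minus_right mult_minus_left mult_ac)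
  qed auto
  finally show ?thesis by (simp add: sort_exp_def mult_ac)
qed

lemma M_closed [simp]: "M a \<in> carrier F"
  by (simp add: M_ordered_prod)

lemma M_nonzero [simp]: "M a \<noteq> \<zero>"
  unfolding M_ordered_prod by (rule smult_nonzero) auto

text \<open>Normalisation and sorting give \<open>s(a,a) + s(b,b) + 2 s(a,b)\<close>, where
  \<open>s\<close> is \<open>sort_exp UNIV\<close>; subtracting the exponent
  \<open>s(a+b,a+b)\<close> of \<open>M (a + b)\<close> leaves \<open>s(a,b) - s(b,a)\<close>, the
  bilinear form.\<close>

lemma M_mult: "M a \<otimes> M b = q_half powi (bil L a b) \<odot> M (a + b)"
  unfolding M_ordered_prod
  by (simp add: smult_mult_left smult_mult_right ordered_prod_mult sort_exp_add_left
      sort_exp_add_right add.assoc add.commute add.left_commute flip: sort_exp_swap)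

lemma ordered_prod_zero: "ordered_prod xs 0 = \<one>"
  by (induction xs) auto

lemma M_zero [simp]: "M 0 = \<one>"
  by (simp add: M_ordered_prod ordered_prod_zero sort_exp_def)

lemma ordered_prod_axis:
  "distinct xs \<Longrightarrow> ordered_prod xs (axis i 1) = (if i \<in> set xs then x i else \<one>)"
proof (induction xs)
  case (Cons j xs)
  then show ?case using int_pow_int[of F "x i" 1] by (auto simp: axis_def)
qed simp

lemma M_axis [simp]: "M (axis i 1) = x i"
proof -
  have "sort_exp UNIV (axis i 1) (axis i 1) = 0"
    unfolding sort_exp_def by (intro sum.neutral ballI) (auto simp: axis_def)
  then show ?thesis by (simp add: M_ordered_prod ordered_prod_axis)
qed

lemma M_commute: "q_commute (2 * bil L a b) (M a) (M b)"
  by (simp add: q_commute_def M_mult add.commute bil_skew[OF L_skew, of b a])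

text \<open>If the sum vanished, the two monomials would be proportional and so q-commute with
  \<open>x k\<close> with the same exponent. By compatibility the exponents differ by
  \<open>2 * d\<close>, and \<open>q_half\<close> is not a root of unity. The argument uses
  commutation alone, hence applies after any number of mutations.\<close>

lemma mutated_nonzero:
  assumes "\<forall>j. (\<Sum>i\<in>UNIV. B $ i $ k * L $ i $ j) = (if k = j then d else 0)" "d > 0"
  shows "M (b_plus B k) \<oplus> M (b_minus B k) \<noteq> \<zero>"
proof
  let ?p = "b_plus B k" and ?m = "b_minus B k"
  assume z: "M ?p \<oplus> M ?m = \<zero>"
  then have m: "M ?m = (- 1) \<odot> M ?p"
    using K_uminus[of "M ?p"] minus_equality[of "M ?m" "M ?p"] a_comm[of "M ?p" "M ?m"] by simp
  have c: "x k \<otimes> M b = q_half powi (2 * bil L (axis k 1) b) \<odot> (M b \<otimes> x k)" for b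
    using M_commute[of "axis k 1" b] by (simp add: q_commute_def)
  have "x k \<otimes> M ?m = (- 1 * q_half powi (2 * bil L (axis k 1) ?p)) \<odot> (M ?p \<otimes> x k)"
    unfolding m by (simp add: smult_mult_right c)
  moreover have "x k \<otimes> M ?m = (- 1 * q_half powi (2 * bil L (axis k 1) ?m)) \<odot> (M ?p \<otimes> x k)"
    using c[of ?m] unfolding m by (simp add: smult_mult_left)
  ultimately have "(- 1 * q_half powi (2 * bil L (axis k 1) ?p)) \<odot> (M ?p \<otimes> x k)
      = (- 1 * q_half powi (2 * bil L (axis k 1) ?m)) \<odot> (M ?p \<otimes> x k)" by simp
  then have "(- 1 * q_half powi (2 * bil L (axis k 1) ?p) + 1 * q_half powi (2 * bil L (axis k 1) ?m)) \<odot> (M ?p \<otimes> x k)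
      = (- 1 * q_half powi (2 * bil L (axis k 1) ?m) + 1 * q_half powi (2 * bil L (axis k 1) ?m)) \<odot> (M ?p \<otimes> x k)"
    by (simp only: K_smult_add_left m_closed M_closed x_closed)
  then have "(- 1 * q_half powi (2 * bil L (axis k 1) ?p) + 1 * q_half powi (2 * bil L (axis k 1) ?m)) \<odot> (M ?p \<otimes> x k) = \<zero>"
    by simp
  then have "- 1 * q_half powi (2 * bil L (axis k 1) ?p) + 1 * q_half powi (2 * bil L (axis k 1) ?m) = 0"
    using smult_nonzero by (metis M_closed M_nonzero m_closed mult_nonzero x_closed x_nonzero)
  then have eq: "q_half powi (2 * bil L (axis k 1) ?m) = q_half powi (2 * bil L (axis k 1) ?p)" by simp
  have "q_half powi (2 * d) * q_half powi (2 * bil L (axis k 1) ?p) = q_half powi (2 * bil L (axis k 1) ?p)"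
    using bil_b_plus_minus[OF L_skew assms(1), of k] eq by (simp add: algebra_simps)
  then have "q_half powi (2 * d) = 1"
    by (metis mult_cancel_right1 power_int_not_zero q_half_nonzero)
  then show False using q_half_powi_eq_1 assms(2) by fastforce
qed

text \<open>For \<open>i \<noteq> k\<close> both monomials of the new entry q-commute with
  \<open>x i\<close> with one exponent, hence so does their sum; half of it is the form at
  \<open>axis i 1\<close> and column \<open>k\<close> of the mutation matrix.\<close>

lemma q_commuting_mutation:
  assumes B: "skew_symmetric B" and "compatible mut B L" "k \<in> mut"
  shows "q_commuting F (x(k := M (b_plus B k) \<oplus> M (b_minus B k)))
           (transpose (mutation_matrix B k) ** L ** mutation_matrix B k)"
proof -
  obtain d where d: "d > 0" "\<forall>j. (\<Sum>i\<in>UNIV. B $ i $ k * L $ i $ j) = (if k = j then d else 0)"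
    using assms(2,3) unfolding compatible_def by blast
  let ?y = "M (b_plus B k) \<oplus> M (b_minus B k)"
  define L' where "L' = transpose (mutation_matrix B k) ** L ** mutation_matrix B k"
  have L': "skew_symmetric L'" unfolding L'_def by (rule skew_symmetric_congruence[OF L_skew])
  have other: "L' $ i $ j = L $ i $ j" if "i \<noteq> k" "j \<noteq> k" for i j
    by (simp add: L'_def congruence_nth mutation_matrix_column_other[OF that(1)] mutation_matrix_column_other[OF that(2)])
  have ik: "L' $ i $ k = bil L (axis i 1) (b_minus B k)" if "i \<noteq> k" for i
    by (simp add: L'_def congruence_nth mutation_matrix_column_other[OF that] mutation_matrix_column[OF B])
  have cik: "q_commute (2 * L' $ i $ k) (x i) ?y" if i: "i \<noteq> k" for i
  proof -
    have "bil L (axis i 1) (b_plus B k) = bil L (axis i 1) (b_minus B k)"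
      using bil_b_plus_minus[OF L_skew d(2), of i] i by simp
    then show ?thesis
      using M_commute[of "axis i 1" "b_plus B k"] M_commute[of "axis i 1" "b_minus B k"]
      by (simp add: q_commute_def ik[OF i] r_distr l_distr K_smult_add_right)
  qed
  have cki: "q_commute (2 * L' $ k $ i) ?y (x i)" if i: "i \<noteq> k" for i
    using q_commute_sym[OF _ _ cik[OF i]] skew_symmetric_nth[OF L', of k i] by simp
  have ckk: "q_commute (2 * L' $ k $ k) ?y ?y"
    by (simp add: q_commute_def skew_symmetric_diag[OF L'])
  have "q_commuting F (x(k := ?y)) L'"
    by unfold_locales
      (use mutated_nonzero[OF d(2,1)] L' cik cki ckk x_commute other in \<open>auto\<close>)
  then show ?thesis by (simp only: L'_def)
qed

end



section \<open>Subalgebras and right fractions\<close>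

lemma K_algebraI:
  assumes "ring A"
    and "\<And>c x. x \<in> carrier A \<Longrightarrow> c \<odot>\<^bsub>A\<^esub> x \<in> carrier A"
    and "\<And>c d x. x \<in> carrier A \<Longrightarrow> (c + d) \<odot>\<^bsub>A\<^esub> x = c \<odot>\<^bsub>A\<^esub> x \<oplus>\<^bsub>A\<^esub> d \<odot>\<^bsub>A\<^esub> x"
    and "\<And>c x y. \<lbrakk>x \<in> carrier A; y \<in> carrier A\<rbrakk> \<Longrightarrow>
      c \<odot>\<^bsub>A\<^esub> (x \<oplus>\<^bsub>A\<^esub> y) = c \<odot>\<^bsub>A\<^esub> x \<oplus>\<^bsub>A\<^esub> c \<odot>\<^bsub>A\<^esub> y"
    and "\<And>c d x. x \<in> carrier A \<Longrightarrow> (c * d) \<odot>\<^bsub>A\<^esub> x = c \<odot>\<^bsub>A\<^esub> (d \<odot>\<^bsub>A\<^esub> x)"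
    and "\<And>x. x \<in> carrier A \<Longrightarrow> 1 \<odot>\<^bsub>A\<^esub> x = x"
    and "\<And>c x y. \<lbrakk>x \<in> carrier A; y \<in> carrier A\<rbrakk> \<Longrightarrow>
      (c \<odot>\<^bsub>A\<^esub> x) \<otimes>\<^bsub>A\<^esub> y = c \<odot>\<^bsub>A\<^esub> (x \<otimes>\<^bsub>A\<^esub> y)"
    and "\<And>c x y. \<lbrakk>x \<in> carrier A; y \<in> carrier A\<rbrakk> \<Longrightarrow>
      x \<otimes>\<^bsub>A\<^esub> (c \<odot>\<^bsub>A\<^esub> y) = c \<odot>\<^bsub>A\<^esub> (x \<otimes>\<^bsub>A\<^esub> y)"
  shows "K_algebra A"
proof -
  interpret ring A by fact
  have "Module.module (ring_of_type_algebra :: qfield ring) A"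
    by (intro moduleI cring_from_type_algebra) (use assms in \<open>auto intro: is_abelian_group\<close>)
  then show ?thesis
    by (intro K_algebra.intro K_algebra_axioms.intro assms(1)) (use assms in auto)
qed

lemma K_subalgebraD:
  assumes "K_subalgebra H A"
  shows "H \<subseteq> carrier A" "\<zero>\<^bsub>A\<^esub> \<in> H" "\<one>\<^bsub>A\<^esub> \<in> H"
    and "x \<in> H \<Longrightarrow> y \<in> H \<Longrightarrow> x \<otimes>\<^bsub>A\<^esub> y \<in> H"
    and "x \<in> H \<Longrightarrow> y \<in> H \<Longrightarrow> x \<oplus>\<^bsub>A\<^esub> y \<in> H"
    and "x \<in> H \<Longrightarrow> c \<odot>\<^bsub>A\<^esub> x \<in> H"
  using assms subringE[of H A] by (auto simp: K_subalgebra_def)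

lemma K_algebra_hom_simps:
  assumes "h \<in> K_algebra_hom R C"
  shows "x \<in> carrier R \<Longrightarrow> h x \<in> carrier C"
    and "\<lbrakk>x \<in> carrier R; y \<in> carrier R\<rbrakk> \<Longrightarrow> h (x \<otimes>\<^bsub>R\<^esub> y) = h x \<otimes>\<^bsub>C\<^esub> h y"
    and "\<lbrakk>x \<in> carrier R; y \<in> carrier R\<rbrakk> \<Longrightarrow> h (x \<oplus>\<^bsub>R\<^esub> y) = h x \<oplus>\<^bsub>C\<^esub> h y"
    and "x \<in> carrier R \<Longrightarrow> h (c \<odot>\<^bsub>R\<^esub> x) = c \<odot>\<^bsub>C\<^esub> h x"
    and "h \<one>\<^bsub>R\<^esub> = \<one>\<^bsub>C\<^esub>"
  using assms by (auto simp: K_algebra_hom_def ring_hom_def)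

context K_algebra
begin

text \<open>Negation is scaling by \<open>- 1\<close>. Expressing it so avoids comparing additive
  inverses, which are defined relative to the carrier, between an algebra and its
  restrictions.\<close>

lemma K_subalgebraI:
  assumes "H \<subseteq> carrier A" "\<one> \<in> H"
    and "\<And>x y. \<lbrakk>x \<in> H; y \<in> H\<rbrakk> \<Longrightarrow> x \<otimes> y \<in> H"
    and "\<And>x y. \<lbrakk>x \<in> H; y \<in> H\<rbrakk> \<Longrightarrow> x \<oplus> y \<in> H"
    and "\<And>c x. x \<in> H \<Longrightarrow> c \<odot> x \<in> H"
  shows "K_subalgebra H A"
  unfolding K_subalgebra_def
proof (intro conjI subringI)
  fix h assume "h \<in> H"
  then show "\<ominus> h \<in> H" using assms(1,5) by (auto simp: K_uminus)
qed (use assms in auto)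

lemma K_subalgebra_carrier: "K_subalgebra (carrier A) A"
  by (rule K_subalgebraI) auto

lemma K_algebra_restrict:
  assumes "K_subalgebra H A"
  shows "K_algebra (A\<lparr>carrier := H\<rparr>)"
proof (rule K_algebraI)
  have "subring H A" using assms by (simp add: K_subalgebra_def)
  then have "ring (A\<lparr>carrier := H\<rparr>)" by (rule subring_is_ring)
  then show "ring (A\<lparr>carrier := H\<rparr>)" .
qed (use K_subalgebraD[OF assms] in
    \<open>auto simp: subset_iff K_smult_add_left K_smult_add_right smult_mult_left smult_mult_right\<close>)

lemma K_subalgebra_restrict_iff:
  assumes "K_subalgebra H' A"
  shows "K_subalgebra H (A\<lparr>carrier := H'\<rparr>) \<longleftrightarrow> K_subalgebra H A \<and> H \<subseteq> H'"
proof
  interpret RR: K_algebra "A\<lparr>carrier := H'\<rparr>" by (rule K_algebra_restrict[OF assms])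
  show "K_subalgebra H (A\<lparr>carrier := H'\<rparr>)" if "K_subalgebra H A \<and> H \<subseteq> H'"
    using that by (intro RR.K_subalgebraI) (auto dest: K_subalgebraD)
  assume H: "K_subalgebra H (A\<lparr>carrier := H'\<rparr>)"
  have "H \<subseteq> H'" using K_subalgebraD(1)[OF H] by simp
  moreover have "H' \<subseteq> carrier A" by (rule K_subalgebraD[OF assms])
  ultimately show "K_subalgebra H A \<and> H \<subseteq> H'"
    using K_subalgebraD[OF H] by (auto intro!: K_subalgebraI)
qed

lemma K_subalgebra_Inter:
  assumes "\<And>H. H \<in> \<H> \<Longrightarrow> K_subalgebra H A" "\<H> \<noteq> {}"
  shows "K_subalgebra (\<Inter>\<H>) A"
proof (rule K_subalgebraI)
  show "\<Inter>\<H> \<subseteq> carrier A" using assms K_subalgebraD(1) by blast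
qed (auto dest: assms(1) intro: K_subalgebraD)

lemma K_subalgebra_generated_subalgebra:
  assumes "S \<subseteq> carrier A"
  shows "K_subalgebra (K_subalgebra_generated A S) A"
  unfolding K_subalgebra_generated_def
  using assms K_subalgebra_carrier by (intro K_subalgebra_Inter) auto

lemma K_subalgebra_generated_least:
  "K_subalgebra H A \<Longrightarrow> S \<subseteq> H \<Longrightarrow> K_subalgebra_generated A S \<subseteq> H"
  by (auto simp: K_subalgebra_generated_def)

lemma K_subalgebra_hom_image:
  assumes h: "h \<in> K_algebra_hom R A" and "K_algebra R"
  shows "K_subalgebra (h ` carrier R) A"
proof (rule K_subalgebraI)
  interpret RR: K_algebra R by fact
  note s = K_algebra_hom_simps[OF h]
  show "h ` carrier R \<subseteq> carrier A" using s by auto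
  show "\<one> \<in> h ` carrier R" using s(5) RR.one_closed by (metis imageI)
  fix x y assume "x \<in> h ` carrier R" "y \<in> h ` carrier R"
  then obtain a b where ab: "a \<in> carrier R" "x = h a" "b \<in> carrier R" "y = h b" by blast
  show "x \<otimes> y \<in> h ` carrier R" using ab s(2)[of a b, symmetric] by auto
  show "x \<oplus> y \<in> h ` carrier R" using ab s(3)[of a b, symmetric] by auto
next
  interpret RR: K_algebra R by fact
  fix c x assume "x \<in> h ` carrier R"
  then obtain a where "a \<in> carrier R" "x = h a" by blast
  then show "c \<odot> x \<in> h ` carrier R"
    using K_algebra_hom_simps(4)[OF h, of a c, symmetric] RR.K_smult_closed[of a c] by auto
qed

end

context K_skew_field
begin

text \<open>Inverses are described relative to the carrier, so the inverse in the restricted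
  structure has to be identified with the ambient one. The twisted seed mutates in such a
  restriction of \<open>D\<close>.\<close>

lemma K_skew_field_restrict:
  assumes H: "K_subalgebra H A" and inv: "\<And>x. \<lbrakk>x \<in> H; x \<noteq> \<zero>\<rbrakk> \<Longrightarrow> inv x \<in> H"
  shows "K_skew_field (A\<lparr>carrier := H\<rparr>)"
    and "\<lbrakk>x \<in> H; x \<noteq> \<zero>\<rbrakk> \<Longrightarrow> inv\<^bsub>A\<lparr>carrier := H\<rparr>\<^esub> x = inv x"
proof -
  interpret RR: K_algebra "A\<lparr>carrier := H\<rparr>" by (rule K_algebra_restrict[OF H])
  have sub: "H \<subseteq> carrier A" by (rule K_subalgebraD[OF H])
  show sf: "K_skew_field (A\<lparr>carrier := H\<rparr>)"
  proof
    have "x \<in> Units (A\<lparr>carrier := H\<rparr>)" if "x \<in> H" "x \<noteq> \<zero>" for x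
      using that inv[OF that] sub unfolding Units_def by (auto intro!: bexI[of _ "inv x"])
    moreover have "\<zero> \<notin> Units (A\<lparr>carrier := H\<rparr>)"
      using sub one_nonzero[symmetric] by (auto simp: Units_def subset_iff)
    moreover have "Units (A\<lparr>carrier := H\<rparr>) \<subseteq> H" by (auto simp: Units_def)
    ultimately show "Units (A\<lparr>carrier := H\<rparr>) = carrier (A\<lparr>carrier := H\<rparr>) - {\<zero>\<^bsub>A\<lparr>carrier := H\<rparr>\<^esub>}"
      by auto
  qed
  interpret S: K_skew_field "A\<lparr>carrier := H\<rparr>" by (rule sf)
  show "inv\<^bsub>A\<lparr>carrier := H\<rparr>\<^esub> x = inv x" if "x \<in> H" "x \<noteq> \<zero>"
    using that inv[OF that] sub by (intro S.inv_eqI) auto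
qed

lemma K_skew_subfield_generated_props:
  assumes "S \<subseteq> carrier A"
  defines "G \<equiv> K_skew_subfield_generated A S"
  shows "K_subalgebra G A" "S \<subseteq> G" "\<And>x. \<lbrakk>x \<in> G; x \<noteq> \<zero>\<rbrakk> \<Longrightarrow> inv x \<in> G"
proof -
  show "K_subalgebra G A"
    unfolding G_def K_skew_subfield_generated_def
  proof (intro K_subalgebra_Inter)
    have "\<forall>x\<in>carrier A - {\<zero>}. inv x \<in> carrier A" by simp
    then show "{H. K_subalgebra H A \<and> (\<forall>x\<in>H - {\<zero>}. inv x \<in> H) \<and> S \<subseteq> H} \<noteq> {}"
      using assms(1) K_subalgebra_carrier by blast
  qed auto
qed (auto simp: G_def K_skew_subfield_generated_def)

lemma K_skew_subfield_generated_least: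
  "\<lbrakk>K_subalgebra H A; \<And>x. \<lbrakk>x \<in> H; x \<noteq> \<zero>\<rbrakk> \<Longrightarrow> inv x \<in> H; S \<subseteq> H\<rbrakk> \<Longrightarrow>
     K_skew_subfield_generated A S \<subseteq> H"
  by (auto simp: K_skew_subfield_generated_def)

lemma inv_mult:
  assumes "x \<in> carrier A" "x \<noteq> \<zero>" "y \<in> carrier A" "y \<noteq> \<zero>"
  shows "inv (x \<otimes> y) = inv y \<otimes> inv x"
proof (rule inv_eqI)
  have "x \<otimes> y \<otimes> (inv y \<otimes> inv x) = x \<otimes> (y \<otimes> inv y) \<otimes> inv x"
    using assms by (simp only: m_assoc m_closed inv_in_carrier simp_thms)
  then show "x \<otimes> y \<otimes> (inv y \<otimes> inv x) = \<one>" using assms by simp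
qed (use assms in auto)

definition right_fractions :: "'a set \<Rightarrow> 'a set"
  where "right_fractions H = {a \<otimes> inv b | a b. a \<in> H \<and> b \<in> H \<and> b \<noteq> \<zero>}"

text \<open>The relation \<open>a d = b c\<close> rewrites the product of \<open>inv b\<close> and
  \<open>a\<close> as the product of \<open>c\<close> and \<open>inv d\<close>.\<close>

definition right_Ore :: "'a set \<Rightarrow> bool"
  where "right_Ore H \<longleftrightarrow>
    (\<forall>a\<in>H. \<forall>b\<in>H - {\<zero>}. \<exists>c\<in>H. \<exists>d\<in>H - {\<zero>}. a \<otimes> d = b \<otimes> c)"

lemma right_fraction_expand:
  assumes "a \<in> carrier A" "b \<in> carrier A" "b \<noteq> \<zero>" "s \<in> carrier A" "s \<noteq> \<zero>"
  shows "a \<otimes> inv b = (a \<otimes> s) \<otimes> inv (b \<otimes> s)"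
proof -
  have "(a \<otimes> s) \<otimes> inv (b \<otimes> s) = a \<otimes> (s \<otimes> inv s) \<otimes> inv b"
    using assms by (simp only: m_assoc m_closed inv_in_carrier inv_mult simp_thms)
  then show ?thesis using assms by simp
qed

text \<open>Products use the Ore condition to move \<open>inv b\<close> past the next numerator;
  sums use it to find the common denominator \<open>b \<otimes> s = d \<otimes> r\<close>.\<close>

lemma right_fractions_subfield:
  assumes H: "K_subalgebra H A" and ore: "right_Ore H"
  shows "K_subalgebra (right_fractions H) A"
    and "H \<subseteq> right_fractions H"
    and "\<And>x. \<lbrakk>x \<in> right_fractions H; x \<noteq> \<zero>\<rbrakk> \<Longrightarrow> inv x \<in> right_fractions H"
proof -
  note HD = K_subalgebraD[OF H]
  have sub [simp]: "x \<in> H \<Longrightarrow> x \<in> carrier A" for x using HD(1) by blast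
  have fracI: "a \<otimes> inv b \<in> right_fractions H" if "a \<in> H" "b \<in> H" "b \<noteq> \<zero>" for a b
    using that by (auto simp: right_fractions_def)
  have oreE: "\<exists>c d. c \<in> H \<and> d \<in> H \<and> d \<noteq> \<zero> \<and> a \<otimes> d = b \<otimes> c" if "a \<in> H" "b \<in> H" "b \<noteq> \<zero>" for a b
    using ore that unfolding right_Ore_def by blast
  show HF: "H \<subseteq> right_fractions H"
  proof
    fix x assume x: "x \<in> H"
    have "inv \<one> = \<one>" by (rule inv_eqI) auto
    then show "x \<in> right_fractions H" using fracI[of x \<one>] x HD(3) by simp
  qed
  show "K_subalgebra (right_fractions H) A"
  proof (rule K_subalgebraI)
    show "right_fractions H \<subseteq> carrier A" by (auto simp: right_fractions_def)
    show "\<one> \<in> right_fractions H" using HF HD(3) by blast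
  next
    fix x y assume "x \<in> right_fractions H" "y \<in> right_fractions H"
    then obtain a b c d where x: "x = a \<otimes> inv b" "a \<in> H" "b \<in> H" "b \<noteq> \<zero>"
      and y: "y = c \<otimes> inv d" "c \<in> H" "d \<in> H" "d \<noteq> \<zero>"
      by (auto simp: right_fractions_def)
    obtain f e where fe: "f \<in> H" "e \<in> H" "e \<noteq> \<zero>" "c \<otimes> e = b \<otimes> f" using oreE[of c b] x y by blast
    have "x \<otimes> y = a \<otimes> (inv b \<otimes> (c \<otimes> e)) \<otimes> inv (d \<otimes> e)"
      using right_fraction_expand[of c d e] x y fe by (simp add: m_assoc)
    also have "inv b \<otimes> (c \<otimes> e) = (inv b \<otimes> b) \<otimes> f"
      using x fe by (simp only: fe(4) m_assoc sub inv_in_carrier simp_thms)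
    also have "\<dots> = f" using x fe by simp
    finally have "x \<otimes> y = (a \<otimes> f) \<otimes> inv (d \<otimes> e)" .
    then show "x \<otimes> y \<in> right_fractions H" using x y fe HD(4) by (auto intro!: fracI)
    obtain r s where rs: "r \<in> H" "s \<in> H" "s \<noteq> \<zero>" "b \<otimes> s = d \<otimes> r" using oreE[of b d] x y by blast
    \<comment> \<open>Both multipliers must be nonzero for the fractions to be expanded; the Ore
      condition promises this for \<open>s\<close> only.\<close>
    have "r \<noteq> \<zero>"
    proof
      assume "r = \<zero>"
      then have "b \<otimes> s = \<zero>" using rs y by simp
      then show False using mult_nonzero[of b s] x rs by simp
    qed
    then have "x \<oplus> y = (a \<otimes> s) \<otimes> inv (b \<otimes> s) \<oplus> (c \<otimes> r) \<otimes> inv (b \<otimes> s)"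
      using right_fraction_expand[of a b s] right_fraction_expand[of c d r] x y rs by simp
    also have "\<dots> = (a \<otimes> s \<oplus> c \<otimes> r) \<otimes> inv (b \<otimes> s)"
    proof (rule l_distr[symmetric])
      show "inv (b \<otimes> s) \<in> carrier A"
        by (intro inv_in_carrier m_closed mult_nonzero) (use x rs in auto)
    qed (use x y rs in auto)
    finally show "x \<oplus> y \<in> right_fractions H" using x y rs HD(4,5) by (auto intro!: fracI)
  next
    fix k x assume "x \<in> right_fractions H"
    then obtain a b where x: "x = a \<otimes> inv b" "a \<in> H" "b \<in> H" "b \<noteq> \<zero>"
      by (auto simp: right_fractions_def)
    then have "k \<odot> x = (k \<odot> a) \<otimes> inv b" by (simp add: smult_mult_left)
    then show "k \<odot> x \<in> right_fractions H" using x HD(6) by (auto intro!: fracI)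
  qed
  fix x assume "x \<in> right_fractions H" and nz: "x \<noteq> \<zero>"
  then obtain a b where x: "x = a \<otimes> inv b" "a \<in> H" "b \<in> H" "b \<noteq> \<zero>"
    by (auto simp: right_fractions_def)
  have a: "a \<noteq> \<zero>" using nz x by auto
  have "inv x = b \<otimes> inv a"
  proof (rule inv_eqI)
    have "x \<otimes> (b \<otimes> inv a) = a \<otimes> (inv b \<otimes> b) \<otimes> inv a"
      unfolding x(1) using x a by (simp only: m_assoc m_closed inv_in_carrier sub simp_thms)
    then show "x \<otimes> (b \<otimes> inv a) = \<one>" using x a by simp
  qed (use x a in auto)
  then show "inv x \<in> right_fractions H" using x a fracI by auto
qed

end



section \<open>Embeddings of quantum tori\<close>

text \<open>Equations pull back along an injective map. A quantum torus thus receives the algebra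
  laws from its embedding into a skew-field, in place of a check of associativity for the twisted
  convolution; \<open>K_algebra_hom\<close> presupposes no laws of its source.\<close>

lemma (in K_algebra) K_algebra_transfer:
  assumes h: "h \<in> K_algebra_hom R A" and inj: "inj_on h (carrier R)"
    and zero: "\<zero>\<^bsub>R\<^esub> \<in> carrier R" "h \<zero>\<^bsub>R\<^esub> = \<zero>" and one: "\<one>\<^bsub>R\<^esub> \<in> carrier R"
    and mult: "\<And>x y. \<lbrakk>x \<in> carrier R; y \<in> carrier R\<rbrakk> \<Longrightarrow> x \<otimes>\<^bsub>R\<^esub> y \<in> carrier R"
    and add: "\<And>x y. \<lbrakk>x \<in> carrier R; y \<in> carrier R\<rbrakk> \<Longrightarrow> x \<oplus>\<^bsub>R\<^esub> y \<in> carrier R"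
    and smult: "\<And>c x. x \<in> carrier R \<Longrightarrow> c \<odot>\<^bsub>R\<^esub> x \<in> carrier R"
  shows "K_algebra R"
proof -
  note s = K_algebra_hom_simps[OF h]
  have eqI: "x = y" if "x \<in> carrier R" "y \<in> carrier R" "h x = h y" for x y
    using inj that by (simp add: inj_on_def)
  have ring: "ring R"
  proof (intro ringI abelian_groupI monoidI)
    fix x assume x: "x \<in> carrier R"
    have "((- 1) \<odot>\<^bsub>R\<^esub> x) \<oplus>\<^bsub>R\<^esub> x = \<zero>\<^bsub>R\<^esub>"
      by (rule eqI) (use x s add smult zero l_neg[of "h x"] in \<open>auto simp: K_uminus\<close>)
    then show "\<exists>y\<in>carrier R. y \<oplus>\<^bsub>R\<^esub> x = \<zero>\<^bsub>R\<^esub>" using x smult by blast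
  next
    fix x y assume "x \<in> carrier R" "y \<in> carrier R"
    then show "x \<oplus>\<^bsub>R\<^esub> y = y \<oplus>\<^bsub>R\<^esub> x" by (intro eqI) (auto simp: s add a_comm)
  qed (auto intro!: eqI simp: s zero one mult add smult m_assoc a_assoc l_distr r_distr)
  show ?thesis
    by (rule K_algebraI[OF ring]) (auto intro!: eqI simp: s zero one mult add smult
        K_smult_add_left K_smult_add_right smult_mult_left smult_mult_right)
qed

section \<open>The twisted convolution product of the quantum torus\<close>

definition torus_monom :: "int^'n \<Rightarrow> qfield \<Rightarrow> int^'n \<Rightarrow> qfield"
  where "torus_monom a s = (\<lambda>c. if c = a then s else 0)"

lemma finite_support_torus_monom [simp]: "finite {c. torus_monom a s c \<noteq> 0}"
  by (rule finite_subset[of _ "{a}"]) (auto simp: torus_monom_def)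

lemma finite_support_add:
  fixes f g :: "'b \<Rightarrow> qfield"
  assumes "finite {c. f c \<noteq> 0}" "finite {c. g c \<noteq> 0}"
  shows "finite {c. f c + g c \<noteq> 0}"
  by (rule finite_subset[of _ "{c. f c \<noteq> 0} \<union> {c. g c \<noteq> 0}"]) (use assms in auto)

text \<open>One term is split off at a time. The set \<open>S\<close> keeps all exponents in a given
  region, such as the nonnegative ones.\<close>

lemma finite_support_induct [consumes 2, case_names zero step]:
  assumes "finite {c. f c \<noteq> 0}" and "{c. f c \<noteq> 0} \<subseteq> S"
    and "P (\<lambda>c. 0)"
    and step: "\<And>a s f. \<lbrakk>a \<in> S; finite {c. f c \<noteq> 0}; P f\<rbrakk> \<Longrightarrow> P (\<lambda>c. torus_monom a s c + f c)"
  shows "P f"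
proof -
  have "{c. g c \<noteq> 0} \<subseteq> U \<Longrightarrow> P g" if "finite U" "U \<subseteq> S" for U g
    using that
  proof (induction U arbitrary: g rule: finite_induct)
    case empty
    then have "g = (\<lambda>c. 0)" by auto
    then show ?case using assms(3) by simp
  next
    case (insert a U)
    have g: "g = (\<lambda>c. torus_monom a (g a) c + (g(a := 0)) c)" by (auto simp: torus_monom_def)
    have sub: "{c. (g(a := 0)) c \<noteq> 0} \<subseteq> U" using insert.prems by auto
    moreover have "finite {c. (g(a := 0)) c \<noteq> 0}" using sub insert.hyps(1) by (rule finite_subset)
    ultimately have "P (\<lambda>c. torus_monom a (g a) c + (g(a := 0)) c)"
      using insert.prems by (intro step insert.IH) auto
    then show ?case using g by simp
  qed
  from this[of "{c. f c \<noteq> 0}" f] show ?thesis using assms by simp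
qed

lemma quantum_torus_carrier: "carrier (quantum_torus L) = {f. finite {a. f a \<noteq> 0}}"
  unfolding quantum_torus_def partial_object.select_convs by (rule refl)

lemma quantum_torus_mult:
  "f \<otimes>\<^bsub>quantum_torus L\<^esub> g =
     (\<lambda>c. \<Sum>a | f a \<noteq> 0. q_half powi (bil L a (c - a)) * f a * g (c - a))"
  unfolding quantum_torus_def monoid.select_convs bil_def by (rule refl)

lemma quantum_torus_one: "\<one>\<^bsub>quantum_torus L\<^esub> = torus_monom 0 1"
  unfolding quantum_torus_def monoid.select_convs torus_monom_def by (rule refl)

lemma quantum_torus_zero: "\<zero>\<^bsub>quantum_torus L\<^esub> = (\<lambda>c. 0)"
  unfolding quantum_torus_def ring.select_convs by (rule refl)

lemma quantum_torus_add: "f \<oplus>\<^bsub>quantum_torus L\<^esub> g = (\<lambda>c. f c + g c)"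
  unfolding quantum_torus_def ring.select_convs by (rule refl)

lemma quantum_torus_smult: "s \<odot>\<^bsub>quantum_torus L\<^esub> f = (\<lambda>c. s * f c)"
  unfolding quantum_torus_def module.select_convs by (rule refl)

lemmas quantum_torus_simps = quantum_torus_carrier quantum_torus_mult quantum_torus_one
  quantum_torus_zero quantum_torus_add quantum_torus_smult

lemma torus_gen_monom: "torus_gen i = torus_monom (axis i 1) 1"
  by (simp add: torus_gen_def torus_monom_def)

lemma quantum_torus_mult_superset:
  assumes "finite S" "{a. f a \<noteq> 0} \<subseteq> S"
  shows "(f \<otimes>\<^bsub>quantum_torus L\<^esub> g) c = (\<Sum>a\<in>S. q_half powi (bil L a (c - a)) * f a * g (c - a))"
  unfolding quantum_torus_simps using assms by (intro sum.mono_neutral_left) auto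

lemma quantum_torus_mult_closed:
  assumes "finite {a. f a \<noteq> 0}" "finite {a. g a \<noteq> 0}"
  shows "finite {a. (f \<otimes>\<^bsub>quantum_torus L\<^esub> g) a \<noteq> 0}"
proof (rule finite_subset)
  show "{a. (f \<otimes>\<^bsub>quantum_torus L\<^esub> g) a \<noteq> 0} \<subseteq> (\<lambda>(a, b). a + b) ` ({a. f a \<noteq> 0} \<times> {a. g a \<noteq> 0})"
  proof
    fix c assume "c \<in> {a. (f \<otimes>\<^bsub>quantum_torus L\<^esub> g) a \<noteq> 0}"
    then have "(\<Sum>a | f a \<noteq> 0. q_half powi (bil L a (c - a)) * f a * g (c - a)) \<noteq> 0"
      by (simp add: quantum_torus_simps)
    then obtain a where "f a \<noteq> 0" "g (c - a) \<noteq> 0"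
      by (auto elim: sum.not_neutral_contains_not_neutral)
    then show "c \<in> (\<lambda>(a, b). a + b) ` ({a. f a \<noteq> 0} \<times> {a. g a \<noteq> 0})"
      by (intro image_eqI[of _ _ "(a, c - a)"]) auto
  qed
qed (use assms in simp)

text \<open>The substitution \<open>b = c - a\<close> turns a sum over exponents of \<open>f\<close>
  into one over exponents of \<open>g\<close>, the form suited to linear equations in an unknown
  right factor.\<close>

lemma quantum_torus_mult_alt:
  assumes "finite {a. f a \<noteq> 0}" "finite S" "{a. g a \<noteq> 0} \<subseteq> S"
  shows "(f \<otimes>\<^bsub>quantum_torus L\<^esub> g) c = (\<Sum>b\<in>S. q_half powi (bil L (c - b) b) * f (c - b) * g b)"
proof -
  let ?U = "{a. f a \<noteq> 0} \<union> (\<lambda>b. c - b) ` S"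
  have "(f \<otimes>\<^bsub>quantum_torus L\<^esub> g) c = (\<Sum>a\<in>?U. q_half powi (bil L a (c - a)) * f a * g (c - a))"
    using assms(1,2) by (intro quantum_torus_mult_superset) auto
  also have "\<dots> = (\<Sum>b\<in>(\<lambda>a. c - a) ` ?U. q_half powi (bil L (c - b) b) * f (c - b) * g b)"
    by (subst sum.reindex) (auto simp: inj_on_def)
  also have "\<dots> = (\<Sum>b\<in>S. q_half powi (bil L (c - b) b) * f (c - b) * g b)"
  proof (rule sum.mono_neutral_right)
    show "S \<subseteq> (\<lambda>a. c - a) ` ?U" by (auto simp: image_Un image_image)
  qed (use assms in auto)
  finally show ?thesis .
qed

lemma quantum_torus_add_mult:
  assumes "finite {a. f a \<noteq> 0}" "finite {a. f' a \<noteq> 0}"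
  shows "(\<lambda>c. f c + f' c) \<otimes>\<^bsub>quantum_torus L\<^esub> g =
    (\<lambda>c. (f \<otimes>\<^bsub>quantum_torus L\<^esub> g) c + (f' \<otimes>\<^bsub>quantum_torus L\<^esub> g) c)"
proof
  fix c
  let ?S = "{a. f a \<noteq> 0} \<union> {a. f' a \<noteq> 0}"
  have S: "finite ?S" "{a. f a \<noteq> 0} \<subseteq> ?S" "{a. f' a \<noteq> 0} \<subseteq> ?S" "{a. f a + f' a \<noteq> 0} \<subseteq> ?S"
    using assms by auto
  show "((\<lambda>c. f c + f' c) \<otimes>\<^bsub>quantum_torus L\<^esub> g) c =
    (f \<otimes>\<^bsub>quantum_torus L\<^esub> g) c + (f' \<otimes>\<^bsub>quantum_torus L\<^esub> g) c"
    unfolding quantum_torus_mult_superset[OF S(1,2)] quantum_torus_mult_superset[OF S(1,3)]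
      quantum_torus_mult_superset[OF S(1,4)]
    by (simp add: algebra_simps sum.distrib)
qed

lemma quantum_torus_mult_add:
  "f \<otimes>\<^bsub>quantum_torus L\<^esub> (\<lambda>c. g c + g' c) =
    (\<lambda>c. (f \<otimes>\<^bsub>quantum_torus L\<^esub> g) c + (f \<otimes>\<^bsub>quantum_torus L\<^esub> g') c)"
  by (simp add: quantum_torus_simps algebra_simps sum.distrib)

lemma torus_monom_mult:
  "torus_monom a s \<otimes>\<^bsub>quantum_torus L\<^esub> torus_monom b t =
     torus_monom (a + b) (q_half powi (bil L a b) * s * t)"
proof
  fix c
  have "(torus_monom a s \<otimes>\<^bsub>quantum_torus L\<^esub> torus_monom b t) c =
      (\<Sum>a'\<in>{a}. q_half powi (bil L a' (c - a')) * torus_monom a s a' * torus_monom b t (c - a'))"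
    by (rule quantum_torus_mult_superset) (auto simp: torus_monom_def)
  also have "\<dots> = torus_monom (a + b) (q_half powi (bil L a b) * s * t) c"
    by (auto simp: torus_monom_def)
  finally show "(torus_monom a s \<otimes>\<^bsub>quantum_torus L\<^esub> torus_monom b t) c =
      torus_monom (a + b) (q_half powi (bil L a b) * s * t) c" .
qed

lemma nonneg_vec_induct [consumes 1, case_names zero step]:
  fixes v :: "int^'n"
  assumes "\<And>i. 0 \<le> v $ i" "P 0" "\<And>v i. \<lbrakk>\<And>i. 0 \<le> v $ i; P v\<rbrakk> \<Longrightarrow> P (v + axis i 1)"
  shows "P v"
  using assms(1)
proof (induction "nat (\<Sum>i\<in>UNIV. v $ i)" arbitrary: v rule: less_induct)
  case less
  show ?case
  proof (cases "v = 0")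
    case True
    then show ?thesis using assms(2) by simp
  next
    case False
    then obtain i where i: "v $ i > 0"
      using less.prems by (metis order_le_less vec_eq_iff zero_index)
    have nn: "0 \<le> (v - axis i 1) $ j" for j
      using less.prems[of j] i by (auto simp: axis_def)
    have "(\<Sum>j\<in>UNIV. axis i (1::int) $ j) = 1" by (simp add: axis_def)
    moreover have "(\<Sum>j\<in>UNIV. v $ j) \<ge> v $ i"
      using less.prems by (intro member_le_sum) auto
    ultimately have "nat (\<Sum>j\<in>UNIV. (v - axis i 1) $ j) < nat (\<Sum>j\<in>UNIV. v $ j)"
      using i by (simp add: sum_subtractf)
    then have "P (v - axis i 1)" using nn by (rule less.hyps)
    then show ?thesis using assms(3)[of "v - axis i 1" i] nn by simp
  qed
qed

section \<open>Linear combinations of quantum monomials\<close>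

context q_commuting
begin

definition lincomb :: "((int, 'n) vec \<Rightarrow> qfield) \<Rightarrow> 'a"
  where "lincomb f = (\<Oplus>a\<in>{a. f a \<noteq> 0}. f a \<odot> M a)"

lemma lincomb_superset:
  assumes "finite S" "{a. f a \<noteq> 0} \<subseteq> S"
  shows "lincomb f = (\<Oplus>a\<in>S. f a \<odot> M a)"
  unfolding lincomb_def using assms by (intro add.finprod_mono_neutral_cong_left) auto

lemma lincomb_closed [simp]: "lincomb f \<in> carrier F"
  unfolding lincomb_def by (intro finsum_closed) auto

lemma lincomb_zero [simp]: "lincomb (\<lambda>c. 0) = \<zero>"
  by (simp add: lincomb_def)

lemma lincomb_monom [simp]: "lincomb (torus_monom a s) = s \<odot> M a"
proof -
  have "lincomb (torus_monom a s) = (\<Oplus>b\<in>{a}. torus_monom a s b \<odot> M b)"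
    by (rule lincomb_superset) (auto simp: torus_monom_def)
  then show ?thesis by (simp add: torus_monom_def)
qed

lemma lincomb_add:
  assumes "finite {a. f a \<noteq> 0}" "finite {a. g a \<noteq> 0}"
  shows "lincomb (\<lambda>c. f c + g c) = lincomb f \<oplus> lincomb g"
proof -
  let ?S = "{a. f a \<noteq> 0} \<union> {a. g a \<noteq> 0}"
  have S: "finite ?S" "{a. f a \<noteq> 0} \<subseteq> ?S" "{a. g a \<noteq> 0} \<subseteq> ?S" "{a. f a + g a \<noteq> 0} \<subseteq> ?S"
    using assms by auto
  show ?thesis
    unfolding lincomb_superset[OF S(1,2)] lincomb_superset[OF S(1,3)] lincomb_superset[OF S(1,4)]
    by (simp add: K_smult_add_left finsum_addf)
qed

lemma lincomb_smult:
  assumes "finite {a. f a \<noteq> 0}"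
  shows "lincomb (\<lambda>c. s * f c) = s \<odot> lincomb f"
proof -
  have "lincomb (\<lambda>c. s * f c) = (\<Oplus>a\<in>{a. f a \<noteq> 0}. (s * f a) \<odot> M a)"
    using assms by (intro lincomb_superset) auto
  also have "\<dots> = (\<Oplus>a\<in>{a. f a \<noteq> 0}. s \<odot> (f a \<odot> M a))" by simp
  also have "\<dots> = s \<odot> lincomb f"
    unfolding lincomb_def using assms by (intro finsum_smult_ldistr[symmetric]) auto
  finally show ?thesis .
qed

text \<open>Both sides are additive in each factor, so the claim reduces to two monomials, where it
  is \<open>M_mult\<close>: torus product and quantum monomials carry the same exponent.\<close>

lemma lincomb_mult:
  assumes f: "finite {a. f a \<noteq> 0}" and g: "finite {a. g a \<noteq> 0}"
  shows "lincomb (f \<otimes>\<^bsub>quantum_torus L\<^esub> g) = lincomb f \<otimes> lincomb g"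
  using f subset_UNIV
proof (induction rule: finite_support_induct)
  show "lincomb ((\<lambda>c. 0) \<otimes>\<^bsub>quantum_torus L\<^esub> g) = lincomb (\<lambda>c. 0) \<otimes> lincomb g"
    by (simp add: quantum_torus_simps)
next
  fix a s f
  assume f: "finite {c. f c \<noteq> (0::qfield)}"
    and IH: "lincomb (f \<otimes>\<^bsub>quantum_torus L\<^esub> g) = lincomb f \<otimes> lincomb g"
  have mono: "lincomb (torus_monom a s \<otimes>\<^bsub>quantum_torus L\<^esub> g) = lincomb (torus_monom a s) \<otimes> lincomb g"
    using g subset_UNIV
  proof (induction rule: finite_support_induct)
    show "lincomb (torus_monom a s \<otimes>\<^bsub>quantum_torus L\<^esub> (\<lambda>c. 0)) =
        lincomb (torus_monom a s) \<otimes> lincomb (\<lambda>c. 0)"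
      by (simp add: quantum_torus_simps)
  next
    fix b t g
    assume "finite {c. g c \<noteq> (0::qfield)}"
      and "lincomb (torus_monom a s \<otimes>\<^bsub>quantum_torus L\<^esub> g) = lincomb (torus_monom a s) \<otimes> lincomb g"
    then show "lincomb (torus_monom a s \<otimes>\<^bsub>quantum_torus L\<^esub> (\<lambda>c. torus_monom b t c + g c)) =
        lincomb (torus_monom a s) \<otimes> lincomb (\<lambda>c. torus_monom b t c + g c)"
      by (simp add: quantum_torus_mult_add lincomb_add quantum_torus_mult_closed torus_monom_mult
          r_distr M_mult smult_mult_left smult_mult_right mult_ac)
  qed
  then show "lincomb ((\<lambda>c. torus_monom a s c + f c) \<otimes>\<^bsub>quantum_torus L\<^esub> g) =
      lincomb (\<lambda>c. torus_monom a s c + f c) \<otimes> lincomb g"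
    using f g IH
    by (simp only: quantum_torus_add_mult lincomb_add quantum_torus_mult_closed
        finite_support_torus_monom l_distr lincomb_closed)
qed

lemma lincomb_hom: "lincomb \<in> K_algebra_hom (quantum_torus L) F"
  unfolding K_algebra_hom_def ring_hom_def
  by (auto simp: quantum_torus_simps(1,3-6) lincomb_mult lincomb_add lincomb_smult)

lemma lincomb_gen: "lincomb (torus_gen i) = x i"
  by (simp add: torus_gen_monom)

end

section \<open>The Ore condition\<close>

text \<open>Gaussian elimination of one equation and one unknown at a time.\<close>

lemma homogeneous_system_nontrivial:
  fixes m :: "'i \<Rightarrow> 'j \<Rightarrow> 'k::field"
  assumes "finite I" "finite J" "card I < card J"
  shows "\<exists>x. (\<exists>j\<in>J. x j \<noteq> 0) \<and> (\<forall>i\<in>I. (\<Sum>j\<in>J. m i j * x j) = 0)"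
  using assms
proof (induction I arbitrary: J m rule: finite_induct)
  case empty
  then have "J \<noteq> {}" by auto
  then show ?case by (intro exI[of _ "\<lambda>_. 1"]) auto
next
  case (insert i I)
  show ?case
  proof (cases "\<forall>j\<in>J. m i j = 0")
    case True
    obtain x where "\<exists>j\<in>J. x j \<noteq> 0" "\<forall>i\<in>I. (\<Sum>j\<in>J. m i j * x j) = 0"
      using insert.IH[of J m] insert.prems insert.hyps by auto
    then show ?thesis using True by (intro exI[of _ x]) auto
  next
    case False
    then obtain k where k: "k \<in> J" "m i k \<noteq> 0" by blast
    let ?J = "J - {k}" and ?m = "\<lambda>i' j. m i' j - m i' k * m i j / m i k"
    have J: "finite ?J" "k \<notin> ?J" "J = insert k ?J" using insert.prems k by auto
    have "card I < card ?J" using insert.prems insert.hyps k by simp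
    then obtain x where x: "\<exists>j\<in>?J. x j \<noteq> 0" "\<forall>i\<in>I. (\<Sum>j\<in>?J. ?m i j * x j) = 0"
      using insert.IH[of ?J ?m] J by blast
    define s where "s = (\<Sum>j\<in>?J. m i j * x j)"
    define y where "y = x(k := - s / m i k)"
    have y: "(\<Sum>j\<in>J. m i' j * y j) = (\<Sum>j\<in>?J. m i' j * x j) - m i' k * s / m i k" for i'
    proof -
      have "(\<Sum>j\<in>J. m i' j * y j) = m i' k * y k + (\<Sum>j\<in>?J. m i' j * y j)"
        using insert.prems(1) k(1) by (rule sum.remove[of J k "\<lambda>j. m i' j * y j"])
      also have "(\<Sum>j\<in>?J. m i' j * y j) = (\<Sum>j\<in>?J. m i' j * x j)"
        by (rule sum.cong) (auto simp: y_def)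
      finally show ?thesis by (simp add: y_def)
    qed
    have "(\<Sum>j\<in>J. m i' j * y j) = 0" if "i' \<in> insert i I" for i'
    proof (cases "i' = i")
      case True
      then show ?thesis using k by (simp add: y s_def)
    next
      case False
      then have "0 = (\<Sum>j\<in>?J. ?m i' j * x j)" using x that by auto
      also have "\<dots> = (\<Sum>j\<in>?J. m i' j * x j) - m i' k / m i k * s"
        by (simp add: s_def sum_distrib_left algebra_simps sum_subtractf)
      finally show ?thesis by (simp add: y)
    qed
    moreover have "\<exists>j\<in>J. y j \<noteq> 0" using x(1) by (auto simp: y_def)
    ultimately show ?thesis by blast
  qed
qed

section \<open>Counting exponents in cubes\<close>

definition box :: "nat \<Rightarrow> (int^'n) set"
  where "box N = {v. \<forall>i. v $ i \<in> {- int N..int N}}"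

lemma box_bij: "bij_betw vec_lambda (PiE UNIV (\<lambda>_. {- int N..int N})) (box N :: (int^'n) set)"
proof (rule bij_betw_byWitness[of _ vec_nth])
  show "vec_lambda ` (UNIV \<rightarrow>\<^sub>E {- int N..int N}) \<subseteq> (box N :: (int^'n) set)"
  proof
    fix v :: "int^'n" assume "v \<in> vec_lambda ` (UNIV \<rightarrow>\<^sub>E {- int N..int N})"
    then obtain f where "v = vec_lambda f" "\<And>i. f i \<in> {- int N..int N}" by (auto simp: PiE_iff)
    then show "v \<in> box N" by (simp add: box_def)
  qed
  show "vec_nth ` (box N :: (int^'n) set) \<subseteq> (UNIV \<rightarrow>\<^sub>E {- int N..int N})"
    by (auto simp: box_def PiE_iff)
qed (auto simp: vec_lambda_inverse)

lemma finite_box [simp]: "finite (box N :: (int^'n) set)"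
  using bij_betw_finite[OF box_bij] by (simp add: finite_PiE)

lemma card_box: "card (box N :: (int^'n) set) = (2 * N + 1) ^ CARD('n)"
proof -
  have "card (box N :: (int^'n) set) = card (PiE (UNIV :: 'n set) (\<lambda>_. {- int N..int N}))"
    using bij_betw_same_card[OF box_bij] by metis
  also have "\<dots> = (2 * N + 1) ^ CARD('n)" by (simp add: card_PiE nat_add_distrib nat_mult_distrib)
  finally show ?thesis .
qed

lemma finite_subset_box:
  assumes "finite (S :: (int^'n) set)"
  shows "\<exists>N. S \<subseteq> box N"
proof -
  have "finite ((\<lambda>(v, i). nat \<bar>v $ i\<bar>) ` (S \<times> UNIV))" using assms by simp
  then obtain N where N: "\<And>n. n \<in> (\<lambda>(v, i). nat \<bar>v $ i\<bar>) ` (S \<times> UNIV) \<Longrightarrow> n \<le> N"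
    by (meson finite_nat_set_iff_bounded_le)
  have "nat \<bar>v $ i\<bar> \<le> N" if "v \<in> S" for v i
    using that by (intro N image_eqI[of _ _ "(v, i)"]) auto
  then have "- int N \<le> v $ i \<and> v $ i \<le> int N" if "v \<in> S" for v i
    using that[THEN \<open>\<And>v i. v \<in> S \<Longrightarrow> nat \<bar>v $ i\<bar> \<le> N\<close>, of i] by linarith
  then have "S \<subseteq> box N" by (auto simp: box_def)
  then show ?thesis ..
qed

lemma box_add: "v \<in> box N \<Longrightarrow> w \<in> box C \<Longrightarrow> v + w \<in> box (N + C)"
proof -
  assume "v \<in> box N" "w \<in> box C"
  then have "- int N \<le> v $ i \<and> v $ i \<le> int N \<and> - int C \<le> w $ i \<and> w $ i \<le> int C" for i
    by (simp add: box_def)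
  then have "- int (N + C) \<le> v $ i + w $ i \<and> v $ i + w $ i \<le> int (N + C)" for i
    by (smt (verit) of_nat_add)
  then show ?thesis by (simp add: box_def)
qed

text \<open>Enlarging a cube by a fixed margin multiplies the number of its points by a factor that
  tends to one, and so eventually drops below two.\<close>

lemma box_growth: "\<exists>N. (2 * (N + C) + 1) ^ r < 2 * (2 * N + 1 :: nat) ^ r"
proof
  \<comment> \<open>The ratio of side lengths is \<open>1 - ?h\<close>. For
    \<open>N = 2 * r * C\<close> one has \<open>r * ?h < 1 / 2\<close>, so Bernoulli's inequality
    keeps the \<open>r\<close>-th power of the ratio above \<open>1 / 2\<close>.\<close>
  let ?N = "2 * r * C" and ?h = "real (2 * C) / real (2 * (2 * r * C + C) + 1)"
  have "real r * ?h = real (2 * r * C) / real (2 * (2 * r * C + C) + 1)" by simp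
  also have "\<dots> < 1 / 2" by (subst pos_divide_less_eq) (auto intro!: add_pos_nonneg)
  finally have "real r * ?h < 1 / 2" .
  moreover have "1 + real r * (- ?h) \<le> (1 + - ?h) ^ r"
  proof (rule Bernoulli_inequality)
    have "?h \<le> 1" by (subst pos_divide_le_eq) (auto intro!: add_pos_nonneg)
    then show "- 1 \<le> - ?h" by simp
  qed
  ultimately have "1 / 2 < (1 - ?h) ^ r" by simp
  also have "1 - ?h = (real (2 * (?N + C) + 1) - real (2 * C)) / real (2 * (?N + C) + 1)"
    by (subst diff_divide_distrib, subst divide_self) linarith+
  also have "real (2 * (?N + C) + 1) - real (2 * C) = real (2 * ?N + 1)" by simp
  finally have "1 / 2 < real (2 * ?N + 1) ^ r / real (2 * (?N + C) + 1) ^ r"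
    by (simp only: power_divide)
  moreover have "0 < real (2 * (?N + C) + 1) ^ r" by (intro zero_less_power) linarith
  ultimately have "real (2 * (?N + C) + 1) ^ r < 2 * real (2 * ?N + 1) ^ r"
    by (simp only: pos_less_divide_eq)
  then have "real ((2 * (?N + C) + 1) ^ r) < real (2 * (2 * ?N + 1) ^ r)"
    by simp
  then show "(2 * (?N + C) + 1) ^ r < 2 * (2 * ?N + 1) ^ r"
    by (simp only: of_nat_less_iff)
qed

text \<open>A common right multiple of \<open>f\<close> and \<open>g\<close> supported in a box is a solution of a linear system;
  for large boxes it has more unknowns than equations.\<close>

lemma quantum_torus_common_multiple:
  fixes L :: "int^'n^'n"
  assumes f: "finite {a. f a \<noteq> 0}" and g: "finite {a. g a \<noteq> 0}"
  obtains p p' where "finite {a. p a \<noteq> 0}" "finite {a. p' a \<noteq> 0}"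
    "p \<noteq> (\<lambda>c. 0) \<or> p' \<noteq> (\<lambda>c. 0)"
    "f \<otimes>\<^bsub>quantum_torus L\<^esub> p = g \<otimes>\<^bsub>quantum_torus L\<^esub> p'"
proof -
  obtain C where C: "{a. f a \<noteq> 0} \<union> {a. g a \<noteq> 0} \<subseteq> box C"
    using finite_subset_box[of "{a. f a \<noteq> 0} \<union> {a. g a \<noteq> 0}"] f g by auto
  obtain N where N: "(2 * (N + C) + 1) ^ CARD('n) < 2 * (2 * N + 1) ^ CARD('n)"
    using box_growth by blast
  \<comment> \<open>Unknowns are indexed by a Boolean and an exponent: \<open>True\<close> stands
    for the coefficients of \<open>p\<close>, \<open>False\<close> for those of \<open>- p'\<close>.
    Equations are indexed by the cube that contains all exponents of the two products.\<close>
  let ?J = "(UNIV :: bool set) \<times> (box N :: (int^'n) set)" and ?I = "box (N + C) :: (int^'n) set"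
  let ?e = "\<lambda>h w v. q_half powi (bil L (w - v) v) * h (w - v)"
  define m where "m = (\<lambda>w (\<epsilon>, v). ?e (if \<epsilon> then f else g) w v)"
  have "card ?I < card ?J"
    using N by (simp only: card_cartesian_product card_box card_UNIV_bool)
  then obtain x where x: "\<exists>j\<in>?J. x j \<noteq> 0" "\<forall>w\<in>?I. (\<Sum>j\<in>?J. m w j * x j) = 0"
    using homogeneous_system_nontrivial[of ?I ?J m] by auto
  define p where "p = (\<lambda>v. if v \<in> box N then x (True, v) else 0)"
  define p' where "p' = (\<lambda>v. if v \<in> box N then - x (False, v) else 0)"
  have supp: "{a. p a \<noteq> 0} \<subseteq> box N" "{a. p' a \<noteq> 0} \<subseteq> box N" by (auto simp: p_def p'_def)
  have fp: "(f \<otimes>\<^bsub>quantum_torus L\<^esub> p) w = (\<Sum>v\<in>box N. ?e f w v * x (True, v))" for w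
    unfolding quantum_torus_mult_alt[OF f finite_box supp(1)] by (simp add: p_def)
  have gp: "(g \<otimes>\<^bsub>quantum_torus L\<^esub> p') w = - (\<Sum>v\<in>box N. ?e g w v * x (False, v))" for w
    unfolding quantum_torus_mult_alt[OF g finite_box supp(2)] by (simp add: p'_def sum_negf)
  have "(f \<otimes>\<^bsub>quantum_torus L\<^esub> p) w = (g \<otimes>\<^bsub>quantum_torus L\<^esub> p') w" for w
  proof (cases "w \<in> ?I")
    case True
    then have "0 = (\<Sum>j\<in>?J. m w j * x j)" using x by simp
    also have "\<dots> = (\<Sum>\<epsilon>\<in>UNIV. \<Sum>v\<in>box N. m w (\<epsilon>, v) * x (\<epsilon>, v))"
      by (simp add: sum.cartesian_product)
    also have "\<dots> = (\<Sum>v\<in>box N. ?e f w v * x (True, v)) + (\<Sum>v\<in>box N. ?e g w v * x (False, v))"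
      by (simp add: UNIV_bool m_def)
    finally show ?thesis unfolding fp gp by (simp add: eq_neg_iff_add_eq_0)
  next
    case False
    have "h (w - v) = 0" if "v \<in> box N" "{a. h a \<noteq> 0} \<subseteq> box C" for h :: "int^'n \<Rightarrow> qfield" and v
    proof (rule ccontr)
      assume "h (w - v) \<noteq> 0"
      then have "v + (w - v) \<in> ?I" using that by (intro box_add) auto
      then show False using False by simp
    qed
    from this[of _ f] this[of _ g] have "f (w - v) = 0" "g (w - v) = 0" if "v \<in> box N" for v
      using C that by auto
    then show ?thesis unfolding fp gp by simp
  qed
  moreover obtain \<epsilon> v where "v \<in> box N" "x (\<epsilon>, v) \<noteq> 0" using x(1) by auto
  then have "p v \<noteq> 0 \<or> p' v \<noteq> 0" by (cases \<epsilon>) (auto simp: p_def p'_def)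
  then have "p \<noteq> (\<lambda>c. 0) \<or> p' \<noteq> (\<lambda>c. 0)" by auto
  ultimately show ?thesis using that supp finite_subset[OF _ finite_box] by blast
qed

section \<open>The subfield generated by an independent q-commuting tuple\<close>

context q_commuting
begin

lemma x_int_pow_in_subfield:
  assumes "K_subalgebra H F" "\<And>y. \<lbrakk>y \<in> H; y \<noteq> \<zero>\<rbrakk> \<Longrightarrow> inv y \<in> H" "x i \<in> H"
  shows "x i [^] (m :: int) \<in> H"
proof -
  have nat: "x i [^] (n :: nat) \<in> H" for n
    by (induction n) (use assms K_subalgebraD[OF assms(1)] in auto)
  have "x i [^] (n :: nat) \<noteq> \<zero>" for n
    using int_pow_nonzero[of "x i" "int n"] by (simp only: int_pow_int x_closed x_nonzero simp_thms)
  then show ?thesis using nat assms(2) by (simp add: int_pow_def2 del: pow_nat)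
qed

lemma lincomb_in_subfield:
  assumes H: "K_subalgebra H F" "\<And>y. \<lbrakk>y \<in> H; y \<noteq> \<zero>\<rbrakk> \<Longrightarrow> inv y \<in> H" "range x \<subseteq> H"
    and f: "finite {a. f a \<noteq> 0}"
  shows "lincomb f \<in> H"
proof -
  note HD = K_subalgebraD[OF H(1)]
  have "ordered_prod xs a \<in> H" for xs a
  proof (induction xs)
    case (Cons i xs)
    have "x i [^] a $ i \<in> H" using H by (intro x_int_pow_in_subfield) auto
    then show ?case using Cons HD(4) by simp
  qed (use HD in simp)
  then have M: "M a \<in> H" for a by (simp add: M_ordered_prod HD(6))
  show ?thesis
    using f subset_UNIV
  proof (induction rule: finite_support_induct)
    fix a s f assume "finite {c. f c \<noteq> (0::qfield)}" "lincomb f \<in> H"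
    then show "lincomb (\<lambda>c. torus_monom a s c + f c) \<in> H"
      using M HD(5,6) by (simp add: lincomb_add)
  qed (use HD in simp)
qed

text \<open>Independence makes \<open>lincomb\<close> an embedding, and common right multiples in
  the torus give the Ore condition for its image. The right fractions form a skew-field containing
  the tuple, so minimality puts \<open>G\<close> inside them. Conversely \<open>G\<close>, closed
  under inverses, contains all monomials, including those with negative exponents.\<close>

lemma quantum_torus_fractions:
  assumes indep: "\<And>f. \<lbrakk>finite {a. f a \<noteq> 0}; lincomb f = \<zero>\<rbrakk> \<Longrightarrow> f = (\<lambda>c. 0)"
  defines "G \<equiv> K_skew_subfield_generated F (range x)"
  shows "skew_field_of_fractions (quantum_torus L) (F\<lparr>carrier := G\<rparr>) lincomb"
proof -
  let ?T = "quantum_torus L" and ?H = "lincomb ` carrier (quantum_torus L)"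
  have inj: "inj_on lincomb (carrier ?T)"
  proof
    fix f g assume "f \<in> carrier ?T" "g \<in> carrier ?T" and eq: "lincomb f = lincomb g"
    then have fin: "finite {a. f a \<noteq> 0}" "finite {a. g a \<noteq> 0}" by (simp_all add: quantum_torus_simps)
    then have fin': "finite {a. - 1 * g a \<noteq> 0}" by simp
    have "lincomb (\<lambda>c. f c + (- 1) * g c) = lincomb f \<oplus> \<ominus> lincomb g"
      using lincomb_add[OF fin(1) fin'] lincomb_smult[OF fin(2), of "- 1"] K_uminus[of "lincomb g"] by simp
    then have "lincomb (\<lambda>c. f c + (- 1) * g c) = \<zero>" by (simp add: eq r_neg)
    then have "(\<lambda>c. f c + (- 1) * g c) = (\<lambda>c. 0)"
      using finite_support_add[OF fin(1) fin'] by (rule indep[rotated])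
    then show "f = g" by (simp add: fun_eq_iff)
  qed
  have T: "K_algebra ?T"
  proof (rule K_algebra_transfer[OF lincomb_hom inj])
    fix s f assume "f \<in> carrier ?T"
    then show "s \<odot>\<^bsub>?T\<^esub> f \<in> carrier ?T"
      by (auto simp: quantum_torus_simps intro: finite_subset[rotated])
  next
    fix f g assume "f \<in> carrier ?T" "g \<in> carrier ?T"
    then show "f \<otimes>\<^bsub>?T\<^esub> g \<in> carrier ?T" "f \<oplus>\<^bsub>?T\<^esub> g \<in> carrier ?T"
      by (simp_all only: quantum_torus_simps(1,5) mem_Collect_eq quantum_torus_mult_closed finite_support_add)
  qed (simp_all add: quantum_torus_simps)
  have H: "K_subalgebra ?H F" by (rule K_subalgebra_hom_image[OF lincomb_hom T])
  have "right_Ore ?H"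
    unfolding right_Ore_def
  proof (intro ballI)
    fix a b assume "a \<in> ?H" "b \<in> ?H - {\<zero>}"
    then obtain f g where fg: "finite {c. f c \<noteq> 0}" "finite {c. g c \<noteq> 0}" "a = lincomb f" "b = lincomb g"
      and b: "b \<noteq> \<zero>" by (auto simp: quantum_torus_simps)
    obtain p p' where p: "finite {c. p c \<noteq> 0}" "finite {c. p' c \<noteq> 0}"
      "p \<noteq> (\<lambda>c. 0) \<or> p' \<noteq> (\<lambda>c. 0)" "f \<otimes>\<^bsub>?T\<^esub> p = g \<otimes>\<^bsub>?T\<^esub> p'"
      using quantum_torus_common_multiple[OF fg(1,2)] by blast
    have eq: "a \<otimes> lincomb p = b \<otimes> lincomb p'"
      unfolding fg(3,4) lincomb_mult[OF fg(1) p(1), symmetric] lincomb_mult[OF fg(2) p(2), symmetric] p(4)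
      by (rule refl)
    \<comment> \<open>Were it zero, independence would force \<open>p\<close> to vanish, hence
      \<open>p'\<close> not to, and \<open>b\<close> would be a zero divisor.\<close>
    have "lincomb p \<noteq> \<zero>"
    proof
      assume z: "lincomb p = \<zero>"
      then have "p = (\<lambda>c. 0)" using p(1) by (intro indep)
      then have "lincomb p' \<noteq> \<zero>" using p(2,3) indep by blast
      moreover have "b \<otimes> lincomb p' = \<zero>" using eq z fg by simp
      ultimately show False using mult_nonzero[of b "lincomb p'"] b fg by simp
    qed
    then show "\<exists>c\<in>?H. \<exists>d\<in>?H - {\<zero>}. a \<otimes> d = b \<otimes> c"
      using eq p(1,2) by (auto simp: quantum_torus_simps(1))
  qed
  note Q = right_fractions_subfield[OF H this]
  have x: "range x \<subseteq> carrier F" by auto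
  note G = K_skew_subfield_generated_props[OF x, folded G_def]
  have "x i \<in> ?H" for i
    using lincomb_gen[of i] by (intro image_eqI[of _ _ "torus_gen i"]) (auto simp: quantum_torus_simps torus_gen_monom)
  then have "G \<subseteq> right_fractions ?H"
    unfolding G_def using Q by (intro K_skew_subfield_generated_least) auto
  have lG: "lincomb f \<in> G" if "f \<in> carrier ?T" for f
    using that G by (intro lincomb_in_subfield) (auto simp: quantum_torus_simps)
  note GF = K_skew_field_restrict[OF G(1,3)]
  have zT: "lincomb \<zero>\<^bsub>?T\<^esub> = \<zero>" by (simp add: quantum_torus_simps)
  have "\<exists>a\<in>carrier ?T. \<exists>b\<in>carrier ?T - {\<zero>\<^bsub>?T\<^esub>}.
      y = lincomb a \<otimes>\<^bsub>F\<lparr>carrier := G\<rparr>\<^esub> inv\<^bsub>F\<lparr>carrier := G\<rparr>\<^esub> (lincomb b)" if y: "y \<in> G" for y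
  proof -
    obtain a b where ab: "a \<in> carrier ?T" "b \<in> carrier ?T" "lincomb b \<noteq> \<zero>" "y = lincomb a \<otimes> inv (lincomb b)"
      using \<open>G \<subseteq> right_fractions ?H\<close> y unfolding right_fractions_def by blast
    moreover have "inv\<^bsub>F\<lparr>carrier := G\<rparr>\<^esub> (lincomb b) = inv (lincomb b)"
      using ab lG by (intro GF(2)) auto
    moreover have "b \<noteq> \<zero>\<^bsub>?T\<^esub>" using ab(3) zT by auto
    ultimately show ?thesis by (intro bexI[of _ a] bexI[of _ b]) auto
  qed
  moreover have "lincomb \<in> K_algebra_hom ?T (F\<lparr>carrier := G\<rparr>)"
    using lincomb_hom lG unfolding K_algebra_hom_def ring_hom_def by auto
  ultimately show ?thesis
    unfolding skew_field_of_fractions_def using T GF(1) inj by simp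
qed

end

section \<open>Relations and independence in a skew-field of fractions of a quantum torus\<close>

lemma q_commuting_of_fractions:
  fixes L :: "int^('n::{finite,linorder})^('n::{finite,linorder})"
  assumes \<phi>: "skew_field_of_fractions (quantum_torus L) F \<phi>" "\<And>i. \<phi> (torus_gen i) = x i"
    and L: "skew_symmetric L"
  shows "q_commuting F x L"
proof -
  interpret F: K_skew_field F using \<phi>(1) by (simp add: skew_field_of_fractions_def)
  interpret T: K_algebra "quantum_torus L" using \<phi>(1) by (simp add: skew_field_of_fractions_def)
  have hom: "\<phi> \<in> K_algebra_hom (quantum_torus L) F" and inj: "inj_on \<phi> (carrier (quantum_torus L))"
    using \<phi>(1) by (simp_all add: skew_field_of_fractions_def)
  note s = K_algebra_hom_simps[OF hom]
  have gen: "torus_gen i \<in> carrier (quantum_torus L)" for i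
    by (simp add: quantum_torus_simps torus_gen_monom)
  have z: "\<phi> \<zero>\<^bsub>quantum_torus L\<^esub> = \<zero>\<^bsub>F\<^esub>"
    using s(4)[OF T.zero_closed, of 0] s(1)[OF T.zero_closed] by simp
  show ?thesis
  proof
    fix i j
    show "x i \<in> carrier F" using s(1)[OF gen] by (simp add: \<phi>(2))
    have "torus_gen i \<noteq> \<zero>\<^bsub>quantum_torus L\<^esub>"
      by (auto simp: quantum_torus_simps torus_gen_def fun_eq_iff)
    then have "\<phi> (torus_gen i) \<noteq> \<phi> \<zero>\<^bsub>quantum_torus L\<^esub>"
      using inj gen T.zero_closed by (meson inj_on_def)
    then show "x i \<noteq> \<zero>\<^bsub>F\<^esub>" by (simp add: \<phi>(2) z)
    have "torus_gen i \<otimes>\<^bsub>quantum_torus L\<^esub> torus_gen j =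
        q_half powi (2 * L $ i $ j) \<odot>\<^bsub>quantum_torus L\<^esub> (torus_gen j \<otimes>\<^bsub>quantum_torus L\<^esub> torus_gen i)"
      by (simp add: torus_gen_monom torus_monom_mult quantum_torus_simps(6) skew_symmetric_nth[OF L, of j i])
        (auto simp: torus_monom_def fun_eq_iff add.commute)
    then have "\<phi> (torus_gen i \<otimes>\<^bsub>quantum_torus L\<^esub> torus_gen j) =
        q_half powi (2 * L $ i $ j) \<odot>\<^bsub>F\<^esub> \<phi> (torus_gen j \<otimes>\<^bsub>quantum_torus L\<^esub> torus_gen i)"
      using gen by (simp add: s)
    then show "F.q_commute (2 * L $ i $ j) (x i) (x j)"
      unfolding F.q_commute_def using gen by (simp add: s \<phi>(2))
  qed (rule L)
qed

text \<open>The embedding \<open>\<phi>\<close> is prescribed on generators only. Building up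
  exponents one generator at a time shows that it agrees with \<open>lincomb\<close> where exponents
  are nonnegative, and \<open>\<phi>\<close> is injective.\<close>

lemma qmonomials_independent:
  fixes L :: "int^('n::{finite,linorder})^('n::{finite,linorder})"
  assumes \<phi>: "skew_field_of_fractions (quantum_torus L) F \<phi>" "\<And>i. \<phi> (torus_gen i) = x i"
    and L: "skew_symmetric L"
    and f: "finite {a. f a \<noteq> 0}" "{a. f a \<noteq> 0} \<subseteq> {a. \<forall>i. 0 \<le> a $ i}"
      "q_commuting.lincomb F x L f = \<zero>\<^bsub>F\<^esub>"
  shows "f = (\<lambda>c. 0)"
proof -
  interpret F: q_commuting F x L by (rule q_commuting_of_fractions[OF \<phi> L])
  interpret T: K_algebra "quantum_torus L" using \<phi>(1) by (simp add: skew_field_of_fractions_def)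
  have hom: "\<phi> \<in> K_algebra_hom (quantum_torus L) F" and inj: "inj_on \<phi> (carrier (quantum_torus L))"
    using \<phi>(1) by (simp_all add: skew_field_of_fractions_def)
  note s = K_algebra_hom_simps[OF hom]
  have z: "\<phi> \<zero>\<^bsub>quantum_torus L\<^esub> = \<zero>\<^bsub>F\<^esub>"
    using s(4)[OF T.zero_closed, of 0] s(1)[OF T.zero_closed] by simp
  have car: "torus_monom a c \<in> carrier (quantum_torus L)" for a c by (simp add: quantum_torus_simps)
  have monom_smult: "torus_monom a c = c \<odot>\<^bsub>quantum_torus L\<^esub> torus_monom a 1" for a c
    by (auto simp: quantum_torus_simps torus_monom_def)
  have phi_smult: "\<phi> (torus_monom a c) = c \<odot>\<^bsub>F\<^esub> \<phi> (torus_monom a 1)" for a c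
    using s(4)[OF car, of c a 1] by (simp flip: monom_smult)
  have M: "\<phi> (torus_monom a 1) = F.M a" if "\<And>i. 0 \<le> a $ i" for a
    using that
  proof (induction rule: nonneg_vec_induct)
    case zero
    then show ?case using s(5) by (simp add: quantum_torus_simps)
  next
    case (step a i)
    have "q_half powi (bil L a (axis i 1)) \<odot>\<^bsub>F\<^esub> \<phi> (torus_monom (a + axis i 1) 1) =
        \<phi> (torus_monom a 1 \<otimes>\<^bsub>quantum_torus L\<^esub> torus_gen i)"
      by (simp add: torus_gen_monom torus_monom_mult phi_smult[of "a + axis i 1" "q_half powi _"])
    also have "\<dots> = F.M a \<otimes>\<^bsub>F\<^esub> F.M (axis i 1)"
      using s(2)[OF car car, of a 1 "axis i 1" 1] step by (simp add: \<phi>(2) flip: torus_gen_monom)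
    finally show ?case
      unfolding F.M_mult by (rule F.K_smult_cancel[rotated 2]) (auto intro: s(1) car)
  qed
  have "\<phi> f = F.lincomb f"
    using f(1,2)
  proof (induction rule: finite_support_induct)
    show "\<phi> (\<lambda>c. 0) = F.lincomb (\<lambda>c. 0)" using z by (simp add: quantum_torus_simps)
  next
    fix a :: "(int, 'n) vec" and c f assume a: "a \<in> {a. \<forall>i. 0 \<le> a $ i}" and f: "finite {c. f c \<noteq> (0::qfield)}" and IH: "\<phi> f = F.lincomb f"
    have "\<phi> (torus_monom a c \<oplus>\<^bsub>quantum_torus L\<^esub> f) = \<phi> (torus_monom a c) \<oplus>\<^bsub>F\<^esub> \<phi> f"
      using f by (intro s(3) car) (simp add: quantum_torus_simps)
    moreover have "\<phi> (torus_monom a c) = F.lincomb (torus_monom a c)"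
      using M[of a] a unfolding phi_smult[of a c] F.lincomb_monom by simp
    ultimately show "\<phi> (\<lambda>c'. torus_monom a c c' + f c') = F.lincomb (\<lambda>c'. torus_monom a c c' + f c')"
      unfolding IH quantum_torus_add F.lincomb_add[OF finite_support_torus_monom f] by simp
  qed
  then have "\<phi> f = \<phi> \<zero>\<^bsub>quantum_torus L\<^esub>" using f(3) z by simp
  then have "f = \<zero>\<^bsub>quantum_torus L\<^esub>"
    using inj f(1) T.zero_closed by (auto simp: inj_on_def quantum_torus_simps(1))
  then show ?thesis by (simp add: quantum_torus_simps)
qed



section \<open>Twisting along a skew-Laurent extension\<close>

text \<open>\<open>C\<close> plays the cluster algebra inside its skew-field \<open>F\<close>, and
  \<open>D\<close> receives its skew-Laurent extension. The automorphism is confined to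
  \<open>C\<close>, so statements about it carry membership in \<open>C\<close>.\<close>

locale skew_laurent_embedding = F: K_skew_field F + D: K_skew_field D
  for F :: "(qfield, 'a) module" and D :: "(qfield, 'd) module" +
  fixes C :: "'a set" and \<tau> :: "'a \<Rightarrow> 'a" and \<iota> :: "(int \<Rightarrow> 'a) \<Rightarrow> 'd"
  assumes C: "K_subalgebra C F"
    and aut: "K_algebra_automorphism (F\<lparr>carrier := C\<rparr>) \<tau>"
    and laurent_algebra: "K_algebra (skew_laurent (F\<lparr>carrier := C\<rparr>) \<tau>)"
    and iota_hom: "\<iota> \<in> K_algebra_hom (skew_laurent (F\<lparr>carrier := C\<rparr>) \<tau>) D"
    and iota_inj: "inj_on \<iota> (carrier (skew_laurent (F\<lparr>carrier := C\<rparr>) \<tau>))"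
begin

sublocale A: K_algebra "F\<lparr>carrier := C\<rparr>"
  by (rule F.K_algebra_restrict[OF C])

abbreviation R :: "(qfield, int \<Rightarrow> 'a) module"
  where "R \<equiv> skew_laurent (F\<lparr>carrier := C\<rparr>) \<tau>"

lemma C_closed [simp]: "x \<in> C \<Longrightarrow> x \<in> carrier F"
  using K_subalgebraD(1)[OF C] by blast

lemma laurent_simps:
  "carrier R = {f. (\<forall>m. f m \<in> C) \<and> finite {m. f m \<noteq> \<zero>\<^bsub>F\<^esub>}}"
  "f \<otimes>\<^bsub>R\<^esub> g = (\<lambda>n. \<Oplus>\<^bsub>F\<lparr>carrier := C\<rparr>\<^esub>m\<in>{m. f m \<noteq> \<zero>\<^bsub>F\<^esub>}. f m \<otimes>\<^bsub>F\<^esub> aut_pow (F\<lparr>carrier := C\<rparr>) \<tau> m (g (n - m)))"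
  "\<zero>\<^bsub>R\<^esub> = (\<lambda>n. \<zero>\<^bsub>F\<^esub>)"
  "f \<oplus>\<^bsub>R\<^esub> g = (\<lambda>n. f n \<oplus>\<^bsub>F\<^esub> g n)"
  "c \<odot>\<^bsub>R\<^esub> f = (\<lambda>n. c \<odot>\<^bsub>F\<^esub> f n)"
  by (simp_all add: skew_laurent_def)

text \<open>Homogeneity of degree \<open>t\<close>: the eigenvalue \<open>q^t\<close> is
  \<open>q_half powi (2 * t)\<close>. Zero counts as homogeneous of every degree.\<close>

definition eigen :: "int \<Rightarrow> 'a \<Rightarrow> bool"
  where "eigen t x \<longleftrightarrow> x \<in> C \<and> \<tau> x = q_half powi (2 * t) \<odot>\<^bsub>F\<^esub> x"

lemma eigen_closed [simp]: "eigen t x \<Longrightarrow> x \<in> C"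
  by (simp add: eigen_def)

lemma tau_simps:
  "x \<in> C \<Longrightarrow> \<tau> x \<in> C"
  "\<lbrakk>x \<in> C; y \<in> C\<rbrakk> \<Longrightarrow> \<tau> (x \<otimes>\<^bsub>F\<^esub> y) = \<tau> x \<otimes>\<^bsub>F\<^esub> \<tau> y"
  "\<lbrakk>x \<in> C; y \<in> C\<rbrakk> \<Longrightarrow> \<tau> (x \<oplus>\<^bsub>F\<^esub> y) = \<tau> x \<oplus>\<^bsub>F\<^esub> \<tau> y"
  "x \<in> C \<Longrightarrow> \<tau> (c \<odot>\<^bsub>F\<^esub> x) = c \<odot>\<^bsub>F\<^esub> \<tau> x"
  "\<tau> \<one>\<^bsub>F\<^esub> = \<one>\<^bsub>F\<^esub>"
  "inj_on \<tau> C"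
proof -
  have h: "\<tau> \<in> K_algebra_hom (F\<lparr>carrier := C\<rparr>) (F\<lparr>carrier := C\<rparr>)" and b: "bij_betw \<tau> C C"
    using aut by (simp_all add: K_algebra_automorphism_def)
  show "x \<in> C \<Longrightarrow> \<tau> x \<in> C"
    "\<lbrakk>x \<in> C; y \<in> C\<rbrakk> \<Longrightarrow> \<tau> (x \<otimes>\<^bsub>F\<^esub> y) = \<tau> x \<otimes>\<^bsub>F\<^esub> \<tau> y"
    "\<lbrakk>x \<in> C; y \<in> C\<rbrakk> \<Longrightarrow> \<tau> (x \<oplus>\<^bsub>F\<^esub> y) = \<tau> x \<oplus>\<^bsub>F\<^esub> \<tau> y"
    "x \<in> C \<Longrightarrow> \<tau> (c \<odot>\<^bsub>F\<^esub> x) = c \<odot>\<^bsub>F\<^esub> \<tau> x"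
    "\<tau> \<one>\<^bsub>F\<^esub> = \<one>\<^bsub>F\<^esub>"
    using K_algebra_hom_simps[OF h] by simp_all
  show "inj_on \<tau> C" using b by (rule bij_betw_imp_inj_on)
qed

lemmas C_ops = K_subalgebraD(2-6)[OF C]

lemma eigen_mult:
  assumes "eigen t x" "eigen t' y"
  shows "eigen (t + t') (x \<otimes>\<^bsub>F\<^esub> y)"
proof -
  have C': "x \<in> C" "y \<in> C" using assms by simp_all
  have "\<tau> (x \<otimes>\<^bsub>F\<^esub> y) = (q_half powi (2 * t) \<odot>\<^bsub>F\<^esub> x) \<otimes>\<^bsub>F\<^esub> (q_half powi (2 * t') \<odot>\<^bsub>F\<^esub> y)"
    using assms by (simp add: eigen_def tau_simps)
  then show ?thesis
    using C' by (simp add: eigen_def C_ops F.smult_mult_left F.smult_mult_right distrib_left add.commute)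
qed

lemma eigen_add: "eigen t x \<Longrightarrow> eigen t y \<Longrightarrow> eigen t (x \<oplus>\<^bsub>F\<^esub> y)"
  by (simp add: eigen_def tau_simps C_ops F.K_smult_add_right)

lemma eigen_smult: "eigen t x \<Longrightarrow> eigen t (c \<odot>\<^bsub>F\<^esub> x)"
  by (simp add: eigen_def tau_simps C_ops mult.commute)

lemma eigen_one: "eigen 0 \<one>\<^bsub>F\<^esub>"
  by (simp add: eigen_def tau_simps C_ops)

lemma eigen_zero: "eigen t \<zero>\<^bsub>F\<^esub>"
  using eigen_smult[OF eigen_one, of 0] tau_simps(4)[of "\<one>\<^bsub>F\<^esub>" 0]
  by (simp add: eigen_def C_ops tau_simps(5))

lemma aut_pow_eigen:
  assumes "eigen t x"
  shows "aut_pow (F\<lparr>carrier := C\<rparr>) \<tau> m x = q_half powi (2 * (m * t)) \<odot>\<^bsub>F\<^esub> x"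
proof -
  have x: "x \<in> C" "\<tau> x = q_half powi (2 * t) \<odot>\<^bsub>F\<^esub> x" using assms by (simp_all add: eigen_def)
  have pos: "(\<tau> ^^ n) x = q_half powi (2 * (int n * t)) \<odot>\<^bsub>F\<^esub> x" for n
  proof (induction n)
    case (Suc n)
    then show ?case using x by (simp add: tau_simps algebra_simps)
  qed (use x in simp)
  have neg: "(inv_into C \<tau> ^^ n) x = q_half powi (2 * (- int n * t)) \<odot>\<^bsub>F\<^esub> x" for n
  proof (induction n)
    case (Suc n)
    have "inv_into C \<tau> (q_half powi (2 * (- int n * t)) \<odot>\<^bsub>F\<^esub> x) = q_half powi (2 * (- int (Suc n) * t)) \<odot>\<^bsub>F\<^esub> x"
      by (rule inv_into_f_eq) (use x in \<open>simp_all add: tau_simps C_ops algebra_simps\<close>)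
    then show ?case using Suc by simp
  qed (use x in simp)
  show ?thesis
    using pos[of "nat m"] neg[of "nat (- m)"] by (simp add: aut_pow_def)
qed

abbreviation lmon :: "'a \<Rightarrow> int \<Rightarrow> int \<Rightarrow> 'a"
  where "lmon \<equiv> laurent_monom (F\<lparr>carrier := C\<rparr>)"

lemma lmon_nth: "lmon a m n = (if n = m then a else \<zero>\<^bsub>F\<^esub>)"
  by (simp add: laurent_monom_def)

lemma lmon_closed: "a \<in> C \<Longrightarrow> lmon a m \<in> carrier R"
  unfolding laurent_simps
  by (auto simp: lmon_nth C_ops intro: finite_subset[of _ "{m}"])

lemma lmon_add: "\<lbrakk>a \<in> C; b \<in> C\<rbrakk> \<Longrightarrow> lmon (a \<oplus>\<^bsub>F\<^esub> b) m = lmon a m \<oplus>\<^bsub>R\<^esub> lmon b m"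
  by (auto simp: laurent_simps lmon_nth)

lemma lmon_smult: "a \<in> C \<Longrightarrow> lmon (c \<odot>\<^bsub>F\<^esub> a) m = c \<odot>\<^bsub>R\<^esub> lmon a m"
  by (auto simp: laurent_simps lmon_nth)

lemma lmon_mult:
  assumes a: "a \<in> C" and b: "eigen t b"
  shows "lmon a m \<otimes>\<^bsub>R\<^esub> lmon b n = lmon (q_half powi (2 * (m * t)) \<odot>\<^bsub>F\<^esub> (a \<otimes>\<^bsub>F\<^esub> b)) (m + n)"
proof
  fix k
  have e: "aut_pow (F\<lparr>carrier := C\<rparr>) \<tau> m (lmon b n (k - m)) =
      (if k = m + n then q_half powi (2 * (m * t)) \<odot>\<^bsub>F\<^esub> b else \<zero>\<^bsub>F\<^esub>)"
    using aut_pow_eigen[OF b, of m] aut_pow_eigen[OF eigen_zero, of m] by (auto simp: lmon_nth)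
  have bC: "b \<in> C" using b by simp
  have "(lmon a m \<otimes>\<^bsub>R\<^esub> lmon b n) k = a \<otimes>\<^bsub>F\<^esub> aut_pow (F\<lparr>carrier := C\<rparr>) \<tau> m (lmon b n (k - m))"
  \<comment> \<open>The product sums over the support of the left factor, which is empty when
    \<open>a\<close> is zero and \<open>{m}\<close> otherwise.\<close>
  proof (cases "a = \<zero>\<^bsub>F\<^esub>")
    case True
    then have "{m'. lmon a m m' \<noteq> \<zero>\<^bsub>F\<^esub>} = {}" by (auto simp: lmon_nth)
    then show ?thesis using True bC A.finsum_empty by (simp add: laurent_simps e)
  next
    case False
    then have s: "{m'. lmon a m m' \<noteq> \<zero>\<^bsub>F\<^esub>} = {m}" by (auto simp: lmon_nth)
    let ?h = "\<lambda>m'. lmon a m m' \<otimes>\<^bsub>F\<^esub> aut_pow (F\<lparr>carrier := C\<rparr>) \<tau> m' (lmon b n (k - m'))"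
    have h: "?h m = a \<otimes>\<^bsub>F\<^esub> aut_pow (F\<lparr>carrier := C\<rparr>) \<tau> m (lmon b n (k - m))"
      by (simp add: lmon_nth)
    have "?h m \<in> C" unfolding h e using a bC by (simp add: C_ops lmon_nth)
    then have "(\<Oplus>\<^bsub>F\<lparr>carrier := C\<rparr>\<^esub>m'\<in>{m}. ?h m') = ?h m"
      using A.finsum_insert[of "{}" m ?h] A.finsum_empty[of ?h] by simp
    then show ?thesis unfolding laurent_simps s using h by simp
  qed
  then show "(lmon a m \<otimes>\<^bsub>R\<^esub> lmon b n) k =
      lmon (q_half powi (2 * (m * t)) \<odot>\<^bsub>F\<^esub> (a \<otimes>\<^bsub>F\<^esub> b)) (m + n) k"
    unfolding e using a bC by (auto simp: lmon_nth F.smult_mult_right)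
qed

lemmas iota_simps = K_algebra_hom_simps[OF iota_hom]

lemma iota_eq_zero:
  assumes "f \<in> carrier R" "\<iota> f = \<zero>\<^bsub>D\<^esub>"
  shows "f = \<zero>\<^bsub>R\<^esub>"
proof -
  interpret RR: K_algebra R by (rule laurent_algebra)
  have "\<iota> \<zero>\<^bsub>R\<^esub> = \<zero>\<^bsub>D\<^esub>"
    using iota_simps(4)[OF RR.zero_closed, of 0] iota_simps(1)[OF RR.zero_closed] by simp
  then show ?thesis using iota_inj assms RR.zero_closed by (auto simp: inj_on_def)
qed

text \<open>The element \<open>q\<^bsup>tu/2\<^esup> x z\<^sup>u\<close> attached to an eigenvector \<open>x\<close> of \<open>\<tau>\<close> with eigenvalue \<open>q\<^sup>t\<close>.\<close>

definition twist :: "int \<Rightarrow> int \<Rightarrow> 'a \<Rightarrow> 'd"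
  where "twist t u x = \<iota> (lmon (q_half powi (t * u) \<odot>\<^bsub>F\<^esub> x) u)"

lemma twist_in_image: "x \<in> C \<Longrightarrow> twist t u x \<in> \<iota> ` carrier R"
  unfolding twist_def by (intro imageI lmon_closed) (simp add: C_ops)

lemma twist_closed [simp]: "x \<in> C \<Longrightarrow> twist t u x \<in> carrier D"
  unfolding twist_def by (intro iota_simps lmon_closed) (simp add: C_ops)

lemma twist_add: "\<lbrakk>x \<in> C; y \<in> C\<rbrakk> \<Longrightarrow> twist t u (x \<oplus>\<^bsub>F\<^esub> y) = twist t u x \<oplus>\<^bsub>D\<^esub> twist t u y"
  unfolding twist_def
  by (simp add: F.K_smult_add_right lmon_add C_ops lmon_closed iota_simps(3))

lemma twist_smult: "x \<in> C \<Longrightarrow> twist t u (c \<odot>\<^bsub>F\<^esub> x) = c \<odot>\<^bsub>D\<^esub> twist t u x"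
  unfolding twist_def
  using iota_simps(4)[of "lmon (q_half powi (t * u) \<odot>\<^bsub>F\<^esub> x) u" c] lmon_closed[of "q_half powi (t * u) \<odot>\<^bsub>F\<^esub> x" u]
  by (simp add: C_ops mult.commute flip: lmon_smult)

lemma twist_nonzero:
  assumes "x \<in> C" "x \<noteq> \<zero>\<^bsub>F\<^esub>"
  shows "twist t u x \<noteq> \<zero>\<^bsub>D\<^esub>"
proof
  assume "twist t u x = \<zero>\<^bsub>D\<^esub>"
  then have "lmon (q_half powi (t * u) \<odot>\<^bsub>F\<^esub> x) u = \<zero>\<^bsub>R\<^esub>"
    unfolding twist_def using assms by (intro iota_eq_zero lmon_closed) (simp_all add: C_ops)
  then have "lmon (q_half powi (t * u) \<odot>\<^bsub>F\<^esub> x) u u = \<zero>\<^bsub>R\<^esub> u" by simp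
  then have "q_half powi (t * u) \<odot>\<^bsub>F\<^esub> x = \<zero>\<^bsub>F\<^esub>" by (simp add: lmon_nth laurent_simps)
  then show False using F.smult_nonzero[of x "q_half powi (t * u)"] assms by simp
qed

text \<open>In powers of \<open>q_half\<close>, the normalisations contribute
  \<open>t u + t' u'\<close> and moving \<open>z^u\<close> past \<open>y\<close> contributes
  \<open>2 u t'\<close>; the normalisation of the product absorbs \<open>(t + t') (u + u')\<close>,
  and \<open>u t' - t u'\<close> remains.\<close>

lemma twist_mult:
  assumes x: "eigen t x" and y: "eigen t' y"
  shows "twist t u x \<otimes>\<^bsub>D\<^esub> twist t' u' y =
    q_half powi (u * t' - t * u') \<odot>\<^bsub>D\<^esub> twist (t + t') (u + u') (x \<otimes>\<^bsub>F\<^esub> y)"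
proof -
  have C': "x \<in> C" "y \<in> C" using x y by simp_all
  have "twist t u x \<otimes>\<^bsub>D\<^esub> twist t' u' y =
      \<iota> (lmon (q_half powi (t * u) \<odot>\<^bsub>F\<^esub> x) u \<otimes>\<^bsub>R\<^esub> lmon (q_half powi (t' * u') \<odot>\<^bsub>F\<^esub> y) u')"
    unfolding twist_def using C' by (simp add: iota_simps(2) lmon_closed C_ops)
  also have "\<dots> = \<iota> (lmon (q_half powi (2 * (u * t')) \<odot>\<^bsub>F\<^esub>
      ((q_half powi (t * u) \<odot>\<^bsub>F\<^esub> x) \<otimes>\<^bsub>F\<^esub> (q_half powi (t' * u') \<odot>\<^bsub>F\<^esub> y))) (u + u'))"
    using C' by (subst lmon_mult[OF _ eigen_smult[OF y]]) (simp_all add: C_ops)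
  also have "\<dots> = twist (t + t') (u + u') (q_half powi (u * t' - t * u') \<odot>\<^bsub>F\<^esub> (x \<otimes>\<^bsub>F\<^esub> y))"
    unfolding twist_def using C'
    by (simp add: F.smult_mult_left F.smult_mult_right algebra_simps)
  also have "\<dots> = q_half powi (u * t' - t * u') \<odot>\<^bsub>D\<^esub> twist (t + t') (u + u') (x \<otimes>\<^bsub>F\<^esub> y)"
    using C' by (intro twist_smult) (simp add: C_ops)
  finally show ?thesis .
qed

lemma twist_q_commute:
  assumes x: "eigen t x" and y: "eigen t' y" and "F.q_commute h x y"
  shows "D.q_commute (h + 2 * (u * t' - t * u')) (twist t u x) (twist t' u' y)"
proof -
  have C': "x \<in> C" "y \<in> C" using x y by simp_all
  have "twist t u x \<otimes>\<^bsub>D\<^esub> twist t' u' y =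
      q_half powi (u * t' - t * u') \<odot>\<^bsub>D\<^esub> twist (t + t') (u + u') (q_half powi h \<odot>\<^bsub>F\<^esub> (y \<otimes>\<^bsub>F\<^esub> x))"
    using assms(3) by (simp add: twist_mult[OF x y] F.q_commute_def)
  also have "\<dots> = q_half powi (u * t' - t * u' + h) \<odot>\<^bsub>D\<^esub> twist (t' + t) (u' + u) (y \<otimes>\<^bsub>F\<^esub> x)"
    using C' by (simp add: twist_smult C_ops add.commute)
  also have "\<dots> = q_half powi (h + 2 * (u * t' - t * u')) \<odot>\<^bsub>D\<^esub> (twist t' u' y \<otimes>\<^bsub>D\<^esub> twist t u x)"
    unfolding twist_mult[OF y x] using C' by (simp add: C_ops algebra_simps)
  finally show ?thesis by (simp add: D.q_commute_def)
qed

end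

section \<open>Twisting a q-commuting tuple of eigenvectors\<close>

locale twisted_tuple = skew_laurent_embedding F D C \<tau> \<iota> + S: q_commuting F x L
  for F :: "(qfield, 'a) module" and D :: "(qfield, 'd) module"
    and C :: "'a set" and \<tau> :: "'a \<Rightarrow> 'a" and \<iota> :: "(int \<Rightarrow> 'a) \<Rightarrow> 'd"
    and x :: "'n::{finite,linorder} \<Rightarrow> 'a"
    and L :: "int^('n::{finite,linorder})^('n::{finite,linorder})" +
  fixes t u :: "int^('n::{finite,linorder})"
  assumes x_eigen: "eigen (t $ i) (x i)"
begin

definition y :: "'n \<Rightarrow> 'd"
  where "y i = twist (t $ i) (u $ i) (x i)"

sublocale S': q_commuting D y "L - wedge t u"
proof
  fix i j
  have xC: "x i \<in> C" for i using x_eigen by (rule eigen_closed)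
  show "y i \<in> carrier D" using xC by (simp add: y_def)
  show "y i \<noteq> \<zero>\<^bsub>D\<^esub>" using xC by (simp add: y_def twist_nonzero)
  show "D.q_commute (2 * (L - wedge t u) $ i $ j) (y i) (y j)"
    using twist_q_commute[OF x_eigen[of i] x_eigen[of j] S.x_commute[of i j], where u = "u $ i" and u' = "u $ j"]
    by (simp add: y_def wedge_def algebra_simps)
  show "skew_symmetric (L - wedge t u)"
    by (intro skew_symmetric_diff S.L_skew skew_symmetric_wedge)
qed

text \<open>Nonnegativity keeps every intermediate product in \<open>C\<close>, where twisting makes
  sense. At each step the exponent from \<open>twist_mult\<close> is the difference between the
  forms \<open>L - wedge t u\<close> and \<open>L\<close>.\<close>

lemma M_twist:
  assumes "\<And>i. 0 \<le> c $ i"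
  shows "eigen (dot t c) (S.M c) \<and> S'.M c = twist (dot t c) (dot u c) (S.M c)"
  using assms
proof (induction rule: nonneg_vec_induct)
  case zero
  have "lmon \<one>\<^bsub>F\<^esub> 0 = \<one>\<^bsub>R\<^esub>"
    by (simp add: skew_laurent_def laurent_monom_def cong: if_cong)
  then show ?case
    using iota_simps(5) by (simp add: eigen_one twist_def)
next
  case (step c i)
  let ?h = "bil L c (axis i 1)" and ?h' = "bil (L - wedge t u) c (axis i 1)"
  have e: "eigen (dot t c) (S.M c)" and M': "S'.M c = twist (dot t c) (dot u c) (S.M c)"
    using step by auto
  have M_step: "S.M (c + axis i 1) = q_half powi (- ?h) \<odot>\<^bsub>F\<^esub> (S.M c \<otimes>\<^bsub>F\<^esub> x i)"
    using S.M_mult[of c "axis i 1"] by simp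
  have prod: "S.M c \<otimes>\<^bsub>F\<^esub> x i = q_half powi ?h \<odot>\<^bsub>F\<^esub> S.M (c + axis i 1)"
    using S.M_mult[of c "axis i 1"] by simp
  have M'_step: "S'.M (c + axis i 1) = q_half powi (- ?h') \<odot>\<^bsub>D\<^esub> (S'.M c \<otimes>\<^bsub>D\<^esub> y i)"
    using S'.M_mult[of c "axis i 1"] by simp
  have e': "eigen (dot t (c + axis i 1)) (S.M (c + axis i 1))"
    unfolding M_step dot_add_right dot_axis_right by (intro eigen_smult eigen_mult e x_eigen)
  have "S'.M (c + axis i 1) = q_half powi (- ?h') \<odot>\<^bsub>D\<^esub>
      (q_half powi (dot u c * t $ i - dot t c * u $ i) \<odot>\<^bsub>D\<^esub>
        twist (dot t (c + axis i 1)) (dot u (c + axis i 1)) (S.M c \<otimes>\<^bsub>F\<^esub> x i))"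
    unfolding M'_step M' y_def twist_mult[OF e x_eigen] dot_add_right dot_axis_right ..
  also have "\<dots> = twist (dot t (c + axis i 1)) (dot u (c + axis i 1)) (S.M (c + axis i 1))"
    unfolding prod twist_smult[OF eigen_closed[OF e']] using eigen_closed[OF e']
    by (simp add: bil_wedge)
  finally show ?case using e' by blast
qed

text \<open>Multiplication by a monomial makes all exponents nonnegative. Then everything lies in the
  image of the skew-Laurent ring, where the coefficients of the powers of \<open>z\<close> can be compared.\<close>

lemma independent:
  assumes indep: "\<And>f. \<lbrakk>finite {a. f a \<noteq> 0}; {a. f a \<noteq> 0} \<subseteq> {a. \<forall>i. 0 \<le> a $ i}; S.lincomb f = \<zero>\<^bsub>F\<^esub>\<rbrakk>
      \<Longrightarrow> f = (\<lambda>c. 0)"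
    and f: "finite {a. f a \<noteq> 0}" "S'.lincomb f = \<zero>\<^bsub>D\<^esub>"
  shows "f = (\<lambda>c. 0)"
proof -
  \<comment> \<open>\<open>co f n\<close> extracts the terms of \<open>u\<close>-degree
    \<open>n\<close>, weighted by the normalisation of the twist. For \<open>f\<close> with
    nonnegative exponents, \<open>G f n\<close> is then the coefficient of \<open>z^n\<close> in the
    skew-Laurent element that \<open>\<iota>\<close> sends to \<open>S'.lincomb f\<close>.\<close>
  define co where "co = (\<lambda>f n c. if dot u c = n then q_half powi (dot t c * dot u c) * f c else 0)"
  define G where "G = (\<lambda>f n. S.lincomb (co f n))"
  have co_fin: "finite {c. co f n c \<noteq> 0}" if "finite {c. f c \<noteq> 0}" for f n
    by (rule finite_subset[OF _ that]) (auto simp: co_def)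
  have co_add: "co (\<lambda>c. torus_monom a s c + f c) n =
      (\<lambda>c. torus_monom a (co (\<lambda>_. s) n a) c + co f n c)" for a s f n
    by (auto simp: co_def torus_monom_def fun_eq_iff algebra_simps)
  have G: "S'.lincomb f = \<iota> (G f) \<and> G f \<in> carrier R"
    if "finite {c. f c \<noteq> 0}" "{c. f c \<noteq> 0} \<subseteq> {c. \<forall>i. 0 \<le> c $ i}" for f
    using that
  proof (induction rule: finite_support_induct)
    case zero
    interpret RR: K_algebra R by (rule laurent_algebra)
    have "G (\<lambda>c. 0) = \<zero>\<^bsub>R\<^esub>" by (simp add: G_def co_def laurent_simps cong: if_cong)
    moreover have "\<iota> \<zero>\<^bsub>R\<^esub> = \<zero>\<^bsub>D\<^esub>"
      using iota_simps(4)[OF RR.zero_closed, of 0] iota_simps(1)[OF RR.zero_closed] by simp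
    ultimately show ?case by simp
  next
    case (step a s f)
    interpret RR: K_algebra R by (rule laurent_algebra)
    have a: "eigen (dot t a) (S.M a)" "S'.M a = twist (dot t a) (dot u a) (S.M a)"
      using M_twist[of a] step by auto
    let ?m = "lmon ((q_half powi (dot t a * dot u a) * s) \<odot>\<^bsub>F\<^esub> S.M a) (dot u a)"
    have m: "?m \<in> carrier R" using a(1) by (intro lmon_closed) (simp add: C_ops)
    have "s \<odot>\<^bsub>D\<^esub> S'.M a = \<iota> ?m"
      using twist_smult[of "S.M a" "dot t a" "dot u a" s, symmetric] a
      by (simp add: twist_def)
    then have "S'.lincomb (\<lambda>c. torus_monom a s c + f c) = \<iota> ?m \<oplus>\<^bsub>D\<^esub> \<iota> (G f)"
      using step by (simp add: S'.lincomb_add)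
    also have "\<dots> = \<iota> (?m \<oplus>\<^bsub>R\<^esub> G f)"
      using step m by (simp add: iota_simps(3))
    also have "?m \<oplus>\<^bsub>R\<^esub> G f = G (\<lambda>c. torus_monom a s c + f c)"
    proof
      fix n
      have "G (\<lambda>c. torus_monom a s c + f c) n = co (\<lambda>_. s) n a \<odot>\<^bsub>F\<^esub> S.M a \<oplus>\<^bsub>F\<^esub> G f n"
        unfolding G_def co_add using co_fin[OF step(2)] by (simp add: S.lincomb_add)
      also have "co (\<lambda>_. s) n a \<odot>\<^bsub>F\<^esub> S.M a = ?m n"
        by (simp add: co_def lmon_nth)
      finally show "(?m \<oplus>\<^bsub>R\<^esub> G f) n = G (\<lambda>c. torus_monom a s c + f c) n"
        by (simp add: laurent_simps(4))
    qed
    finally have 1: "S'.lincomb (\<lambda>c. torus_monom a s c + f c) = \<iota> (G (\<lambda>c. torus_monom a s c + f c))" .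
    have "?m \<oplus>\<^bsub>R\<^esub> G f \<in> carrier R" using m step by (intro RR.a_closed) auto
    then show ?case using 1 \<open>?m \<oplus>\<^bsub>R\<^esub> G f = _\<close> by simp
  qed
  have nonneg: "g = (\<lambda>c. 0)"
    if g: "finite {c. g c \<noteq> 0}" "{c. g c \<noteq> 0} \<subseteq> {c. \<forall>i. 0 \<le> c $ i}" "S'.lincomb g = \<zero>\<^bsub>D\<^esub>" for g
  proof
    fix c
    have "G g = \<zero>\<^bsub>R\<^esub>" using G[OF g(1,2)] g(3) by (intro iota_eq_zero) auto
    then have "S.lincomb (co g (dot u c)) = \<zero>\<^bsub>F\<^esub>" by (simp add: G_def laurent_simps fun_eq_iff)
    moreover have "{c'. co g (dot u c) c' \<noteq> 0} \<subseteq> {a. \<forall>i. 0 \<le> a $ i}"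
      using g(2) by (auto simp: co_def split: if_splits)
    ultimately have "co g (dot u c) = (\<lambda>c. 0)" using co_fin[OF g(1)] by (intro indep)
    then have "co g (dot u c) c = 0" by simp
    then show "g c = 0" by (simp add: co_def)
  qed
  obtain N where N: "{a. f a \<noteq> 0} \<subseteq> box N" using finite_subset_box[OF f(1)] by blast
  \<comment> \<open>The support lies in the cube of radius \<open>N\<close>, so a shift by
    \<open>N\<close> in every coordinate leaves no negative exponent.\<close>
  define v :: "(int, 'n) vec" where "v = (\<chi> i. int N)"
  let ?g = "f \<otimes>\<^bsub>quantum_torus (L - wedge t u)\<^esub> torus_monom v 1"
  have gfin: "finite {a. ?g a \<noteq> 0}" using f(1) by (intro quantum_torus_mult_closed) auto
  have gc: "?g c = q_half powi (bil (L - wedge t u) (c - v) v) * f (c - v)" for c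
  proof -
    have "?g c = (\<Sum>b\<in>{v}. q_half powi (bil (L - wedge t u) (c - b) b) * f (c - b) * torus_monom v 1 b)"
      by (rule quantum_torus_mult_alt[OF f(1)]) (auto simp: torus_monom_def)
    then show ?thesis by (simp add: torus_monom_def)
  qed
  have "{a. ?g a \<noteq> 0} \<subseteq> {a. \<forall>i. 0 \<le> a $ i}"
  proof
    fix a assume "a \<in> {a. ?g a \<noteq> 0}"
    then have "a - v \<in> box N" using N by (auto simp: gc)
    then have "- int N \<le> (a - v) $ i" for i by (simp add: box_def)
    then show "a \<in> {a. \<forall>i. 0 \<le> a $ i}" by (simp add: v_def)
  qed
  moreover have "S'.lincomb ?g = \<zero>\<^bsub>D\<^esub>"
    using f by (simp add: S'.lincomb_mult)
  ultimately have "?g = (\<lambda>c. 0)" using gfin by (intro nonneg)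
  then have "f (c - v) = 0" for c using gc[of c] by simp
  from this[of "c + v" for c] show ?thesis by (auto simp: fun_eq_iff)
qed

text \<open>Only the products \<open>x\<^sub>k x\<^sub>k'\<close> are sums of monomials with nonnegative exponents; the statements
  about \<open>x\<^sub>k'\<close> follow by cancelling \<open>x\<^sub>k\<close>.\<close>

lemma twist_exchange:
  assumes B: "skew_symmetric B" and k: "k \<in> mut"
    and t: "is_grading mut B t" and u: "is_grading mut B u"
    and xk': "S.M (b_plus B k) \<oplus>\<^bsub>F\<^esub> S.M (b_minus B k) \<in> C"
  shows "eigen (dot t (b_minus B k)) (S.M (b_plus B k) \<oplus>\<^bsub>F\<^esub> S.M (b_minus B k))"
    and "S'.M (b_plus B k) \<oplus>\<^bsub>D\<^esub> S'.M (b_minus B k) =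
      twist (dot t (b_minus B k)) (dot u (b_minus B k)) (S.M (b_plus B k) \<oplus>\<^bsub>F\<^esub> S.M (b_minus B k))"
proof -
  let ?p = "b_plus B k" and ?m = "b_minus B k" and ?e = "axis k 1 :: (int, 'n) vec"
  let ?x = "S.M ?p \<oplus>\<^bsub>F\<^esub> S.M ?m" and ?tb = "dot t (b_minus B k)" and ?ub = "dot u (b_minus B k)"
  \<comment> \<open>Both exchange monomials have the same degrees because \<open>t\<close> and
    \<open>u\<close> are gradings; otherwise their sum need not be an eigenvector, nor its twist
    involve a single power of \<open>z\<close>.\<close>
  have tp: "dot t ?p = ?tb" and up: "dot u ?p = ?ub"
    using dot_b_plus_minus[OF B _ k] t u by auto
  have xC: "x k \<in> C" using x_eigen by (rule eigen_closed)
  have P: "eigen (t $ k + ?tb) (S.M (?e + b)) \<and> S'.M (?e + b) = twist (t $ k + ?tb) (u $ k + ?ub) (S.M (?e + b))"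
    if "b = ?p \<or> b = ?m" for b
    using that M_twist[of "?e + b"] b_plus_minus_nonneg[of k B]
    by (auto simp: dot_add_right tp up)
  have prod: "x k \<otimes>\<^bsub>F\<^esub> ?x = q_half powi (bil L ?e ?p) \<odot>\<^bsub>F\<^esub> S.M (?e + ?p) \<oplus>\<^bsub>F\<^esub> q_half powi (bil L ?e ?m) \<odot>\<^bsub>F\<^esub> S.M (?e + ?m)"
    using S.M_mult[of ?e ?p] S.M_mult[of ?e ?m] by (simp add: F.r_distr)
  have ep: "eigen (t $ k + ?tb) (x k \<otimes>\<^bsub>F\<^esub> ?x)"
    unfolding prod using P by (intro eigen_add eigen_smult) auto
  \<comment> \<open>The monomials in \<open>?x\<close> need not lie in \<open>C\<close> separately.
    Evaluating \<open>\<tau>\<close> on the product of \<open>x k\<close> and \<open>?x\<close> in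
    two ways determines \<open>\<tau> ?x\<close> after cancelling \<open>x k\<close>.\<close>
  have "x k \<otimes>\<^bsub>F\<^esub> (q_half powi (2 * t $ k) \<odot>\<^bsub>F\<^esub> \<tau> ?x) = \<tau> (x k) \<otimes>\<^bsub>F\<^esub> \<tau> ?x"
    using x_eigen[of k] xk' by (simp add: eigen_def F.smult_mult_left F.smult_mult_right tau_simps)
  also have "\<dots> = \<tau> (x k \<otimes>\<^bsub>F\<^esub> ?x)" using xC xk' by (simp add: tau_simps)
  also have "\<dots> = q_half powi (2 * (t $ k + ?tb)) \<odot>\<^bsub>F\<^esub> (x k \<otimes>\<^bsub>F\<^esub> ?x)"
    using ep unfolding eigen_def by blast
  also have "\<dots> = x k \<otimes>\<^bsub>F\<^esub> (q_half powi (2 * t $ k) \<odot>\<^bsub>F\<^esub> (q_half powi (2 * ?tb) \<odot>\<^bsub>F\<^esub> ?x))"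
    by (simp add: F.smult_mult_right distrib_left)
  finally have "q_half powi (2 * t $ k) \<odot>\<^bsub>F\<^esub> \<tau> ?x = q_half powi (2 * t $ k) \<odot>\<^bsub>F\<^esub> (q_half powi (2 * ?tb) \<odot>\<^bsub>F\<^esub> ?x)"
    by (rule F.left_cancel[rotated -1]) (use xk' in \<open>auto simp: tau_simps(1)\<close>)
  then have "\<tau> ?x = q_half powi (2 * ?tb) \<odot>\<^bsub>F\<^esub> ?x"
    by (rule F.K_smult_cancel[rotated 2]) (use xk' in \<open>auto simp: tau_simps(1)\<close>)
  then show ex: "eigen ?tb ?x" using xk' by (simp add: eigen_def)
  let ?d = "u $ k * ?tb - t $ k * ?ub"
  \<comment> \<open>The discrepancy \<open>?d\<close> is the same for both monomials, so it comes
    out of the exchange relation as a single scalar.\<close>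
  have bil': "bil (L - wedge t u) ?e b = ?d + bil L ?e b" if "b = ?p \<or> b = ?m" for b
    using that by (auto simp: bil_wedge tp up)
  have MC: "S.M (?e + ?p) \<in> C" "S.M (?e + ?m) \<in> C" using P[of ?p] P[of ?m] by auto
  have "y k \<otimes>\<^bsub>D\<^esub> twist ?tb ?ub ?x = q_half powi ?d \<odot>\<^bsub>D\<^esub> twist (t $ k + ?tb) (u $ k + ?ub) (x k \<otimes>\<^bsub>F\<^esub> ?x)"
    unfolding y_def by (rule twist_mult[OF x_eigen ex])
  also have "\<dots> = q_half powi (?d + bil L ?e ?p) \<odot>\<^bsub>D\<^esub> S'.M (?e + ?p) \<oplus>\<^bsub>D\<^esub> q_half powi (?d + bil L ?e ?m) \<odot>\<^bsub>D\<^esub> S'.M (?e + ?m)"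
    unfolding prod using P MC by (simp add: twist_add twist_smult C_ops D.K_smult_add_right)
  also have "\<dots> = y k \<otimes>\<^bsub>D\<^esub> (S'.M ?p \<oplus>\<^bsub>D\<^esub> S'.M ?m)"
    using S'.M_mult[of ?e ?p] S'.M_mult[of ?e ?m] by (simp add: D.r_distr bil')
  finally show "S'.M ?p \<oplus>\<^bsub>D\<^esub> S'.M ?m = twist ?tb ?ub ?x"
    by (rule D.left_cancel[rotated -1, symmetric]) (use xk' in auto)
qed

end



section \<open>Mutation of twisted seeds\<close>

lemma mutate_simps [simp]:
  "cluster (mutate F mut k T) = (cluster T)(k := qmonomial F (cluster T) (qform T) (b_plus (exch T) k)
     \<oplus>\<^bsub>F\<^esub> qmonomial F (cluster T) (qform T) (b_minus (exch T) k))"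
  "exch (mutate F mut k T) =
     reset_frozen mut (mutation_matrix (exch T) k ** exch T ** transpose (mutation_matrix (exch T) k))"
  "qform (mutate F mut k T) =
     transpose (mutation_matrix (exch T) k) ** qform T ** mutation_matrix (exch T) k"
  by (simp_all add: mutate_def Let_def)

text \<open>These are conditions that survive mutation by computation alone: q-commutation of
  nonzero entries stands in for the requirement that \<open>F\<close> be the skew-field of fractions
  of the current torus.\<close>

definition valid_seed ::
    "(qfield, 'a) module \<Rightarrow> 'n set \<Rightarrow> ('n::{finite,linorder}, 'a) seed \<Rightarrow> bool"
  where "valid_seed F mut T \<longleftrightarrow>
    q_commuting F (cluster T) (qform T) \<and> skew_symmetric (exch T) \<and> compatible mut (exch T) (qform T)"

lemma valid_seed_mutate:
  assumes "valid_seed F mut T" "k \<in> mut"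
  shows "valid_seed F mut (mutate F mut k T)"
  unfolding valid_seed_def mutate_simps
  using assms unfolding valid_seed_def
  by (intro conjI q_commuting.q_commuting_mutation skew_symmetric_reset_frozen
      skew_symmetric_congruence' compatible_mutation) auto

lemma valid_seed_mutation_class:
  assumes "valid_seed F mut S" "T \<in> mutation_class F mut S"
  shows "valid_seed F mut T"
  using assms(2) by induction (auto intro: assms(1) valid_seed_mutate)

lemma graded_quantum_seed_valid:
  assumes "graded_quantum_seed F mut S"
  shows "valid_seed F mut S"
  using assms q_commuting_of_fractions unfolding graded_quantum_seed_def valid_seed_def by blast

lemma cluster_mutation_class:
  assumes "T \<in> mutation_class F mut S"
  shows "cluster T i \<in> K_subalgebra_generated F (quantum_cluster_variables F mut S)"
proof -
  have "cluster T i \<in> quantum_cluster_variables F mut S"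
    using assms by (auto simp: quantum_cluster_variables_def)
  then show ?thesis by (auto simp: K_subalgebra_generated_def)
qed

text \<open>Negative exponents involve inverses taken in the restricted structure, so agreement with
  the ambient monomials rests on comparing the two inverses.\<close>

lemma (in q_commuting) qmonomial_restrict:
  assumes H: "K_subalgebra H F" "\<And>y. \<lbrakk>y \<in> H; y \<noteq> \<zero>\<rbrakk> \<Longrightarrow> inv y \<in> H" "range x \<subseteq> H"
  shows "qmonomial (F\<lparr>carrier := H\<rparr>) x L a = M a"
proof -
  have nat: "x i [^]\<^bsub>F\<lparr>carrier := H\<rparr>\<^esub> (n :: nat) = x i [^] n" for i n
    by (simp add: nat_pow_def)
  have nz: "x i [^] (n :: nat) \<noteq> \<zero>" for i n
    using int_pow_nonzero[of "x i" "int n"] by (simp only: int_pow_int x_closed x_nonzero simp_thms)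
  have mem: "x i [^] (n :: nat) \<in> H" for i n
    by (induction n) (use H(3) K_subalgebraD(3,4)[OF H(1)] in \<open>auto simp: image_subset_iff\<close>)
  have "x i [^]\<^bsub>F\<lparr>carrier := H\<rparr>\<^esub> (m :: int) = x i [^] m" for i m
    unfolding int_pow_def2 nat using K_skew_field_restrict(2)[OF H(1,2) mem nz] by (simp del: pow_nat)
  then show ?thesis by (simp add: qmonomial_def)
qed

lemma (in q_commuting) M_in_subfield:
  assumes "K_subalgebra H F" "\<And>y. \<lbrakk>y \<in> H; y \<noteq> \<zero>\<rbrakk> \<Longrightarrow> inv y \<in> H" "range x \<subseteq> H"
  shows "M a \<in> H"
  using lincomb_in_subfield[OF assms finite_support_torus_monom, of a 1] by simp

context skew_laurent_embedding
begin

text \<open>The vectors \<open>t\<close> and \<open>u\<close> are the gradings of the seed at hand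
  and change from seed to seed, which is what lets the relation pass through mutation.\<close>

definition twist_related ::
    "'n set \<Rightarrow> (int, 'n) vec \<Rightarrow> (int, 'n) vec \<Rightarrow> ('n::{finite,linorder}, 'a) seed \<Rightarrow> ('n, 'd) seed \<Rightarrow> bool"
  where "twist_related mut t u T T' \<longleftrightarrow>
    valid_seed F mut T \<and> is_grading mut (exch T) t \<and> is_grading mut (exch T) u \<and>
    (\<forall>i. eigen (t $ i) (cluster T i)) \<and>
    (\<forall>i. cluster T' i = twist (t $ i) (u $ i) (cluster T i)) \<and>
    exch T' = exch T \<and> qform T' = qform T - wedge t u"

text \<open>By \<open>twist_exchange\<close> the new variable is the twist of its untwisted
  counterpart in the degrees of \<open>b_minus\<close>, which are the entries at \<open>k\<close> of
  the mutated gradings. On the twisted side mutation takes place in a skew-subfield with carrier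
  \<open>H\<close>, whose monomials are those of \<open>D\<close>.\<close>

lemma twist_related_mutate:
  assumes rel: "twist_related mut t u T T'" and k: "k \<in> mut"
    and C': "cluster (mutate F mut k T) k \<in> C"
    and H: "K_subalgebra H D" "\<And>y. \<lbrakk>y \<in> H; y \<noteq> \<zero>\<^bsub>D\<^esub>\<rbrakk> \<Longrightarrow> inv\<^bsub>D\<^esub> y \<in> H" "range (cluster T') \<subseteq> H"
  shows "twist_related mut (transpose (mutation_matrix (exch T) k) *v t)
      (transpose (mutation_matrix (exch T) k) *v u) (mutate F mut k T) (mutate (D\<lparr>carrier := H\<rparr>) mut k T')"
    and "range (cluster (mutate (D\<lparr>carrier := H\<rparr>) mut k T')) \<subseteq> H"
proof -
  let ?B = "exch T" and ?T2 = "mutate F mut k T" and ?T2' = "mutate (D\<lparr>carrier := H\<rparr>) mut k T'"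
  have valid: "q_commuting F (cluster T) (qform T)" "skew_symmetric ?B"
    and gr: "is_grading mut ?B t" "is_grading mut ?B u"
    and eig: "\<And>i. eigen (t $ i) (cluster T i)"
    and cl: "\<And>i. cluster T' i = twist (t $ i) (u $ i) (cluster T i)"
    and ex: "exch T' = ?B" and qf: "qform T' = qform T - wedge t u"
    using rel by (auto simp: twist_related_def valid_seed_def)
  interpret S: q_commuting F "cluster T" "qform T" by (rule valid)
  interpret W: twisted_tuple F D C \<tau> \<iota> "cluster T" "qform T" t u
    by unfold_locales (rule eig)
  have y: "W.y = cluster T'" by (auto simp: W.y_def cl)
  have M: "qmonomial (D\<lparr>carrier := H\<rparr>) (cluster T') (qform T') a = W.S'.M a" for a
    using W.S'.qmonomial_restrict[of H a] H by (simp add: y qf)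
  have MH: "W.S'.M a \<in> H" for a
    using W.S'.M_in_subfield[of H a] H by (simp add: y)
  have C'': "S.M (b_plus ?B k) \<oplus>\<^bsub>F\<^esub> S.M (b_minus ?B k) \<in> C" using C' by simp
  note tw = W.twist_exchange[OF valid(2) k gr C'']
  show "range (cluster ?T2') \<subseteq> H"
    using H(3) K_subalgebraD(5)[OF H(1) MH MH] by (auto simp: M ex)
  have "eigen ((transpose (mutation_matrix ?B k) *v t) $ i) (cluster ?T2 i)" for i
    using tw(1) eig unfolding transpose_mutation_vec[OF valid(2)] by simp
  moreover have "cluster ?T2' i = twist ((transpose (mutation_matrix ?B k) *v t) $ i)
      ((transpose (mutation_matrix ?B k) *v u) $ i) (cluster ?T2 i)" for i
    using tw(2) cl unfolding transpose_mutation_vec[OF valid(2)] by (simp add: M ex)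
  moreover have "valid_seed F mut ?T2"
    using rel k by (auto simp: twist_related_def intro: valid_seed_mutate)
  moreover have "is_grading mut (exch ?T2) (transpose (mutation_matrix ?B k) *v v)"
    if "is_grading mut ?B v" for v
    unfolding mutate_simps using that k by (rule is_grading_mutation)
  then have "is_grading mut (exch ?T2) (transpose (mutation_matrix ?B k) *v t)"
    "is_grading mut (exch ?T2) (transpose (mutation_matrix ?B k) *v u)"
    using gr by blast+
  moreover have "exch ?T2' = exch ?T2" by (simp only: mutate_simps ex)
  moreover have "qform ?T2' = qform ?T2 - wedge (transpose (mutation_matrix ?B k) *v t)
      (transpose (mutation_matrix ?B k) *v u)"
    by (simp only: mutate_simps ex qf congruence_wedge)
  ultimately show "twist_related mut (transpose (mutation_matrix ?B k) *v t)
      (transpose (mutation_matrix ?B k) *v u) ?T2 ?T2'"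
    unfolding twist_related_def by blast
qed

lemma twist_related_mutation_class:
  assumes rel: "twist_related mut t u S S'"
    and C': "\<And>T i. T \<in> mutation_class F mut S \<Longrightarrow> cluster T i \<in> C"
    and H: "K_subalgebra H D" "\<And>y. \<lbrakk>y \<in> H; y \<noteq> \<zero>\<^bsub>D\<^esub>\<rbrakk> \<Longrightarrow> inv\<^bsub>D\<^esub> y \<in> H" "range (cluster S') \<subseteq> H"
    and T': "T' \<in> mutation_class (D\<lparr>carrier := H\<rparr>) mut S'"
  shows "range (cluster T') \<subseteq> H \<inter> \<iota> ` carrier R"
proof -
  \<comment> \<open>The gradings are existentially quantified, since each mutation replaces
    them.\<close>
  have "range (cluster T') \<subseteq> H \<and> (\<exists>T t u. T \<in> mutation_class F mut S \<and> twist_related mut t u T T')"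
    using T'
  proof induction
    case initial
    then show ?case using rel H(3) mutation_class.initial by blast
  next
    case (step T' k)
    then obtain T t u where T: "T \<in> mutation_class F mut S" "twist_related mut t u T T'" by blast
    have T2: "mutate F mut k T \<in> mutation_class F mut S"
      using T(1) step(2) by (rule mutation_class.step)
    have rH: "range (cluster T') \<subseteq> H" using step by simp
    note * = twist_related_mutate[OF T(2) step(2) C'[OF T2] H(1,2) rH]
    show ?case using *(2) T2 *(1) by blast
  qed
  then obtain T t u where *: "range (cluster T') \<subseteq> H" "twist_related mut t u T T'" by blast
  have "cluster T' i \<in> \<iota> ` carrier R" for i
  proof -
    have "cluster T' i = twist (t $ i) (u $ i) (cluster T i)" "eigen (t $ i) (cluster T i)"
      using *(2) by (auto simp: twist_related_def)
    then show ?thesis using twist_in_image[OF eigen_closed] by metis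
  qed
  then show ?thesis using *(1) by blast
qed

end

theorem theorem4p6:
  fixes F A :: "(qfield, 'a) module"
    and mut :: "('n::{finite,linorder}) set"
    and S :: "('n, 'a) seed"
    and t u :: "int^('n::{finite,linorder})"
    and \<tau> :: "'a \<Rightarrow> 'a"
    and D F' :: "(qfield, 'd) module"
    and \<iota> :: "(int \<Rightarrow> 'a) \<Rightarrow> 'd"
    and S' :: "('n, 'd) seed"
  assumes "graded_quantum_seed F mut S"
    and "is_grading mut (exch S) t"
    and "is_grading mut (exch S) u"
    and "A = quantum_cluster_algebra F mut S"
    and "K_algebra_automorphism A \<tau>"
    and "\<forall>i. \<tau> (cluster S i) = q_param powi (t $ i) \<odot>\<^bsub>A\<^esub> cluster S i"
    and "skew_field_of_fractions (skew_laurent A \<tau>) D \<iota>"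
    and "S' = map_seed \<iota> (twisted_seed A \<tau> S t u)"
    and "F' = D\<lparr>carrier := K_skew_subfield_generated D (range (cluster S'))\<rparr>"
  shows "graded_quantum_seed F' mut S' \<and>
         K_subalgebra (carrier (quantum_cluster_algebra F' mut S'))
           (D\<lparr>carrier := \<iota> ` carrier (skew_laurent A \<tau>)\<rparr>)"
proof -
  define C where "C = K_subalgebra_generated F (quantum_cluster_variables F mut S)"
  define G where "G = K_skew_subfield_generated D (range (cluster S'))"
  have A: "A = F\<lparr>carrier := C\<rparr>" using assms(4) by (simp add: quantum_cluster_algebra_def C_def)
  obtain \<phi> where \<phi>: "skew_field_of_fractions (quantum_torus (qform S)) F \<phi>"
      "\<And>i. \<phi> (torus_gen i) = cluster S i"
    and seed: "skew_symmetric (qform S)" "skew_symmetric (exch S)"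
      "\<forall>i j. i \<notin> mut \<and> j \<notin> mut \<longrightarrow> exch S $ i $ j = 0" "compatible mut (exch S) (qform S)"
      "is_grading mut (exch S) (grading S)"
    using assms(1) unfolding graded_quantum_seed_def by blast
  have valid: "valid_seed F mut S" using assms(1) by (rule graded_quantum_seed_valid)
  interpret S: q_commuting F "cluster S" "qform S" using valid by (simp add: valid_seed_def)
  \<comment> \<open>Were some variable outside the carrier, no subalgebra would contain the
    generators and the intersection defining \<open>C\<close> would be the whole type.\<close>
  have "quantum_cluster_variables F mut S \<subseteq> carrier F"
  proof
    fix x assume "x \<in> quantum_cluster_variables F mut S"
    then obtain T i where T: "T \<in> mutation_class F mut S" "x = cluster T i"
      by (auto simp: quantum_cluster_variables_def)
    then have "q_commuting F (cluster T) (qform T)"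
      using valid_seed_mutation_class[OF valid] by (auto simp: valid_seed_def)
    then show "x \<in> carrier F" using T(2) q_commuting.x_closed by blast
  qed
  then have C: "K_subalgebra C F" unfolding C_def by (rule S.K_subalgebra_generated_subalgebra)
  have clC: "cluster T i \<in> C" if "T \<in> mutation_class F mut S" for T i
    using that unfolding C_def by (rule cluster_mutation_class)
  have D: "K_skew_field D" and emb: "K_algebra (skew_laurent A \<tau>)" "\<iota> \<in> K_algebra_hom (skew_laurent A \<tau>) D"
    "inj_on \<iota> (carrier (skew_laurent A \<tau>))"
    using assms(7) by (auto simp: skew_field_of_fractions_def)
  interpret E: skew_laurent_embedding F D C \<tau> \<iota>
    using D C assms(5) emb unfolding A
    by (intro skew_laurent_embedding.intro skew_laurent_embedding_axioms.intro S.K_skew_field_axioms)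
  have eig: "E.eigen (t $ i) (cluster S i)" for i
    using assms(6) clC[OF mutation_class.initial] by (simp add: E.eigen_def A q_param_powi)
  interpret W: twisted_tuple F D C \<tau> \<iota> "cluster S" "qform S" t u
    by unfold_locales (rule eig)
  have S': "exch S' = exch S" "qform S' = qform S - wedge t u" "grading S' = grading S + u"
    using assms(8) by (simp_all add: map_seed_def twisted_seed_def)
  have clS': "cluster S' = W.y"
  proof
    fix i
    have "cluster S' i = \<iota> (q_half powi (t $ i * u $ i) \<odot>\<^bsub>E.R\<^esub> E.lmon (cluster S i) (u $ i))"
      using assms(8) by (simp add: map_seed_def twisted_seed_def A)
    also have "\<dots> = W.y i"
      using clC[OF mutation_class.initial] by (simp add: W.y_def E.twist_def E.lmon_smult)
    finally show "cluster S' i = W.y i" .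
  qed
  have F': "F' = D\<lparr>carrier := G\<rparr>" using assms(9) by (simp add: G_def)
  have "skew_field_of_fractions (quantum_torus (qform S')) F' W.S'.lincomb"
    unfolding F' G_def clS' S'(2)
  proof (rule W.S'.quantum_torus_fractions, rule W.independent)
    fix f assume "finite {a. f a \<noteq> (0 :: qfield)}" "{a. f a \<noteq> 0} \<subseteq> {a. \<forall>i. 0 \<le> a $ i}"
      "S.lincomb f = \<zero>\<^bsub>F\<^esub>"
    then show "f = (\<lambda>c. 0)" by (rule qmonomials_independent[OF \<phi> seed(1)])
  qed
  moreover have "\<forall>i. W.S'.lincomb (torus_gen i) = cluster S' i"
    by (simp add: W.S'.lincomb_gen clS')
  ultimately have gqs: "graded_quantum_seed F' mut S'"
    unfolding graded_quantum_seed_def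
    using seed W.S'.L_skew compatible_wedge[OF seed(2,4) assms(2,3)] is_grading_add[OF seed(5) assms(3)]
    by (auto simp: S')
  have "range (cluster S') \<subseteq> carrier D" by (auto simp: clS')
  note G = E.D.K_skew_subfield_generated_props[OF this, folded G_def]
  have rel: "E.twist_related mut t u S S'"
    unfolding E.twist_related_def using valid assms(2,3) eig S' by (simp add: clS' W.y_def)
  have I: "K_subalgebra (\<iota> ` carrier E.R) D"
    by (rule E.D.K_subalgebra_hom_image[OF E.iota_hom E.laurent_algebra])
  have "cluster T i \<in> G \<inter> \<iota> ` carrier E.R" if "T \<in> mutation_class F' mut S'" for T i
    using E.twist_related_mutation_class[OF rel clC G(1,3,2), of T] that unfolding F' by blast
  then have vars: "quantum_cluster_variables F' mut S' \<subseteq> G \<inter> \<iota> ` carrier E.R"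
    by (auto simp: quantum_cluster_variables_def)
  interpret F': K_algebra F' unfolding F' by (rule E.D.K_algebra_restrict[OF G(1)])
  let ?Q = "K_subalgebra_generated F' (quantum_cluster_variables F' mut S')"
  \<comment> \<open>The generated algebra is formed inside \<open>F'\<close>, with carrier
    \<open>G\<close>, but has to lie in the image of the skew-Laurent ring. The intersection is a
    subalgebra of \<open>F'\<close> that contains all variables, so it bounds the generated algebra
    on both sides.\<close>
  have "K_subalgebra (G \<inter> \<iota> ` carrier E.R) D"
    using E.D.K_subalgebra_Inter[of "{G, \<iota> ` carrier E.R}"] G(1) I by auto
  then have "K_subalgebra (G \<inter> \<iota> ` carrier E.R) F'"
    unfolding F' by (simp add: E.D.K_subalgebra_restrict_iff[OF G(1)])
  then have sub: "?Q \<subseteq> G \<inter> \<iota> ` carrier E.R"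
    using vars by (rule F'.K_subalgebra_generated_least)
  have "K_subalgebra ?Q F'"
    using vars by (intro F'.K_subalgebra_generated_subalgebra) (auto simp: F')
  then have "K_subalgebra ?Q D"
    unfolding F' by (simp add: E.D.K_subalgebra_restrict_iff[OF G(1)])
  then have "K_subalgebra ?Q (D\<lparr>carrier := \<iota> ` carrier E.R\<rparr>)"
    using sub by (simp add: E.D.K_subalgebra_restrict_iff[OF I])
  then show ?thesis using gqs by (simp add: quantum_cluster_algebra_def A)
qed

end
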